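(* Let $d\ge1$, let $\phi:[0,1)^d\to\mathbb{R}$ be measurable, let $X=\phi(\bm u)$ with $\bm u$ uniformly distributed on $[0,1)^d$, let $F$ be the cumulative distribution function of $X$, let $p\in(0,1)$, $v=\inf\{x\in\mathbb{R}:F(x)\ge p\}$ and $c=v-\frac1p\mathbb{E}[(v-X)^+]$. Put $\Omega_x=\{\bm u\in[0,1)^d:\phi(\bm u)\le x\}$. Assume: (A) $X$ has a density $f_X$ in a neighborhood of $v$, and $f_X$ is positive and continuous at $v$. (B) There exist a positive nondecreasing function $g(\epsilon)$, defined for $\epsilon>0$, with $\lim_{\epsilon\to0_+}g(\epsilon)=0$, and constants $\delta,\epsilon_0>0$ such that $\sup_{x:\,|x-v|\le\delta}\lambda_d\big((\partial\Omega_x)_\epsilon\big)\le g(\epsilon)$ for every $0<\epsilon\le\epsilon_0$. (C) The function $\bm u\mapsto(v-\phi(\bm u))^+$ belongs to $L^2([0,1)^d)$. Let $b\ge2$ and $t\ge0$ be integers, and for $m\ge t$ let $N=b^m$ and let $\{\bm u_1,\dots,\bm u_N\}$ be a scrambled $(t,m,d)$-net in base $b$. Define $$\hat F_N(x)=\frac1N\sum_{i=1}^N\bm 1\{\phi(\bm u_i)\le x\},\qquad \hat K_N(x)=\frac1N\sum_{i=1}^N(x-\phi(\bm u_i))^+,$$ $$\hat v_N=\inf\{x\in\mathbb{R}:\hat F_N(x)\ge p\},\qquad \hat c_N=\hat v_N-\frac1p\hat K_N(\hat v_N).$$ Then: (1) For $N$ large enough, $$\mathbb{E}[(\hat c_N-c)^2]\le\frac{2}{p^2}\mathrm{Var}[\hat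 K_N(v)]+a_N\left(\frac{4}{N^2}+\mathrm{Var}[\hat F_N(v)]\right),$$ where $$a_N:=8\left[\frac{g(\sqrt d\,b^{1+t/d}N^{-1/d})}{p f_X(v)}\right]^2\to0\quad\text{as }N\to\infty.$$ (2) In particular, $\mathbb{E}[(\hat c_N-c)^2]=o(1/N)$ as $N=b^m\to\infty$. (3) If moreover $\phi$ is of bounded variation in the sense of Hardy and Krause and (B) holds with $g(\epsilon)=\kappa\epsilon$ for some constant $\kappa>0$, then $\mathbb{E}[(\hat c_N-c)^2]=O(N^{-1-1/(2d-1)+\epsilon})$ for arbitrarily small $\epsilon>0$.
   Context: $x^+=\max\{x,0\}$. $\lambda_d$ is Lebesgue measure on $\mathbb{R}^d$, and $\partial\Omega$ is the topological boundary in $\mathbb{R}^d$. For $A\subset\mathbb{R}^d$ and $\epsilon>0$, $(A)_\epsilon=\{\bm x\in\mathbb{R}^d:\|\bm x-\bm y\|_2\le\epsilon\text{ for some }\bm y\in A\}$ (Euclidean norm), with $(\varnothing)_\epsilon=\varnothing$. "$X$ has a density $f_X$ in a neighborhood of $v$" means that on some open interval $J\ni v$ one has $F(y)-F(x)=\int_x^y f_X(s)\,ds$ for $x<y$ in $J$. An elementary interval in base $b$ is a set $\prod_{j=1}^d\big[t_jb^{-k_j},(t_j+1)b^{-k_j}\big)$ with integers $k_j\ge0$ and $0\le t_j<b^{k_j}$; its volume is $b^{-\sum_j k_j}$. For integers $0\le t\le m$, a $(t,m,d)$-net in base $b$ is a set of $b^m$ points (counted with multiplicity) in $[0,1)^d$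 such that every elementary interval in base $b$ of volume $b^{t-m}$ contains exactly $b^t$ of the points. A scrambled $(t,m,d)$-net is the random point set obtained from a $(t,m,d)$-net $\{\bm a_1,\dots,\bm a_N\}$ in base $b$ by Owen's nested uniform scrambling: write the $j$-th coordinate of $\bm a_i$ in base $b$ as $\sum_{k\ge1}a_{ijk}b^{-k}$ and set the $j$-th coordinate of $\bm u_i$ to be $\sum_{k\ge1}u_{ijk}b^{-k}$ with $u_{ij1}=\pi_j(a_{ij1})$ and $u_{ijk}=\pi_{j,a_{ij1},\dots,a_{ij(k-1)}}(a_{ijk})$ for $k\ge2$, where all the permutations $\pi_{j}$, $\pi_{j,a_1,\dots,a_{k-1}}$ of $\{0,\dots,b-1\}$ are mutually independent and each is uniformly distributed over the $b!$ permutations. Each scrambled point is uniformly distributed on $[0,1)^d$. The integers $b,t,d$ are fixed and asymptotics are as $m\to\infty$; $\mathbb{E}$ and $\mathrm{Var}$ are with respect to the scrambling. In (3) the implied constant may depend on $\epsilon$. Hardy–Krause variation: for $f:[0,1]^d\to\mathbb{R}$, $V_{\mathrm{HK}}(f)=\sum_{\varnothing\ne w\subseteq\{1,\dots,d\}}V^{(w)}(f)$, where $V^{(w)}(f)$ is the Vitali variation over $[0,1]^{|w|}$ of the function obtained from $f$ by setting to $1$ all coordinates with index not in $w$; the Vitali variation of a function is the supremum, over all partitions of the cube into finite grids of boxes, of the sum of absolute values of the alternating sums of the function over the vertices of the boxes. A function on $[0,1)^d$ is of bounded variation in the sense of Hardy and Krause if it is the restriction of a function on $[0,1]^d$ with $V_{\mathrm{HK}}<\infty$.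 *)

theory Defs
  imports "HOL-Probability.Probability"
begin

text \<open>Throughout, the dimension $d$ is \<open>CARD('d)\<close>; the norm of \<open>real ^ 'd\<close> is the Euclidean one.\<close>

definition unit_cube :: "(real ^ 'd::finite) set" where
  "unit_cube = {x. \<forall>j. 0 \<le> x $ j \<and> x $ j < 1}"

text \<open>The cube has Lebesgue measure 1, so no normalisation is needed.\<close>

definition uniform_cube :: "(real ^ 'd::finite) measure" where
  "uniform_cube = restrict_space lborel unit_cube"

definition quantile :: "(real \<Rightarrow> real) \<Rightarrow> real \<Rightarrow> real" where
  "quantile F p = Inf {x. p \<le> F x}"

text \<open>A Henstock--Kurzweil integral: since \<open>F\<close> will be nondecreasing, it is a Lebesgue integral.\<close>

definition has_density_near :: "(real \<Rightarrow> real) \<Rightarrow> (real \<Rightarrow> real) \<Rightarrow> real \<Rightarrow> bool" where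
  "has_density_near F f v \<longleftrightarrow>
     (\<exists>J. open J \<and> is_interval J \<and> v \<in> J \<and>
       (\<forall>x\<in>J. \<forall>y\<in>J. x < y \<longrightarrow> (f has_integral (F y - F x)) {x..y}))"

definition thickening :: "(real ^ 'd::finite) set \<Rightarrow> real \<Rightarrow> (real ^ 'd) set" where
  "thickening A \<epsilon> = {x. \<exists>y\<in>A. norm (x - y) \<le> \<epsilon>}"

definition sublevel :: "(real ^ 'd::finite \<Rightarrow> real) \<Rightarrow> real \<Rightarrow> (real ^ 'd) set" where
  "sublevel \<phi> x = {u \<in> unit_cube. \<phi> u \<le> x}"

definition boundary_condition ::
  "(real ^ 'd::finite \<Rightarrow> real) \<Rightarrow> real \<Rightarrow> (real \<Rightarrow> real) \<Rightarrow> bool" where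
  "boundary_condition \<phi> v g \<longleftrightarrow>
     (\<forall>\<epsilon>>0. 0 < g \<epsilon>) \<and> mono_on {0<..} g \<and> (g \<longlongrightarrow> 0) (at_right 0) \<and>
     (\<exists>\<delta>>0. \<exists>\<epsilon>\<^sub>0>0. \<forall>\<epsilon>. 0 < \<epsilon> \<and> \<epsilon> \<le> \<epsilon>\<^sub>0 \<longrightarrow>
        (SUP x\<in>{x. \<bar>x - v\<bar> \<le> \<delta>}. emeasure lborel (thickening (frontier (sublevel \<phi> x)) \<epsilon>))
          \<le> ennreal (g \<epsilon>))"


subsection \<open>Nets and nested uniform scrambling\<close>

definition elementary_interval ::
  "nat \<Rightarrow> ('d::finite \<Rightarrow> nat) \<Rightarrow> ('d \<Rightarrow> nat) \<Rightarrow> (real ^ 'd) set" where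
  "elementary_interval b k \<tau> =
     {x. \<forall>j. real (\<tau> j) / real b ^ k j \<le> x $ j \<and> x $ j < (real (\<tau> j) + 1) / real b ^ k j}"

text \<open>The points are \<open>a i\<close> for \<open>i < b ^ m\<close>, possibly repeated. An elementary interval with exponents
  \<open>k\<close> has volume $b^{-\sum_j k_j}$, which is $b^{t-m}$ iff $\sum_j k_j + t = m$.\<close>

definition tmd_net :: "nat \<Rightarrow> nat \<Rightarrow> nat \<Rightarrow> (nat \<Rightarrow> real ^ 'd::finite) \<Rightarrow> bool" where
  "tmd_net b t m a \<longleftrightarrow> t \<le> m \<and> (\<forall>i<b ^ m. a i \<in> unit_cube) \<and>
     (\<forall>k \<tau>. (\<forall>j. \<tau> j < b ^ k j) \<and> (\<Sum>j\<in>UNIV. k j) + t = m \<longrightarrow>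
        card {i. i < b ^ m \<and> a i \<in> elementary_interval b k \<tau>} = b ^ t)"

text \<open>The digits (\<open>k \<ge> 1\<close>) of the base-\<open>b\<close> expansion of \<open>x \<in> [0,1)\<close> that is not
  eventually \<open>b - 1\<close>.\<close>

definition digit :: "nat \<Rightarrow> real \<Rightarrow> nat \<Rightarrow> nat" where
  "digit b x k = nat (\<lfloor>x * real b ^ k\<rfloor> mod int b)"

text \<open>The permutation applied to the \<open>k\<close>-th digit is indexed by the list of the preceding \<open>k - 1\<close>
  digits. The series takes the value 1, outside $[0,1)$, only if all scrambled digits are \<open>b - 1\<close>, an
  event of probability zero; \<open>frac\<close> sends this value to 0 and has no effect otherwise.\<close>

definition scramble_coord :: "nat \<Rightarrow> (nat list \<Rightarrow> nat \<Rightarrow> nat) \<Rightarrow> real \<Rightarrow> real" where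
  "scramble_coord b \<pi> x =
     frac (\<Sum>k. real (\<pi> (map (digit b x) [1..<Suc k]) (digit b x (Suc k))) / real b ^ Suc k)"

definition scramble ::
  "nat \<Rightarrow> ('d::finite \<Rightarrow> nat list \<Rightarrow> nat \<Rightarrow> nat) \<Rightarrow> real ^ 'd \<Rightarrow> real ^ 'd" where
  "scramble b \<pi> x = (\<chi> j. scramble_coord b (\<pi> j) (x $ j))"

definition iid_uniform_permutations ::
  "'w measure \<Rightarrow> nat \<Rightarrow> ('d::finite \<Rightarrow> nat list \<Rightarrow> 'w \<Rightarrow> nat \<Rightarrow> nat) \<Rightarrow> bool" where
  "iid_uniform_permutations M b \<pi> \<longleftrightarrow>
     prob_space.indep_vars M (\<lambda>_. count_space {\<sigma>. \<sigma> permutes {..<b}})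
       (\<lambda>(j, l). \<pi> j l) (UNIV \<times> lists {..<b}) \<and>
     (\<forall>j. \<forall>l\<in>lists {..<b}.
        distr M (count_space {\<sigma>. \<sigma> permutes {..<b}}) (\<pi> j l)
          = uniform_count_measure {\<sigma>. \<sigma> permutes {..<b}})"

definition scrambled_net ::
  "'w measure \<Rightarrow> nat \<Rightarrow> nat \<Rightarrow> nat \<Rightarrow> (nat \<Rightarrow> 'w \<Rightarrow> real ^ 'd::finite) \<Rightarrow> bool" where
  "scrambled_net M b t m u \<longleftrightarrow> prob_space M \<and>
     (\<exists>a \<pi>. tmd_net b t m a \<and> iid_uniform_permutations M b \<pi> \<and>
        (\<forall>i<b ^ m. \<forall>\<omega>\<in>space M. u i \<omega> = scramble b (\<lambda>j l. \<pi> j l \<omega>) (a i)))"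


subsection \<open>Hardy--Krause variation\<close>

text \<open>Alternating vertex sum, over the box with opposite corners \<open>lo\<close>, \<open>hi\<close> in the coordinates \<open>w\<close>, of
  the function obtained from \<open>f\<close> by setting the other coordinates to 1.\<close>

definition alternating_sum ::
  "(real ^ 'd::finite \<Rightarrow> real) \<Rightarrow> 'd set \<Rightarrow> ('d \<Rightarrow> real) \<Rightarrow> ('d \<Rightarrow> real) \<Rightarrow> real" where
  "alternating_sum f w lo hi =
     (\<Sum>S\<in>Pow w. (-1) ^ card S * f (\<chi> j. if j \<notin> w then 1 else if j \<in> S then lo j else hi j))"

text \<open>A grid is given by partitions $0 = s_{j,0} < \dots < s_{j,n_j} = 1$ for \<open>j \<in> w\<close>.\<close>

definition vitali_variation :: "(real ^ 'd::finite \<Rightarrow> real) \<Rightarrow> 'd set \<Rightarrow> ennreal" where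
  "vitali_variation f w =
     (SUP (n, s) \<in> {(n :: 'd \<Rightarrow> nat, s :: 'd \<Rightarrow> nat \<Rightarrow> real).
          \<forall>j\<in>w. s j 0 = 0 \<and> s j (n j) = 1 \<and> (\<forall>k<n j. s j k < s j (Suc k))}.
        \<Sum>k\<in>(\<Pi>\<^sub>E j\<in>w. {..<n j}).
          ennreal \<bar>alternating_sum f w (\<lambda>j. s j (k j)) (\<lambda>j. s j (Suc (k j)))\<bar>)"

definition hk_variation :: "(real ^ 'd::finite \<Rightarrow> real) \<Rightarrow> ennreal" where
  "hk_variation f = (\<Sum>w\<in>{w. w \<noteq> {}}. vitali_variation f w)"

text \<open>\<open>hk_variation f\<close> only involves the values of \<open>f\<close> on $[0,1]^d$.\<close>

definition bounded_hk_variation :: "(real ^ 'd::finite \<Rightarrow> real) \<Rightarrow> bool" where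
  "bounded_hk_variation \<phi> \<longleftrightarrow> (\<exists>f. (\<forall>u\<in>unit_cube. f u = \<phi> u) \<and> hk_variation f < \<infinity>)"

end

theory Submission
  imports Defs
begin

text \<open>The empirical objective \<open>x - K_N(x) / p\<close> is concave with supergradient \<open>1 - F_N(x) / p\<close> and
  maximal at the empirical quantile \<open>v_N\<close>, so its maximum \<open>c_N\<close> differs from its value at \<open>v\<close> by at most
  \<open>|v_N - v| |F_N(v) - p| / p\<close>. A scrambled net is almost surely a net, and a net represents the measure
  of a set up to the cells that meet its boundary; hence \<open>|F_N - F| \<le> g\<close> near \<open>v\<close>, and since the slope of
  \<open>F\<close> there is close to \<open>f_X(v)\<close>, almost surely \<open>|v_N - v| \<le> 2 g / f_X(v)\<close>. This gives (1), even
  without the term \<open>4 / N^2\<close>.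

  For (2) and (3), expand a function of finitely many digits into its Hoeffding components over sets
  of digits. Distinct components give uncorrelated sums over the scrambled net; components with few
  digits are integrated exactly, and for the others each point is correlated with at most \<open>b ^ (t + d)\<close>
  points. By density this bounds the variance of the average of any square integrable \<open>f\<close> by
  \<open>4 b ^ (t + d) / N\<close> times the integral of \<open>f^2\<close>. Functions constant on cubic cells of volume at least
  \<open>b ^ (t - m)\<close> may be subtracted from \<open>f\<close> at no cost, so the variance is \<open>o(1 / N)\<close>. When \<open>\<phi>\<close> has bounded
  Hardy--Krause variation it is within \<open>O(N ^ (- 1 / d))\<close> of such functions in mean square, which gives
  the rate \<open>N ^ (- 1 - 1 / d)\<close>, at least as good as the one in (3).\<close>

subsection \<open>Digits and cells\<close>

text \<open>The two variances in (1) play different roles: that of \<open>K_N(v)\<close> must itself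
  be o(1 / N), while O(1 / N) suffices for that of \<open>F_N(v)\<close>, since \<open>a_N\<close>
  tends to 0. The constant 8 in \<open>a_N\<close> is 2 times 2^2: the 2 comes from (x + y)^2 <= 2
  x^2 + 2 y^2, the 2^2 from the radius 2 g / f_X(v). The argument of g bounds the diameter of the
  cubic cells of side b^(-k) with k = (m - t) div d, the finest cubes whose points a net must count
  exactly. The obstacle is that scrambled points are dependent: two points share the permutations at
  all nodes of their common digit prefix. The analysis is therefore carried out on nodes, that is,
  pairs of a coordinate and a digit prefix. Within one Hoeffding component two points are
  uncorrelated as soon as they disagree on one node of the component; counting the points that agree
  on all of them loses at most one digit per coordinate, whence the exponent t + d. The factor 4 is
  the price of passing to the limit in mean square. Under bounded Hardy--Krause variation, the mean
  square distance to a step function is at most the supremum times the mean absolute distance, and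
  the latter is O(b^(-k)).\<close>

definition cell :: "nat \<Rightarrow> nat \<Rightarrow> real \<Rightarrow> nat" where
  "cell b k x = nat \<lfloor>x * real b ^ k\<rfloor>"

lemma cell_0: "0 \<le> x \<Longrightarrow> x < 1 \<Longrightarrow> cell b 0 x = 0"
  by (simp add: cell_def floor_eq_iff)

lemma digit_eq_cell_mod:
  assumes "0 \<le> x"
  shows "digit b x k = cell b k x mod b"
  using assms by (simp add: digit_def cell_def nat_mod_distrib)

lemma digit_less: "0 < b \<Longrightarrow> digit b x k < b"
  by (simp add: digit_def nat_less_iff)

lemma cell_Suc_div:
  assumes "0 < b"
  shows "cell b (Suc k) x div b = cell b k x"
proof -
  have "\<lfloor>x * real b ^ k\<rfloor> = \<lfloor>(x * real b ^ Suc k) / real_of_int (int b)\<rfloor>"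
    using assms by simp
  also have "\<dots> = \<lfloor>x * real b ^ Suc k\<rfloor> div int b"
    by (rule floor_divide_real_eq_div) simp
  finally show ?thesis
    by (simp add: cell_def nat_div_distrib' del: power_Suc)
qed

lemma cell_Suc:
  assumes "0 < b" "0 \<le> x"
  shows "cell b (Suc k) x = b * cell b k x + digit b x (Suc k)"
  using cell_Suc_div[OF assms(1), of k x] digit_eq_cell_mod[OF assms(2)] by (metis mult_div_mod_eq)

lemma cell_less:
  assumes "0 < b" "x < 1"
  shows "cell b k x < b ^ k"
proof -
  have "x * real b ^ k < real_of_int (int (b ^ k))"
    using assms by simp
  then have "\<lfloor>x * real b ^ k\<rfloor> < int (b ^ k)"
    using floor_less_iff by blast
  then show ?thesis
    using assms by (cases "0 \<le> \<lfloor>x * real b ^ k\<rfloor>") (simp_all add: cell_def nat_less_iff)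
qed

lemma cell_eq_iff:
  assumes "0 < b" "0 \<le> x"
  shows "cell b k x = n \<longleftrightarrow> real n / real b ^ k \<le> x \<and> x < (real n + 1) / real b ^ k"
proof -
  have "cell b k x = n \<longleftrightarrow> \<lfloor>x * real b ^ k\<rfloor> = int n"
    using assms by (auto simp: cell_def)
  also have "\<dots> \<longleftrightarrow> real n \<le> x * real b ^ k \<and> x * real b ^ k < real n + 1"
    by (simp add: floor_eq_iff)
  finally show ?thesis
    using assms by (simp add: pos_divide_le_eq pos_less_divide_eq)
qed

text \<open>By \<open>cell_Suc\<close>, the index at depth k is the number written by the first k
  digits. This links the geometric side (intervals) to the scrambling side (digit prefixes).\<close>

lemma cell_eq_iff_digits:
  assumes "0 < b" "0 \<le> x" "x < 1" "0 \<le> y" "y < 1"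
  shows "cell b k x = cell b k y \<longleftrightarrow> (\<forall>i<k. digit b x (Suc i) = digit b y (Suc i))"
proof (induction k)
  case 0
  then show ?case using assms by (simp add: cell_0)
next
  case (Suc k)
  have "cell b (Suc k) x = cell b (Suc k) y \<longleftrightarrow>
      cell b k x = cell b k y \<and> digit b x (Suc k) = digit b y (Suc k)"
  proof
    assume *: "cell b (Suc k) x = cell b (Suc k) y"
    then show "cell b k x = cell b k y \<and> digit b x (Suc k) = digit b y (Suc k)"
      using assms by (metis cell_Suc_div digit_eq_cell_mod)
  qed (use assms in \<open>simp add: cell_Suc\<close>)
  then show ?case using Suc by (auto simp: less_Suc_eq)
qed

lemma cell_eq_mono:
  assumes "0 < b" "0 \<le> x" "x < 1" "0 \<le> y" "y < 1" "cell b k x = cell b k y" "l \<le> k"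
  shows "cell b l x = cell b l y"
  using assms by (auto simp: cell_eq_iff_digits)

text \<open>Scrambling indexes its permutations by digit prefixes, so this says when two coordinates
  have their next digit moved by the same permutation.\<close>

lemma prefix_eq_iff:
  assumes "0 < b" "0 \<le> x" "x < 1" "0 \<le> y" "y < 1"
  shows "map (digit b x) [1..<Suc k] = map (digit b y) [1..<Suc k] \<longleftrightarrow> cell b k x = cell b k y"
proof -
  have "{1..<Suc k} = Suc ` {..<k}"
    by (auto simp: image_Suc_lessThan)
  then have "(\<forall>i<k. digit b x (Suc i) = digit b y (Suc i)) \<longleftrightarrow> (\<forall>i\<in>{1..<Suc k}. digit b x i = digit b y i)"
    by auto
  then show ?thesis
    unfolding cell_eq_iff_digits[OF assms, of k] map_eq_conv set_upt by simp
qed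


section \<open>Base-b series and the recovery of their digits\<close>

definition digit_tail :: "nat \<Rightarrow> (nat \<Rightarrow> nat) \<Rightarrow> nat \<Rightarrow> real" where
  "digit_tail b d k = (\<Sum>i. real (d (i + k)) / real b ^ Suc i)"

context
  fixes b :: nat and d :: "nat \<Rightarrow> nat"
  assumes b: "2 \<le> b" and d: "\<And>k. d k < b"
begin

lemma top_digits_sums: "(\<lambda>i. (real b - 1) / real b ^ Suc i) sums 1"
proof -
  have "(\<lambda>i. (1 / real b) ^ i) sums (1 / (1 - 1 / real b))"
    using b by (intro geometric_sums) simp
  then have "(\<lambda>i. (1 / real b) ^ i * ((real b - 1) / real b)) sums
      (1 / (1 - 1 / real b) * ((real b - 1) / real b))"
    by (rule sums_mult2)
  moreover have "1 / (1 - 1 / real b) * ((real b - 1) / real b) = 1"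
    using b by (simp add: field_simps)
  ultimately show ?thesis
    by (simp add: field_simps power_divide)
qed

lemma summable_digits: "summable (\<lambda>i. real (d (i + k)) / real b ^ Suc i)"
proof (rule summable_comparison_test'[OF sums_summable[OF top_digits_sums]])
  fix i
  have "real (d (i + k)) \<le> real b - 1"
    using d[of "i + k"] b by linarith
  then show "norm (real (d (i + k)) / real b ^ Suc i) \<le> (real b - 1) / real b ^ Suc i"
    by (simp add: divide_right_mono)
qed

lemma digit_tail_nonneg: "0 \<le> digit_tail b d k"
  unfolding digit_tail_def by (intro suminf_nonneg summable_digits) simp

lemma digit_tail_le: "digit_tail b d k \<le> 1"
proof -
  have "real (d (i + k)) \<le> real b - 1" for i
    using d[of "i + k"] b by linarith
  then have "digit_tail b d k \<le> (\<Sum>i. (real b - 1) / real b ^ Suc i)"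
    unfolding digit_tail_def
    by (intro suminf_le summable_digits sums_summable[OF top_digits_sums] divide_right_mono) auto
  then show ?thesis using sums_unique[OF top_digits_sums] by simp
qed

text \<open>The tail starting at place \<open>k\<close> (counted from 0) is rescaled by b^k, so that
  splitting off its leading digit leaves a tail of the same kind, again in [0, 1].\<close>

lemma digit_tail_rec: "digit_tail b d k = (real (d k) + digit_tail b d (Suc k)) / real b"
proof -
  have "digit_tail b d k = real (d k) / real b + (\<Sum>i. real (d (Suc i + k)) / real b ^ Suc (Suc i))"
    unfolding digit_tail_def using suminf_split_head[OF summable_digits[of k]] by simp
  also have "(\<Sum>i. real (d (Suc i + k)) / real b ^ Suc (Suc i))
      = (\<Sum>i. real (d (i + Suc k)) / real b ^ Suc i * (1 / real b))"
    by (intro suminf_cong) (simp add: field_simps)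
  also have "\<dots> = digit_tail b d (Suc k) * (1 / real b)"
    unfolding digit_tail_def by (intro suminf_mult2[symmetric] summable_digits)
  finally show ?thesis by (simp add: add_divide_distrib)
qed

context
  assumes not_top: "\<And>k. \<exists>i\<ge>k. d i \<noteq> b - 1"
begin

text \<open>A tail equal to 1 forces, through the recursion, a leading digit \<open>b - 1\<close>
  and a next tail equal to 1; by induction all further digits would be \<open>b - 1\<close>.\<close>

lemma digit_tail_less: "digit_tail b d k < 1"
proof (rule ccontr)
  assume "\<not> digit_tail b d k < 1"
  then have k1: "digit_tail b d k = 1"
    using digit_tail_le[of k] by simp
  have "digit_tail b d (k + i) = 1 \<and> d (k + i) = b - 1" for i
  proof (induction i)
    case 0
    have "real b = real (d k) + digit_tail b d (Suc k)"
      using k1 digit_tail_rec[of k] b by (simp add: field_simps)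
    then have "real b \<le> real (d k) + 1" using digit_tail_le[of "Suc k"] by simp
    then have "b \<le> Suc (d k)" by linarith
    then show ?case using k1 d[of k] by simp
  next
    case (Suc i)
    then have "real b = real (b - 1) + digit_tail b d (k + Suc i)"
      using digit_tail_rec[of "k + i"] b by (simp add: field_simps)
    then have *: "digit_tail b d (k + Suc i) = 1" using b by (simp add: of_nat_diff)
    then have "real b = real (d (k + Suc i)) + digit_tail b d (Suc (k + Suc i))"
      using digit_tail_rec[of "k + Suc i"] b by (simp add: field_simps)
    then have "real b \<le> real (d (k + Suc i)) + 1" using digit_tail_le[of "Suc (k + Suc i)"] by simp
    then have "b \<le> Suc (d (k + Suc i))" by linarith
    then show ?case using * d[of "k + Suc i"] by simp
  qed
  then show False using not_top[of k] by (metis le_Suc_ex)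
qed

text \<open>Multiplication by b^k shifts the expansion by k places and leaves a tail in [0, 1) as
  fractional part. The two claims are proved together because the second one turns the shifted
  integer part \<open>b * cell + d k\<close> into the next cell index.\<close>

lemma digit_tail_0_cell:
  "digit_tail b d 0 * real b ^ k = real (cell b k (digit_tail b d 0)) + digit_tail b d k
   \<and> cell b (Suc k) (digit_tail b d 0) = b * cell b k (digit_tail b d 0) + d k"
proof (induction k)
  case 0
  have "cell b 0 (digit_tail b d 0) = 0"
    using digit_tail_nonneg digit_tail_less by (simp add: cell_0)
  moreover have "cell b (Suc 0) (digit_tail b d 0) = d 0"
    using digit_tail_rec[of 0] digit_tail_nonneg[of 1] digit_tail_less[of 1] b
    by (simp add: cell_def floor_eq_iff nat_eq_iff)
  ultimately show ?case by simp
next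
  case (Suc k)
  let ?T = "digit_tail b d" let ?c = "\<lambda>k. cell b k (digit_tail b d 0)"
  have step: "?T 0 * real b ^ Suc k = real (b * n + d k) + ?T (Suc k)"
    if "?T 0 * real b ^ k = real n + ?T k" for n k
  proof -
    have "?T 0 * real b ^ Suc k = (real n + ?T k) * real b"
      using that by simp
    also have "\<dots> = real (b * n + d k) + ?T (Suc k)"
      using digit_tail_rec[of k] b by (simp add: field_simps)
    finally show ?thesis .
  qed
  have 1: "?T 0 * real b ^ Suc k = real (?c (Suc k)) + ?T (Suc k)"
    using Suc step by simp
  have "?T 0 * real b ^ Suc (Suc k) = real (b * ?c (Suc k) + d (Suc k)) + ?T (Suc (Suc k))"
    by (rule step[OF 1])
  then have "?c (Suc (Suc k)) = b * ?c (Suc k) + d (Suc k)"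
    using digit_tail_nonneg[of "Suc (Suc k)"] digit_tail_less[of "Suc (Suc k)"]
    unfolding cell_def[of b "Suc (Suc k)"]
    by (simp add: floor_eq_iff nat_eq_iff del: power_Suc of_nat_add of_nat_mult)
  then show ?case using 1 by simp
qed

text \<open>Places of \<open>d\<close> are counted from 0, those of \<open>digit\<close> from 1;
  hence the \<open>Suc\<close>.\<close>

lemma digit_digit_tail: "digit b (digit_tail b d 0) (Suc k) = d k"
  using digit_tail_0_cell[of k] d[of k] by (simp add: digit_eq_cell_mod digit_tail_nonneg)

end
end


subsection \<open>The unit cube and functions constant on elementary intervals\<close>

definition cells :: "nat \<Rightarrow> ('d::finite \<Rightarrow> nat) \<Rightarrow> real ^ 'd \<Rightarrow> 'd \<Rightarrow> nat" where
  "cells b k x = (\<lambda>j. cell b (k j) (x $ j))"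

definition cell_indices :: "nat \<Rightarrow> ('d::finite \<Rightarrow> nat) \<Rightarrow> ('d \<Rightarrow> nat) set" where
  "cell_indices b k = (\<Pi>\<^sub>E j\<in>UNIV. {..<b ^ k j})"

text \<open>The lower corner belongs to its half-open interval and serves as the point at which a
  step function is sampled.\<close>

definition corner :: "nat \<Rightarrow> ('d::finite \<Rightarrow> nat) \<Rightarrow> ('d \<Rightarrow> nat) \<Rightarrow> real ^ 'd" where
  "corner b k \<tau> = (\<chi> j. real (\<tau> j) / real b ^ k j)"

text \<open>The depth \<open>k j\<close> may differ between coordinates, and the values outside the
  cube are left free.\<close>

definition step_fun :: "nat \<Rightarrow> ('d::finite \<Rightarrow> nat) \<Rightarrow> (real ^ 'd \<Rightarrow> real) \<Rightarrow> bool" where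
  "step_fun b k f \<longleftrightarrow> (\<forall>x\<in>unit_cube. \<forall>y\<in>unit_cube. cells b k x = cells b k y \<longrightarrow> f x = f y)"

lemma finite_cell_indices: "finite (cell_indices b k)"
  by (simp add: cell_indices_def finite_PiE)

lemma cells_in_cell_indices: "0 < b \<Longrightarrow> x \<in> unit_cube \<Longrightarrow> cells b k x \<in> cell_indices b k"
  by (auto simp: cells_def cell_indices_def unit_cube_def cell_less)

lemma mem_elementary_interval_iff:
  assumes "0 < b" "x \<in> unit_cube"
  shows "x \<in> elementary_interval b k \<tau> \<longleftrightarrow> cells b k x = \<tau>"
  using assms by (auto simp: elementary_interval_def cells_def fun_eq_iff unit_cube_def cell_eq_iff)

lemma elementary_interval_subset:
  assumes "0 < b" "\<tau> \<in> cell_indices b k"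
  shows "elementary_interval b k \<tau> \<subseteq> unit_cube"
proof
  fix x assume x: "x \<in> elementary_interval b k \<tau>"
  show "x \<in> unit_cube"
    unfolding unit_cube_def
  proof safe
    fix j
    have "real (\<tau> j) / real b ^ k j \<le> x $ j" "x $ j < (real (\<tau> j) + 1) / real b ^ k j"
      using x by (auto simp: elementary_interval_def)
    moreover have "real (\<tau> j) + 1 \<le> real (b ^ k j)"
    proof -
      have "Suc (\<tau> j) \<le> b ^ k j"
        using assms(2) by (auto simp: cell_indices_def PiE_iff Suc_le_eq)
      then show ?thesis by (simp only: of_nat_le_iff of_nat_Suc[symmetric] add.commute)
    qed
    moreover from this have "(real (\<tau> j) + 1) / real b ^ k j \<le> 1"
      using assms(1) by simp
    moreover have "0 \<le> real (\<tau> j) / real b ^ k j" by simp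
    ultimately show "0 \<le> x $ j" "x $ j < 1"
      by linarith+
  qed
qed

lemma corner_in_elementary_interval:
  "0 < b \<Longrightarrow> corner b k \<tau> \<in> elementary_interval b k \<tau>"
  by (auto simp: corner_def elementary_interval_def divide_strict_right_mono)

lemma halfopen_box_sets:
  "{x :: real ^ 'd::finite. \<forall>j. l j \<le> x $ j \<and> x $ j < h j} \<in> sets borel"
proof -
  have "{x :: real ^ 'd. \<forall>j. l j \<le> x $ j \<and> x $ j < h j}
      = (\<Inter>j. {x. l j \<le> x $ j} \<inter> {x. x $ j < h j})"
    by auto
  also have "\<dots> \<in> sets borel"
    by (intro sets.countable_INT'' sets.Int) auto
  finally show ?thesis .
qed

text \<open>The set lies between an open and a closed box of equal measure.\<close>

lemma emeasure_halfopen_box: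
  fixes l h :: "'d::finite \<Rightarrow> real"
  assumes "\<And>j. l j \<le> h j"
  shows "emeasure lborel {x :: real ^ 'd. \<forall>j. l j \<le> x $ j \<and> x $ j < h j}
    = ennreal (\<Prod>j\<in>UNIV. h j - l j)"
proof -
  let ?L = "\<chi> j. l j" and ?H = "\<chi> j. h j"
  let ?B = "{x :: real ^ 'd. \<forall>j. l j \<le> x $ j \<and> x $ j < h j}"
  have le: "?L \<bullet> i \<le> ?H \<bullet> i" if "i \<in> Basis" for i
    using that assms by (auto simp: Basis_vec_def inner_axis)
  have eq: "emeasure lborel (box ?L ?H) = emeasure lborel (cbox ?L ?H)"
    using le by (simp add: emeasure_lborel_cbox emeasure_lborel_box)
  have "box ?L ?H \<subseteq> ?B" "?B \<subseteq> cbox ?L ?H"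
    by (auto simp: mem_box_cart less_imp_le)
  then have "emeasure lborel (box ?L ?H) \<le> emeasure lborel ?B"
      "emeasure lborel ?B \<le> emeasure lborel (cbox ?L ?H)"
    using halfopen_box_sets[of l h] by (auto intro!: emeasure_mono)
  then have "emeasure lborel ?B = emeasure lborel (cbox ?L ?H)"
    unfolding eq by (intro antisym)
  also have "\<dots> = ennreal (measure lborel (cbox ?L ?H))"
    using emeasure_lborel_cbox_finite[of ?L ?H] by (intro emeasure_eq_ennreal_measure) auto
  also have "measure lborel (cbox ?L ?H) = (\<Prod>j\<in>UNIV. h j - l j)"
  proof -
    have "cbox ?L ?H \<noteq> {}"
      using assms by (auto simp: interval_ne_empty_cart)
    then show ?thesis by (simp add: content_cbox_cart)
  qed
  finally show ?thesis .
qed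

lemma unit_cube_sets [measurable]: "unit_cube \<in> sets borel"
  unfolding unit_cube_def using halfopen_box_sets[of "\<lambda>_. 0" "\<lambda>_. 1"] .

lemma emeasure_unit_cube: "emeasure lborel unit_cube = 1"
  unfolding unit_cube_def using emeasure_halfopen_box[of "\<lambda>_. 0" "\<lambda>_. 1"] by simp

lemma space_uniform_cube [simp]: "space uniform_cube = unit_cube"
  by (simp add: uniform_cube_def space_restrict_space)

lemma sets_uniform_cube: "sets uniform_cube = {A. A \<subseteq> unit_cube \<and> A \<in> sets borel}"
  using sets_restrict_space_iff[of unit_cube lborel]
  by (auto simp: uniform_cube_def)

lemma emeasure_uniform_cube:
  "A \<in> sets uniform_cube \<Longrightarrow> emeasure uniform_cube A = emeasure lborel A"
  by (auto simp: uniform_cube_def emeasure_restrict_space sets_restrict_space_iff)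

lemma prob_space_uniform_cube: "prob_space uniform_cube"
  by (rule prob_spaceI)
    (simp add: emeasure_uniform_cube sets_uniform_cube unit_cube_sets emeasure_unit_cube)

interpretation U: prob_space uniform_cube
  by (rule prob_space_uniform_cube)

lemma elementary_interval_sets: "elementary_interval b k \<tau> \<in> sets borel"
  unfolding elementary_interval_def by (rule halfopen_box_sets)

lemma elementary_interval_sets_uniform:
  "0 < b \<Longrightarrow> \<tau> \<in> cell_indices b k \<Longrightarrow> elementary_interval b k \<tau> \<in> sets uniform_cube"
  using elementary_interval_subset by (auto simp: sets_uniform_cube elementary_interval_sets)

lemma measure_elementary_interval:
  assumes "0 < b" "\<tau> \<in> cell_indices b k"
  shows "measure uniform_cube (elementary_interval b k \<tau>) = 1 / real b ^ (\<Sum>j\<in>UNIV. k j)"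
proof -
  have "emeasure lborel (elementary_interval b k \<tau>)
      = ennreal (\<Prod>j\<in>UNIV. (real (\<tau> j) + 1) / real b ^ k j - real (\<tau> j) / real b ^ k j)"
    unfolding elementary_interval_def
    by (rule emeasure_halfopen_box) (use assms in \<open>simp add: divide_right_mono\<close>)
  also have "(\<Prod>j\<in>UNIV. (real (\<tau> j) + 1) / real b ^ k j - real (\<tau> j) / real b ^ k j)
      = 1 / real b ^ (\<Sum>j\<in>UNIV. k j)"
    by (simp add: add_divide_distrib power_sum prod_dividef)
  finally have "emeasure uniform_cube (elementary_interval b k \<tau>) = ennreal (1 / real b ^ (\<Sum>j\<in>UNIV. k j))"
    using elementary_interval_sets_uniform[OF assms] by (simp add: emeasure_uniform_cube)
  then show ?thesis by (simp add: measure_def)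
qed

text \<open>Exactly one summand survives, that of the cell of x. Measurability, integrals and net
  sums of step functions are all read off from this finite expansion.\<close>

lemma step_fun_eq_sum:
  assumes "0 < b" "step_fun b k f" "x \<in> unit_cube"
  shows "f x = (\<Sum>\<tau>\<in>cell_indices b k. f (corner b k \<tau>) * indicator (elementary_interval b k \<tau>) x)"
proof -
  have ci: "cells b k x \<in> cell_indices b k"
    by (rule cells_in_cell_indices[OF assms(1,3)])
  have "(\<Sum>\<tau>\<in>cell_indices b k. f (corner b k \<tau>) * indicator (elementary_interval b k \<tau>) x)
      = (\<Sum>\<tau>\<in>cell_indices b k. if \<tau> = cells b k x then f (corner b k \<tau>) else 0)"
    using mem_elementary_interval_iff[OF assms(1,3), of k]
    by (intro sum.cong) (auto simp: indicator_def)
  also have "\<dots> = f (corner b k (cells b k x))"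
    using ci finite_cell_indices[of b k] by (simp add: sum.delta')
  also have "\<dots> = f x"
  proof -
    have "corner b k (cells b k x) \<in> unit_cube"
      using elementary_interval_subset[OF assms(1) ci] corner_in_elementary_interval[OF assms(1)] by blast
    moreover from this have "cells b k (corner b k (cells b k x)) = cells b k x"
      by (intro mem_elementary_interval_iff[OF assms(1), THEN iffD1] corner_in_elementary_interval assms)
    ultimately show ?thesis
      using assms(2,3) unfolding step_fun_def by blast
  qed
  finally show ?thesis by simp
qed

lemma step_fun_measurable:
  assumes "0 < b" "step_fun b k f"
  shows "f \<in> borel_measurable uniform_cube"
proof -
  have "(\<lambda>x. \<Sum>\<tau>\<in>cell_indices b k. f (corner b k \<tau>) * indicator (elementary_interval b k \<tau>) x)
      \<in> borel_measurable uniform_cube"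
    using elementary_interval_sets_uniform[OF assms(1)]
    by (intro borel_measurable_sum borel_measurable_times borel_measurable_indicator) auto
  then show ?thesis
    by (rule measurable_cong[THEN iffD2, rotated]) (use step_fun_eq_sum[OF assms] in auto)
qed

lemma step_fun_integral:
  assumes "0 < b" "step_fun b k f"
  shows "integrable uniform_cube f"
    and "(LINT x|uniform_cube. f x)
      = (\<Sum>\<tau>\<in>cell_indices b k. f (corner b k \<tau>)) / real b ^ (\<Sum>j\<in>UNIV. k j)"
proof -
  let ?s = "\<lambda>x. \<Sum>\<tau>\<in>cell_indices b k. f (corner b k \<tau>) * indicator (elementary_interval b k \<tau>) x"
  have E: "integrable uniform_cube (indicator (elementary_interval b k \<tau>) :: _ \<Rightarrow> real)"
    if "\<tau> \<in> cell_indices b k" for \<tau>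
    using elementary_interval_sets_uniform[OF assms(1) that] U.emeasure_finite
    by (intro integrable_real_indicator) (auto simp: less_top[symmetric])
  have "integrable uniform_cube ?s"
    using E by (intro Bochner_Integration.integrable_sum integrable_mult_right) auto
  then show "integrable uniform_cube f"
    using step_fun_eq_sum[OF assms] by (subst Bochner_Integration.integrable_cong) auto
  have "(LINT x|uniform_cube. f x) = (LINT x|uniform_cube. ?s x)"
    using step_fun_eq_sum[OF assms] by (intro Bochner_Integration.integral_cong) auto
  also have "\<dots> = (\<Sum>\<tau>\<in>cell_indices b k. f (corner b k \<tau>) *
      measure uniform_cube (elementary_interval b k \<tau>))"
    using E elementary_interval_subset[OF assms(1), where k = k]
    by (subst Bochner_Integration.integral_sum) (auto intro!: sum.cong simp: Int_absorb2)
  also have "\<dots> = (\<Sum>\<tau>\<in>cell_indices b k. f (corner b k \<tau>)) / real b ^ (\<Sum>j\<in>UNIV. k j)"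
    by (simp add: measure_elementary_interval[OF assms(1)] sum_divide_distrib)
  finally show "(LINT x|uniform_cube. f x)
      = (\<Sum>\<tau>\<in>cell_indices b k. f (corner b k \<tau>)) / real b ^ (\<Sum>j\<in>UNIV. k j)" .
qed


subsection \<open>Exact integration by nets\<close>

text \<open>The definition of a net speaks only of intervals of volume b^(t - m). A larger interval
  is cut into b children along one coordinate, which lowers m - t minus the total depth, the measure
  of the induction, until that volume is reached.\<close>

lemma net_card_cell:
  fixes a :: "nat \<Rightarrow> real ^ 'd::finite"
  assumes b: "0 < b" and net: "tmd_net b t m a" and k: "(\<Sum>j\<in>UNIV. k j) + t \<le> m"
    and \<tau>: "\<tau> \<in> cell_indices b k"
  shows "card {i. i < b ^ m \<and> cells b k (a i) = \<tau>} = b ^ (m - (\<Sum>j\<in>UNIV. k j))"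
  using k \<tau>
proof (induction "m - t - (\<Sum>j\<in>UNIV. k j)" arbitrary: k \<tau>)
  case 0
  then have kt: "(\<Sum>j\<in>UNIV. k j) + t = m" by simp
  have cube: "a i \<in> unit_cube" if "i < b ^ m" for i
    using net that by (auto simp: tmd_net_def)
  have "{i. i < b ^ m \<and> cells b k (a i) = \<tau>} = {i. i < b ^ m \<and> a i \<in> elementary_interval b k \<tau>}"
    using cube mem_elementary_interval_iff[OF b] by blast
  moreover have "\<forall>j. \<tau> j < b ^ k j"
    using 0(3) by (auto simp: cell_indices_def)
  ultimately show ?case
    using net kt unfolding tmd_net_def by auto
next
  case (Suc n)
  \<comment> \<open>Any coordinate may be refined; this only picks one.\<close>
  obtain j :: 'd where True by simp
  define k' where "k' = k(j := Suc (k j))"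
  have sum_k': "(\<Sum>j\<in>UNIV. k' j) = Suc (\<Sum>j\<in>UNIV. k j)"
  proof -
    have "(\<Sum>i\<in>UNIV. k' i) = k' j + (\<Sum>i\<in>UNIV - {j}. k' i)"
      by (rule sum.remove) auto
    also have "(\<Sum>i\<in>UNIV - {j}. k' i) = (\<Sum>i\<in>UNIV - {j}. k i)"
      by (intro sum.cong) (auto simp: k'_def)
    also have "k' j + (\<Sum>i\<in>UNIV - {j}. k i) = Suc (k j + (\<Sum>i\<in>UNIV - {j}. k i))"
      by (simp add: k'_def)
    also have "k j + (\<Sum>i\<in>UNIV - {j}. k i) = (\<Sum>j\<in>UNIV. k j)"
      by (rule sum.remove[symmetric]) auto
    finally show ?thesis .
  qed
  define \<tau>' where "\<tau>' c = \<tau>(j := b * \<tau> j + c)" for c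
  have cube: "a i \<in> unit_cube" if "i < b ^ m" for i
    using net that by (auto simp: tmd_net_def)
  have split: "{i. i < b ^ m \<and> cells b k (a i) = \<tau>}
      = (\<Union>c\<in>{..<b}. {i. i < b ^ m \<and> cells b k' (a i) = \<tau>' c})" (is "?L = ?R")
  proof (intro equalityI subsetI)
    fix i assume i: "i \<in> ?L"
    have "cells b k' (a i) = \<tau>' (digit b (a i $ j) (Suc (k j)))"
      using i cube[of i] cell_Suc[OF b, of "a i $ j" "k j"]
      by (auto simp: cells_def fun_eq_iff k'_def \<tau>'_def unit_cube_def)
    then show "i \<in> ?R"
      using i digit_less[OF b] by blast
  next
    fix i assume "i \<in> ?R"
    then obtain c where i: "i < b ^ m" and c: "c < b" and eq: "cells b k' (a i) = \<tau>' c" by auto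
    have "cell b (k j') (a i $ j') = \<tau> j'" for j'
    proof (cases "j' = j")
      case True
      have "cell b (Suc (k j)) (a i $ j) = b * \<tau> j + c"
        using fun_cong[OF eq, of j] by (simp add: cells_def k'_def \<tau>'_def)
      then have "cell b (k j) (a i $ j) = (b * \<tau> j + c) div b"
        using cell_Suc_div[OF b] by metis
      then show ?thesis using c True by simp
    next
      case False
      then show ?thesis using fun_cong[OF eq, of j'] by (simp add: cells_def k'_def \<tau>'_def)
    qed
    then show "i \<in> ?L" using i by (auto simp: cells_def)
  qed
  have card: "card {i. i < b ^ m \<and> cells b k' (a i) = \<tau>' c} = b ^ (m - (\<Sum>j\<in>UNIV. k' j))"
    if c: "c < b" for c
  proof (rule Suc.hyps(1))
    show "n = m - t - (\<Sum>j\<in>UNIV. k' j)" "(\<Sum>j\<in>UNIV. k' j) + t \<le> m"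
      using Suc.hyps(2) by (auto simp: sum_k')
    have "\<tau> j < b ^ k j"
      using Suc.prems by (auto simp: cell_indices_def)
    then have "b * \<tau> j + c < b * \<tau> j + b" "b * (\<tau> j + 1) \<le> b * b ^ k j"
      using c by (auto simp: Suc_le_eq simp del: mult_Suc_right)
    then show "\<tau>' c \<in> cell_indices b k'"
      using Suc.prems by (auto simp: cell_indices_def \<tau>'_def k'_def PiE_iff)
  qed
  have "card (\<Union>c\<in>{..<b}. {i. i < b ^ m \<and> cells b k' (a i) = \<tau>' c})
      = (\<Sum>c<b. card {i. i < b ^ m \<and> cells b k' (a i) = \<tau>' c})"
    by (intro card_UN_disjoint) (auto simp: \<tau>'_def fun_eq_iff split: if_splits)
  also have "\<dots> = b * b ^ (m - (\<Sum>j\<in>UNIV. k' j))"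
    using card by simp
  also have "\<dots> = b ^ (m - (\<Sum>j\<in>UNIV. k j))"
    using Suc.hyps(2) unfolding sum_k' by (subst power_Suc[symmetric]) (simp add: Suc_diff_Suc)
  finally show ?case using split by simp
qed

text \<open>Each cell contains N times its volume many points, so the average over the net is the
  integral.\<close>

lemma net_step_fun_exact:
  assumes b: "0 < b" and net: "tmd_net b t m a" and k: "(\<Sum>j\<in>UNIV. k j) + t \<le> m"
    and f: "step_fun b k f"
  shows "(\<Sum>i<b ^ m. f (a i)) = real (b ^ m) * (LINT x|uniform_cube. f x)"
proof -
  let ?K = "\<Sum>j\<in>UNIV. k j"
  have cube: "a i \<in> unit_cube" if "i < b ^ m" for i
    using net that by (auto simp: tmd_net_def)
  have "(\<Sum>i<b ^ m. f (a i))
      = (\<Sum>i<b ^ m. \<Sum>\<tau>\<in>cell_indices b k. f (corner b k \<tau>) * indicator (elementary_interval b k \<tau>) (a i))"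
    using step_fun_eq_sum[OF b f] cube by (intro sum.cong) auto
  also have "\<dots> = (\<Sum>\<tau>\<in>cell_indices b k. f (corner b k \<tau>) *
      (\<Sum>i<b ^ m. indicator (elementary_interval b k \<tau>) (a i)))"
    by (subst sum.swap) (simp add: sum_distrib_left)
  also have "\<dots> = (\<Sum>\<tau>\<in>cell_indices b k. f (corner b k \<tau>) * real (b ^ (m - ?K)))"
  proof (intro sum.cong refl arg_cong2[where f = "(*)"])
    fix \<tau> assume \<tau>: "\<tau> \<in> cell_indices b k"
    have "(\<Sum>i<b ^ m. indicator (elementary_interval b k \<tau>) (a i))
        = (\<Sum>i<b ^ m. of_bool (cells b k (a i) = \<tau>) :: real)"
      using mem_elementary_interval_iff[OF b cube] by (intro sum.cong) (auto simp: indicator_def)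
    also have "\<dots> = real (card {i. i < b ^ m \<and> cells b k (a i) = \<tau>})"
      by (simp add: sum_of_bool_eq Int_def)
    finally show "(\<Sum>i<b ^ m. indicator (elementary_interval b k \<tau>) (a i)) = real (b ^ (m - ?K))"
      using net_card_cell[OF b net k \<tau>] by simp
  qed
  also have "real (b ^ (m - ?K)) = real (b ^ m) / real b ^ ?K"
    using b k by (simp add: power_diff[of "real b"])
  also have "(\<Sum>\<tau>\<in>cell_indices b k. f (corner b k \<tau>) * (real (b ^ m) / real b ^ ?K))
      = real (b ^ m) * (LINT x|uniform_cube. f x)"
    unfolding step_fun_integral(2)[OF b f]
    by (simp add: sum_distrib_left sum_divide_distrib mult.commute)
  finally show ?thesis .
qed


subsection \<open>The Hoeffding decomposition\<close>

definition depends_on :: "(('q \<Rightarrow> nat) \<Rightarrow> real) \<Rightarrow> 'q set \<Rightarrow> bool" where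
  "depends_on G S \<longleftrightarrow> (\<forall>x y. (\<forall>q\<in>S. x q = y q) \<longrightarrow> G x = G y)"

definition centered :: "nat \<Rightarrow> 'q \<Rightarrow> (('q \<Rightarrow> nat) \<Rightarrow> real) \<Rightarrow> bool" where
  "centered b q G \<longleftrightarrow> (\<forall>x. (\<Sum>c<b. G (x(q := c))) = 0)"

lemma depends_onD: "depends_on G S \<Longrightarrow> (\<And>q. q \<in> S \<Longrightarrow> x q = y q) \<Longrightarrow> G x = G y"
  by (auto simp: depends_on_def)

text \<open>If G depends only on D, taking T = D makes the component \<open>H S\<close> depend only
  on S. The arbitrary T, and the last clause on positions outside D, are there for the induction on
  D: a position already centered must stay so while the others are decomposed.\<close>

definition hoeffding_family ::
  "nat \<Rightarrow> 'q set \<Rightarrow> (('q \<Rightarrow> nat) \<Rightarrow> real) \<Rightarrow> ('q set \<Rightarrow> ('q \<Rightarrow> nat) \<Rightarrow> real) \<Rightarrow> bool" where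
  "hoeffding_family b D G H \<longleftrightarrow> (\<forall>x. G x = (\<Sum>S\<in>Pow D. H S x)) \<and>
    (\<forall>S\<subseteq>D. (\<forall>T. depends_on G T \<longrightarrow> depends_on (H S) (T - (D - S))) \<and>
      (\<forall>q\<in>S. centered b q (H S)) \<and> (\<forall>q. q \<notin> D \<longrightarrow> centered b q G \<longrightarrow> centered b q (H S)))"

lemma hoeffding_familyD:
  assumes "hoeffding_family b D G H"
  shows "G x = (\<Sum>S\<in>Pow D. H S x)"
    and "S \<subseteq> D \<Longrightarrow> depends_on G T \<Longrightarrow> depends_on (H S) (T - (D - S))"
    and "S \<subseteq> D \<Longrightarrow> q \<in> S \<Longrightarrow> centered b q (H S)"
    and "S \<subseteq> D \<Longrightarrow> q \<notin> D \<Longrightarrow> centered b q G \<Longrightarrow> centered b q (H S)"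
  using assms unfolding hoeffding_family_def by blast+

text \<open>One position p at a time: G is its average A over the p-th digit plus the remainder B,
  which is centered at p. Components of A supply the sets without p, those of B the sets with
  p.\<close>

lemma hoeffding_decomposition:
  assumes "finite D" "0 < b"
  shows "\<exists>H. hoeffding_family b D G H"
  using assms(1)
proof (induction D arbitrary: G rule: finite_induct)
  case empty
  show ?case by (rule exI[of _ "\<lambda>_. G"]) (simp add: hoeffding_family_def)
next
  case (insert p D)
  define A where "A x = (\<Sum>c<b. G (x(p := c))) / real b" for x
  define B where "B x = G x - A x" for x
  have A_dep: "depends_on A (T - {p})" if "depends_on G T" for T
    unfolding depends_on_def A_def
    by (intro allI impI arg_cong2[where f = "(/)"] sum.cong refl depends_onD[OF that]) auto
  have A_upd: "A (x(p := c)) = A x" for x c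
    by (simp add: A_def)
  have B_dep: "depends_on B T" if "depends_on G T" for T
    using A_dep[OF that] that unfolding depends_on_def B_def by (metis DiffD1)
  have B_cent: "centered b p B"
    using \<open>0 < b\<close> by (simp add: centered_def B_def sum_subtractf A_upd) (simp add: A_def)
  have A_cent: "centered b q A" if "q \<noteq> p" "centered b q G" for q
  proof -
    have "(\<Sum>c<b. \<Sum>c'<b. G (x(q := c, p := c'))) = (\<Sum>c'<b. \<Sum>c<b. G ((x(p := c'))(q := c)))" for x
      using that by (subst sum.swap) (simp add: fun_upd_twist)
    then show ?thesis
      using that by (simp add: centered_def A_def flip: sum_divide_distrib)
  qed
  have B_cent': "centered b q B" if "q \<noteq> p" "centered b q G" for q
    using A_cent[OF that] that by (simp add: centered_def B_def sum_subtractf)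
  obtain H0 H1 where "hoeffding_family b D A H0" "hoeffding_family b D B H1"
    using insert.IH by metis
  note H0 = hoeffding_familyD[OF this(1)] and H1 = hoeffding_familyD[OF this(2)]
  define H where "H S = (if p \<in> S then H1 (S - {p}) else H0 S)" for S
  have H_out: "H S = H0 S" "H (insert p S) = H1 S" if "S \<subseteq> D" for S
  proof -
    have "p \<notin> S" "S - {p} = S" using that insert.hyps by auto
    then show "H S = H0 S" "H (insert p S) = H1 S" by (simp_all add: H_def)
  qed
  have "G x = (\<Sum>S\<in>Pow (insert p D). H S x)" for x
  proof -
    have "(\<Sum>S\<in>Pow (insert p D). H S x) = (\<Sum>S\<in>Pow D. H S x) + (\<Sum>S\<in>insert p ` Pow D. H S x)"
      unfolding Pow_insert using insert.hyps by (intro sum.union_disjoint) auto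
    also have "(\<Sum>S\<in>insert p ` Pow D. H S x) = (\<Sum>S\<in>Pow D. H (insert p S) x)"
      using insert.hyps by (subst sum.reindex) (auto simp: inj_on_def)
    also have "(\<Sum>S\<in>Pow D. H S x) + (\<Sum>S\<in>Pow D. H (insert p S) x) = A x + B x"
      unfolding H0(1) H1(1) by (intro arg_cong2[where f = "(+)"] sum.cong) (auto simp: H_out)
    finally show ?thesis by (simp add: B_def)
  qed
  moreover have "(\<forall>T. depends_on G T \<longrightarrow> depends_on (H S) (T - (insert p D - S))) \<and>
      (\<forall>q\<in>S. centered b q (H S)) \<and>
      (\<forall>q. q \<notin> insert p D \<longrightarrow> centered b q G \<longrightarrow> centered b q (H S))"
    if S: "S \<subseteq> insert p D" for S
  proof (cases "p \<in> S")
    case False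
    then have "S \<subseteq> D" using S by auto
    moreover from this have "T - (insert p D - S) = (T - {p}) - (D - S)" for T
      using insert.hyps by auto
    ultimately show ?thesis
      using H0 A_dep A_cent False by (simp add: H_out)
  next
    case True
    define S' where "S' = S - {p}"
    have S': "S' \<subseteq> D" "S = insert p S'" using S True by (auto simp: S'_def)
    have "T - (insert p D - S) = T - (D - S')" for T
      using S' insert.hyps by auto
    moreover have "centered b q (H1 S')" if "q \<in> S" for q
      using that S' H1(3) H1(4)[OF S'(1) insert.hyps(2) B_cent] by auto
    ultimately show ?thesis
      using H1(2,4) B_dep B_cent' S' by (simp add: H_out)
  qed
  ultimately have "hoeffding_family b (insert p D) G H"
    unfolding hoeffding_family_def by blast
  then show ?case by blast
qed


subsection \<open>Scrambled digits\<close>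

text \<open>Composing with a transposition shows that the sum is the same for every argument; summed
  over all b arguments it is a multiple of the sum of h, that is 0.\<close>

lemma sum_permutations_centered:
  fixes h :: "nat \<Rightarrow> real"
  assumes "x < b" and "(\<Sum>c<b. h c) = 0"
  shows "(\<Sum>\<sigma> | \<sigma> permutes {..<b}. h (\<sigma> x)) = 0"
proof -
  let ?P = "{\<sigma>. \<sigma> permutes {..<b}}"
  have eq: "(\<Sum>\<sigma>\<in>?P. h (\<sigma> x)) = (\<Sum>\<sigma>\<in>?P. h (\<sigma> y))" if "y < b" for y
    using sum_permutations_compose_right[OF permutes_swap_id, of x "{..<b}" y "\<lambda>\<sigma>. h (\<sigma> x)"] assms that
    by simp
  have "real b * (\<Sum>\<sigma>\<in>?P. h (\<sigma> x)) = (\<Sum>y<b. \<Sum>\<sigma>\<in>?P. h (\<sigma> x))"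
    by simp
  also have "\<dots> = (\<Sum>y<b. \<Sum>\<sigma>\<in>?P. h (\<sigma> y))"
    by (intro sum.cong refl eq) simp
  also have "\<dots> = (\<Sum>\<sigma>\<in>?P. \<Sum>y<b. h (\<sigma> y))"
    by (rule sum.swap)
  also have "\<dots> = (\<Sum>\<sigma>\<in>?P. \<Sum>y<b. h y)"
    using sum.permute[of _ "{..<b}" h] by (intro sum.cong[of ?P ?P]) (simp_all add: comp_def)
  finally show ?thesis using assms by auto
qed

text \<open>The net and the permutations that \<open>scrambled_net\<close> only asserts to exist
  become parameters.\<close>

locale net_scrambling = prob_space M
  for M :: "'w measure" +
  fixes b t m :: nat
    and a :: "nat \<Rightarrow> real ^ 'd::finite"
    and \<pi> :: "'d \<Rightarrow> nat list \<Rightarrow> 'w \<Rightarrow> nat \<Rightarrow> nat"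
    and u :: "nat \<Rightarrow> 'w \<Rightarrow> real ^ 'd"
  assumes b: "2 \<le> b"
    and net: "tmd_net b t m a"
    and perms: "iid_uniform_permutations M b \<pi>"
    and u_eq: "\<And>i \<omega>. i < b ^ m \<Longrightarrow> \<omega> \<in> space M \<Longrightarrow> u i \<omega> = scramble b (\<lambda>j l. \<pi> j l \<omega>) (a i)"
begin

abbreviation P :: "(nat \<Rightarrow> nat) set" where
  "P \<equiv> {\<sigma>. \<sigma> permutes {..<b}}"

abbreviation C :: "(nat \<Rightarrow> nat) measure" where
  "C \<equiv> count_space P"

text \<open>The address of the permutation acting on the digit at position q of point i. Digit
  indices in positions start at 0, so the prefix has length \<open>snd q\<close> and the digit
  concerned is number \<open>Suc (snd q)\<close>.\<close>

definition node :: "nat \<Rightarrow> 'd \<times> nat \<Rightarrow> 'd \<times> nat list" where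
  "node i q = (fst q, map (digit b (a i $ fst q)) [1..<Suc (snd q)])"

definition adigit :: "nat \<Rightarrow> 'd \<times> nat \<Rightarrow> nat" where
  "adigit i q = digit b (a i $ fst q) (Suc (snd q))"

definition node_perm :: "'d \<times> nat list \<Rightarrow> 'w \<Rightarrow> nat \<Rightarrow> nat" where
  "node_perm = (\<lambda>(j, l). \<pi> j l)"

text \<open>Working with these digits instead of those of \<open>u i\<close> avoids the ambiguity of
  expansions: they are defined for every outcome and agree with the digits of \<open>u i\<close> on
  \<open>regular\<close> outcomes.\<close>

definition sdigit :: "nat \<Rightarrow> 'w \<Rightarrow> 'd \<times> nat \<Rightarrow> nat" where
  "sdigit i \<omega> q = node_perm (node i q) \<omega> (adigit i q)"

lemma b_pos: "0 < b" using b by simp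

lemma finite_P: "finite P"
  by (simp add: finite_permutations)

lemma a_cube: "i < b ^ m \<Longrightarrow> a i \<in> unit_cube"
  using net by (simp add: tmd_net_def)

lemma adigit_less: "adigit i q < b"
  using b_pos by (simp add: adigit_def digit_less)

lemma node_in: "node i q \<in> UNIV \<times> lists {..<b}"
  using b_pos by (auto simp: node_def digit_less)

text \<open>The length of the prefix stored in a node reveals the digit index, even when the two
  points differ.\<close>

lemma node_eqD: "node i q = node i' q' \<Longrightarrow> q = q'"
  unfolding node_def by (metis Pair_inject diff_Suc_1 length_map length_upt prod.collapse)

lemma indep_node_perm: "indep_vars (\<lambda>_. C) node_perm (UNIV \<times> lists {..<b})"
  using perms by (simp add: iid_uniform_permutations_def node_perm_def)

lemma node_perm_measurable: "n \<in> UNIV \<times> lists {..<b} \<Longrightarrow> node_perm n \<in> measurable M C"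
  using indep_node_perm by (auto simp: indep_vars_def)

lemma node_perm_permutes:
  "n \<in> UNIV \<times> lists {..<b} \<Longrightarrow> \<omega> \<in> space M \<Longrightarrow> node_perm n \<omega> permutes {..<b}"
  using measurable_space[OF node_perm_measurable] by auto

lemma distr_node_perm: "n \<in> UNIV \<times> lists {..<b} \<Longrightarrow> distr M C (node_perm n) = uniform_count_measure P"
  using perms by (auto simp: iid_uniform_permutations_def node_perm_def)

lemma sdigit_less: "\<omega> \<in> space M \<Longrightarrow> sdigit i \<omega> q < b"
  using permutes_in_image[OF node_perm_permutes[OF node_in], of \<omega> i q "adigit i q"] adigit_less
  by (simp add: sdigit_def)

lemma sdigit_measurable [measurable]: "(\<lambda>\<omega>. sdigit i \<omega> q) \<in> measurable M (count_space UNIV)"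
proof -
  have "(\<lambda>\<sigma>. \<sigma> (adigit i q)) \<circ> node_perm (node i q) \<in> measurable M (count_space UNIV)"
    by (rule measurable_comp[OF node_perm_measurable[OF node_in]]) simp
  then show ?thesis by (simp add: sdigit_def comp_def)
qed

text \<open>The digits at the positions D form a random element of a countable discrete product, on
  which every function is measurable.\<close>

lemma depends_on_sdigit_measurable:
  assumes "finite D" "depends_on G D"
  shows "(\<lambda>\<omega>. G (sdigit i \<omega>)) \<in> borel_measurable M"
proof -
  have "(\<lambda>\<omega>. \<lambda>q\<in>D. sdigit i \<omega> q) \<in> measurable M (PiM D (\<lambda>_. count_space UNIV))"
    by (intro measurable_restrict sdigit_measurable)
  then have "(\<lambda>\<omega>. \<lambda>q\<in>D. sdigit i \<omega> q) \<in> measurable M (count_space (PiE D (\<lambda>_. UNIV)))"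
    using count_space_PiM_finite[OF assms(1), of "\<lambda>_. UNIV :: nat set"] by simp
  from measurable_comp[OF this, of G borel]
  have "(\<lambda>\<omega>. G (\<lambda>q\<in>D. sdigit i \<omega> q)) \<in> borel_measurable M" by (simp add: comp_def)
  moreover have "G (\<lambda>q\<in>D. sdigit i \<omega> q) = G (sdigit i \<omega>)" for \<omega>
    by (rule depends_onD[OF assms(2)]) simp
  ultimately show ?thesis by simp
qed

lemma depends_on_sdigit_bounded:
  assumes "finite D" "depends_on G D"
  shows "\<exists>B. \<forall>i. \<forall>\<omega>\<in>space M. \<bar>G (sdigit i \<omega>)\<bar> \<le> B"
proof -
  let ?F = "PiE D (\<lambda>_. {..<b})"
  have fin: "finite ?F" using assms by (intro finite_PiE) auto
  have "\<bar>G (sdigit i \<omega>)\<bar> \<le> (\<Sum>x\<in>?F. \<bar>G x\<bar>)" if "\<omega> \<in> space M" for i \<omega>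
  proof -
    have "G (sdigit i \<omega>) = G (restrict (sdigit i \<omega>) D)"
      by (rule depends_onD[OF assms(2)]) simp
    moreover have "restrict (sdigit i \<omega>) D \<in> ?F"
      using sdigit_less[OF that] by auto
    ultimately show ?thesis
      using member_le_sum[of _ ?F "\<lambda>x. \<bar>G x\<bar>"] fin by simp
  qed
  then show ?thesis by blast
qed

lemma depends_on_sdigit_integrable:
  assumes "finite D" "depends_on G D" "finite D'" "depends_on G' D'"
  shows "integrable M (\<lambda>\<omega>. G (sdigit i \<omega>) * G' (sdigit i' \<omega>))"
proof -
  obtain B where B: "\<And>i \<omega>. \<omega> \<in> space M \<Longrightarrow> \<bar>G (sdigit i \<omega>)\<bar> \<le> B"
    using depends_on_sdigit_bounded[OF assms(1,2)] by blast
  obtain B' where B': "\<And>i \<omega>. \<omega> \<in> space M \<Longrightarrow> \<bar>G' (sdigit i \<omega>)\<bar> \<le> B'"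
    using depends_on_sdigit_bounded[OF assms(3,4)] by blast
  show ?thesis
  proof (rule integrable_const_bound[where B = "B * B'"])
    have "norm (G (sdigit i \<omega>) * G' (sdigit i' \<omega>)) \<le> B * B'" if "\<omega> \<in> space M" for \<omega>
      unfolding real_norm_def abs_mult
      using B[OF that, of i] B'[OF that, of i'] by (intro mult_mono) auto
    then show "AE \<omega> in M. norm (G (sdigit i \<omega>) * G' (sdigit i' \<omega>)) \<le> B * B'" by auto
  qed (intro borel_measurable_times depends_on_sdigit_measurable[OF assms(1,2)]
      depends_on_sdigit_measurable[OF assms(3,4)])
qed

text \<open>The permutation at \<open>node i q\<close> enters the product only through the \<open>q\<close>-th digit of the \<open>i\<close>-th
  point, and averaging over that permutation gives 0.\<close>

lemma expectation_centered_eq_0: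
  assumes G: "finite D" "depends_on G D" "centered b q G"
    and G': "finite D'" "depends_on G' D'"
    and ne: "\<And>q'. q' \<in> D' \<Longrightarrow> node i' q' \<noteq> node i q"
  shows "expectation (\<lambda>\<omega>. G (sdigit i \<omega>) * G' (sdigit i' \<omega>)) = 0"
proof -
  let ?n = "node i q"
  \<comment> \<open>All other permutations entering the product. The node of q is not among them:
    \<open>node_eqD\<close> excludes the other positions of point i, and the assumption
    \<open>ne\<close> excludes those of point i'.\<close>
  define B where "B = node i ` (D - {q}) \<union> node i' ` D'"
  define Q where "Q = PiE B (\<lambda>_. P)"
  define Y where "Y \<omega> = (\<lambda>n\<in>B. node_perm n \<omega>)" for \<omega>
  define g where "g \<sigma> y = G (\<lambda>p. if p = q then \<sigma> (adigit i q) else y (node i p) (adigit i p))"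
    for \<sigma> :: "nat \<Rightarrow> nat" and y :: "'d \<times> nat list \<Rightarrow> nat \<Rightarrow> nat"
  define g' where "g' y = G' (\<lambda>p. y (node i' p) (adigit i' p))"
    for y :: "'d \<times> nat list \<Rightarrow> nat \<Rightarrow> nat"
  have B: "finite B" "B \<subseteq> UNIV \<times> lists {..<b}" "?n \<notin> B"
  proof -
    show "finite B" using G(1) G'(1) by (simp add: B_def)
    show "B \<subseteq> UNIV \<times> lists {..<b}" using node_in unfolding B_def by blast
    show "?n \<notin> B"
    proof
      assume "?n \<in> B"
      then show False
        unfolding B_def
      proof (elim UnE imageE)
        fix p assume "?n = node i p" "p \<in> D - {q}"
        then show False by (auto dest: node_eqD)
      next
        fix p assume "?n = node i' p" "p \<in> D'"
        then show False using ne[of p] by simp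
      qed
    qed
  qed
  have finQ: "finite Q"
    unfolding Q_def using B finite_P by (intro finite_PiE) auto
  \<comment> \<open>As the remaining permutations have finitely many joint values, conditioning on
    them amounts to a finite sum over the values of Y.\<close>
  have PiM_B: "PiM B (\<lambda>_. C) = count_space Q"
    unfolding Q_def using B finite_P by (intro count_space_PiM_finite) (auto intro: countable_finite)
  have G_eq: "G (sdigit i \<omega>) = g (node_perm ?n \<omega>) (Y \<omega>)" for \<omega>
    unfolding g_def by (rule depends_onD[OF G(2)]) (auto simp: sdigit_def Y_def B_def)
  have G'_eq: "G' (sdigit i' \<omega>) = g' (Y \<omega>)" for \<omega>
    unfolding g'_def by (rule depends_onD[OF G'(2)]) (auto simp: sdigit_def Y_def B_def)
  have "indep_var (PiM {?n} (\<lambda>_. C)) (\<lambda>\<omega>. \<lambda>n\<in>{?n}. node_perm n \<omega>) (PiM B (\<lambda>_. C)) Y"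
    unfolding Y_def using B node_in by (intro indep_var_restrict[OF indep_node_perm]) auto
  then have ind: "indep_var (PiM {?n} (\<lambda>_. C)) (\<lambda>\<omega>. \<lambda>n\<in>{?n}. node_perm n \<omega>) (count_space Q) Y"
    by (simp add: PiM_B)
  have Y_meas: "Y \<in> measurable M (count_space Q)"
    using ind by (rule indep_var_rv2)
  have Y_Q: "Y \<omega> \<in> Q" if "\<omega> \<in> space M" for \<omega>
    using measurable_space[OF Y_meas that] by simp
  have X_int: "expectation (\<lambda>\<omega>. g (node_perm ?n \<omega>) y) = 0" for y
  proof -
    have "expectation (\<lambda>\<omega>. g (node_perm ?n \<omega>) y) = (LINT \<sigma>|distr M C (node_perm ?n). g \<sigma> y)"
      using node_perm_measurable[OF node_in] by (subst integral_distr) auto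
    also have "\<dots> = (\<Sum>\<sigma>\<in>P. g \<sigma> y) / card P"
      by (simp add: distr_node_perm[OF node_in] integral_uniform_count_measure finite_P)
    also have "(\<Sum>\<sigma>\<in>P. g \<sigma> y) = 0"
    proof -
      let ?x = "\<lambda>p. y (node i p) (adigit i p)"
      have "g \<sigma> y = G (?x(q := \<sigma> (adigit i q)))" for \<sigma>
        unfolding g_def by (rule arg_cong[where f = G]) auto
      then show ?thesis
        using sum_permutations_centered[OF adigit_less, of "\<lambda>c. G (?x(q := c))"] G(3)
        by (simp add: centered_def)
    qed
    finally show ?thesis by simp
  qed
  have cell: "expectation (\<lambda>\<omega>. g (node_perm ?n \<omega>) y * of_bool (Y \<omega> = y)) = 0
      \<and> integrable M (\<lambda>\<omega>. g (node_perm ?n \<omega>) y * of_bool (Y \<omega> = y))" for y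
  proof -
    let ?X = "\<lambda>\<omega>. g (node_perm ?n \<omega>) y" and ?I = "\<lambda>\<omega>. of_bool (Y \<omega> = y) :: real"
    have "(\<lambda>s. s ?n) \<in> measurable (PiM {?n} (\<lambda>_. C)) C"
      by (rule measurable_component_singleton) simp
    then have "(\<lambda>\<sigma>. g \<sigma> y) \<circ> (\<lambda>s. s ?n) \<in> borel_measurable (PiM {?n} (\<lambda>_. C))"
      by (rule measurable_comp) simp
    from indep_var_compose[OF ind this, of "\<lambda>z. of_bool (z = y)" borel]
    have iv: "indep_var borel ?X borel ?I"
      by (simp add: comp_def)
    have X_meas: "?X \<in> borel_measurable M" and I_meas: "?I \<in> borel_measurable M"
      using indep_var_rv1[OF iv] indep_var_rv2[OF iv] .
    have "\<bar>?X \<omega>\<bar> \<le> (\<Sum>\<sigma>\<in>P. \<bar>g \<sigma> y\<bar>)" if "\<omega> \<in> space M" for \<omega>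
      using node_perm_permutes[OF node_in that, of i q] finite_P
      by (intro member_le_sum[of _ P "\<lambda>\<sigma>. \<bar>g \<sigma> y\<bar>"]) auto
    then have Xi: "integrable M ?X"
      using X_meas by (intro integrable_const_bound[where B = "\<Sum>\<sigma>\<in>P. \<bar>g \<sigma> y\<bar>"]) auto
    have Ii: "integrable M ?I"
      using I_meas by (intro integrable_const_bound[where B = 1]) auto
    show ?thesis
      using indep_var_lebesgue_integral[OF iv Xi Ii] indep_var_integrable[OF iv Xi Ii] X_int by simp
  qed
  have "expectation (\<lambda>\<omega>. G (sdigit i \<omega>) * G' (sdigit i' \<omega>))
      = expectation (\<lambda>\<omega>. \<Sum>y\<in>Q. g' y * (g (node_perm ?n \<omega>) y * of_bool (Y \<omega> = y)))"
  proof (intro Bochner_Integration.integral_cong refl)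
    fix \<omega> assume "\<omega> \<in> space M"
    then have "(\<Sum>y\<in>Q. g' y * (g (node_perm ?n \<omega>) y * of_bool (Y \<omega> = y)))
        = (\<Sum>y\<in>Q. if y = Y \<omega> then g' y * g (node_perm ?n \<omega>) y else 0)"
      by (intro sum.cong) auto
    also have "\<dots> = g' (Y \<omega>) * g (node_perm ?n \<omega>) (Y \<omega>)"
      using finQ Y_Q[OF \<open>\<omega> \<in> space M\<close>] by (simp add: sum.delta')
    finally show "G (sdigit i \<omega>) * G' (sdigit i' \<omega>)
        = (\<Sum>y\<in>Q. g' y * (g (node_perm ?n \<omega>) y * of_bool (Y \<omega> = y)))"
      by (simp add: G_eq G'_eq)
  qed
  also have "\<dots> = (\<Sum>y\<in>Q. g' y * expectation (\<lambda>\<omega>. g (node_perm ?n \<omega>) y * of_bool (Y \<omega> = y)))"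
    using cell by (subst Bochner_Integration.integral_sum) auto
  also have "\<dots> = 0" using cell by simp
  finally show ?thesis .
qed

text \<open>For a single point the digits are independent and uniform: the indicator of agreement on
  D and p, minus 1 / b times that on D, is centered at p, so each further digit contributes a factor
  1 / b.\<close>

lemma prob_sdigit:
  assumes "finite D" "\<And>q. q \<in> D \<Longrightarrow> c q < b"
  shows "prob {\<omega> \<in> space M. \<forall>q\<in>D. sdigit i \<omega> q = c q} = 1 / real b ^ card D"
  using assms
proof (induction D rule: finite_induct)
  case empty
  then show ?case by (simp add: prob_space)
next
  case (insert p D)
  define G where "G E x = (of_bool (\<forall>q\<in>E. x q = c q) :: real)" for E and x :: "'d \<times> nat \<Rightarrow> nat"
  have G_prob: "expectation (\<lambda>\<omega>. G E (sdigit i \<omega>)) = prob {\<omega> \<in> space M. \<forall>q\<in>E. sdigit i \<omega> q = c q}"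
    and G_int: "integrable M (\<lambda>\<omega>. G E (sdigit i \<omega>))"
    if "finite E" for E
  proof -
    have sets: "{\<omega> \<in> space M. \<forall>q\<in>E. sdigit i \<omega> q = c q} \<in> events"
      using that by measurable
    have "expectation (\<lambda>\<omega>. G E (sdigit i \<omega>))
        = expectation (indicator {\<omega> \<in> space M. \<forall>q\<in>E. sdigit i \<omega> q = c q})"
      by (intro Bochner_Integration.integral_cong) (auto simp: G_def indicator_def)
    then show "expectation (\<lambda>\<omega>. G E (sdigit i \<omega>)) = prob {\<omega> \<in> space M. \<forall>q\<in>E. sdigit i \<omega> q = c q}"
      using sets by (simp add: Int_def conj_commute)
    have "depends_on (G E) E" by (auto simp: depends_on_def G_def)
    from depends_on_sdigit_integrable[OF that this, of "{}" "\<lambda>_. 1" i i]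
    show "integrable M (\<lambda>\<omega>. G E (sdigit i \<omega>))" by (simp add: depends_on_def)
  qed
  define H where "H x = G (insert p D) x - G D x / real b" for x
  have dep: "depends_on H (insert p D)"
    by (auto simp: depends_on_def H_def G_def)
  have cent: "centered b p H"
    unfolding centered_def
  proof
    fix x
    have 1: "G D (x(p := k)) = G D x" for k
      using insert.hyps by (auto simp: G_def)
    have 2: "G (insert p D) (x(p := k)) = (if k = c p then G D x else 0)" for k
      using insert.hyps by (auto simp: G_def)
    show "(\<Sum>k<b. H (x(p := k))) = 0"
      using b_pos insert.prems unfolding H_def 1 2 by (simp add: sum_subtractf sum.delta')
  qed
  have "expectation (\<lambda>\<omega>. H (sdigit i \<omega>)) = 0"
    using expectation_centered_eq_0[OF _ dep cent, of "{}" "\<lambda>_. 1" i i] insert.hyps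
    by (simp add: depends_on_def)
  then have "expectation (\<lambda>\<omega>. G (insert p D) (sdigit i \<omega>)) = expectation (\<lambda>\<omega>. G D (sdigit i \<omega>)) / real b"
    using G_int insert.hyps by (simp add: H_def)
  then show ?case
    using insert by (simp add: G_prob mult.commute)
qed

text \<open>A run of n digits \<open>b - 1\<close> has probability b^(-n), so an infinite run is a
  null event; only countably many starting places occur.\<close>

lemma AE_sdigit_not_top:
  "AE \<omega> in M. \<forall>i<b ^ m. \<forall>j k. \<exists>l\<ge>k. sdigit i \<omega> (j, l) \<noteq> b - 1"
proof -
  have "AE \<omega> in M. \<exists>l\<ge>k. sdigit i \<omega> (j, l) \<noteq> b - 1" for i j k
  proof -
    define E where "E = {\<omega> \<in> space M. \<forall>l\<ge>k. sdigit i \<omega> (j, l) = b - 1}"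
    have E: "E \<in> events" unfolding E_def by measurable
    have le: "prob E \<le> (1 / real b) ^ n" for n
    proof -
      let ?D = "(\<lambda>l. (j, l)) ` {k..<k + n}"
      have "prob E \<le> prob {\<omega> \<in> space M. \<forall>q\<in>?D. sdigit i \<omega> q = b - 1}"
        unfolding E_def by (intro finite_measure_mono) (auto, measurable)
      also have "\<dots> = 1 / real b ^ card ?D"
        using b_pos by (intro prob_sdigit) auto
      also have "card ?D = n" by (subst card_image) (auto simp: inj_on_def)
      finally show ?thesis by (simp add: power_divide)
    qed
    have "(\<lambda>n. (1 / real b) ^ n) \<longlonglongrightarrow> 0"
      using b by (intro LIMSEQ_power_zero) simp
    then have "prob E \<le> 0"
      using le by (intro LIMSEQ_le_const) auto
    then have "prob E = 0" by (simp add: measure_le_0_iff)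
    then have "AE \<omega> in M. \<omega> \<notin> E"
      using E by (simp add: prob_eq_0)
    then show ?thesis using AE_space by eventually_elim (auto simp: E_def)
  qed
  then show ?thesis
    by (simp add: AE_all_countable AE_ball_countable' countable_finite AE_all_countable[where 'i = 'd])
qed

end


subsection \<open>Cubic cells generate the Borel sets of the cube\<close>

lemma cells_dist:
  fixes x y :: "real ^ 'd::finite"
  assumes "0 < b" "x \<in> unit_cube" "y \<in> unit_cube" "cells b (\<lambda>_. k) x = cells b (\<lambda>_. k) y"
  shows "norm (x - y) \<le> sqrt (real CARD('d)) / real b ^ k"
proof -
  have *: "\<bar>x $ j - y $ j\<bar> \<le> 1 / real b ^ k" for j
  proof -
    have pos: "0 \<le> x $ j" "0 \<le> y $ j" using assms by (auto simp: unit_cube_def)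
    have eq: "cell b k (x $ j) = cell b k (y $ j)"
      using fun_cong[OF assms(4), of j] by (simp add: cells_def)
    have "real (cell b k (y $ j)) / real b ^ k \<le> x $ j"
      "x $ j < (real (cell b k (y $ j)) + 1) / real b ^ k"
      using cell_eq_iff[OF assms(1) pos(1), of k] eq by auto
    moreover have "real (cell b k (y $ j)) / real b ^ k \<le> y $ j"
      "y $ j < (real (cell b k (y $ j)) + 1) / real b ^ k"
      using cell_eq_iff[OF assms(1) pos(2), of k] by auto
    ultimately show ?thesis by (simp add: add_divide_distrib abs_le_iff)
  qed
  have "norm (x - y) = sqrt (\<Sum>j\<in>UNIV. (x $ j - y $ j)\<^sup>2)"
    by (simp add: norm_vec_def L2_set_def)
  also have "\<dots> \<le> sqrt (\<Sum>j\<in>(UNIV :: 'd set). (1 / real b ^ k)\<^sup>2)"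
    using * by (intro real_sqrt_le_mono sum_mono) (metis abs_le_square_iff abs_of_nonneg zero_le_divide_1_iff zero_le_power of_nat_0_le_iff)
  also have "\<dots> = sqrt (real CARD('d)) / real b ^ k"
    by (simp add: real_sqrt_mult)
  finally show ?thesis .
qed

text \<open>The empty set is included because two cubes of this grid may be disjoint and the family
  has to be closed under intersection.\<close>

definition cubic_cells :: "nat \<Rightarrow> (real ^ 'd::finite) set set" where
  "cubic_cells b = insert {} {elementary_interval b (\<lambda>_. k) \<tau> |k \<tau>. \<tau> \<in> cell_indices b (\<lambda>_. k)}"

lemma cells_const_mono:
  assumes "0 < b" "x \<in> unit_cube" "y \<in> unit_cube" "cells b (\<lambda>_. k) x = cells b (\<lambda>_. k) y" "l \<le> k"
  shows "cells b (\<lambda>_. l) x = cells b (\<lambda>_. l) y"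
proof
  fix j
  have "cell b k (x $ j) = cell b k (y $ j)"
    using fun_cong[OF assms(4), of j] by (simp add: cells_def)
  then show "cells b (\<lambda>_. l) x j = cells b (\<lambda>_. l) y j"
    using cell_eq_mono[OF assms(1), of "x $ j" "y $ j" k l] assms(2,3,5)
    by (simp add: cells_def unit_cube_def)
qed

text \<open>Two b-adic cubes are nested or disjoint, since equal digits to depth k are equal digits
  to every smaller depth.\<close>

lemma Int_stable_cubic_cells:
  assumes "0 < b"
  shows "Int_stable (cubic_cells b :: (real ^ 'd::finite) set set)"
proof -
  have *: "elementary_interval b (\<lambda>_. k) \<tau> \<inter> elementary_interval b (\<lambda>_. l) \<tau>'
      \<in> {{}, elementary_interval b (\<lambda>_. k) \<tau>}"
    if "l \<le> k" "\<tau> \<in> cell_indices b (\<lambda>_. k)" for k l and \<tau> \<tau>' :: "'d \<Rightarrow> nat"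
  proof (cases "elementary_interval b (\<lambda>_. k) \<tau> \<inter> elementary_interval b (\<lambda>_. l) \<tau>' = {}")
    case False
    then obtain x where x: "x \<in> elementary_interval b (\<lambda>_. k) \<tau>" "x \<in> elementary_interval b (\<lambda>_. l) \<tau>'"
      by blast
    note sub = elementary_interval_subset[OF assms that(2)]
    have "y \<in> elementary_interval b (\<lambda>_. l) \<tau>'" if y: "y \<in> elementary_interval b (\<lambda>_. k) \<tau>" for y
    proof -
      have xy: "x \<in> unit_cube" "y \<in> unit_cube" using x y sub by auto
      then have "cells b (\<lambda>_. k) y = cells b (\<lambda>_. k) x" "cells b (\<lambda>_. l) x = \<tau>'"
        using x y by (simp_all add: mem_elementary_interval_iff[OF assms])
      then have "cells b (\<lambda>_. l) y = \<tau>'"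
        using cells_const_mono[OF assms xy(2,1) _ \<open>l \<le> k\<close>] by simp
      then show ?thesis using xy by (simp add: mem_elementary_interval_iff[OF assms])
    qed
    then show ?thesis by blast
  qed simp
  have **: "elementary_interval b (\<lambda>_. k) \<tau> \<inter> elementary_interval b (\<lambda>_. l) \<tau>' \<in> cubic_cells b"
    if "\<tau> \<in> cell_indices b (\<lambda>_. k)" "\<tau>' \<in> cell_indices b (\<lambda>_. l)" for k l and \<tau> \<tau>' :: "'d \<Rightarrow> nat"
  proof (cases "l \<le> k")
    case True
    show ?thesis using *[OF True that(1), of \<tau>'] that unfolding cubic_cells_def by blast
  next
    case False
    then have "k \<le> l" by simp
    from *[OF this that(2), of \<tau>] show ?thesis
      using that unfolding cubic_cells_def by (auto simp: Int_commute)
  qed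
  show ?thesis
    unfolding Int_stable_def
  proof (intro ballI)
    fix X Y :: "(real ^ 'd) set"
    assume XY: "X \<in> cubic_cells b" "Y \<in> cubic_cells b"
    show "X \<inter> Y \<in> cubic_cells b"
    proof (cases "X = {} \<or> Y = {}")
      case True
      then show ?thesis by (auto simp: cubic_cells_def)
    next
      case False
      then obtain k \<tau> l \<tau>' where "\<tau> \<in> cell_indices b (\<lambda>_. k)" "X = elementary_interval b (\<lambda>_. k) \<tau>"
        "\<tau>' \<in> cell_indices b (\<lambda>_. l)" "Y = elementary_interval b (\<lambda>_. l) \<tau>'"
        using XY unfolding cubic_cells_def by blast
      then show ?thesis using ** by simp
    qed
  qed
qed

lemma cubic_cells_subset: "0 < b \<Longrightarrow> cubic_cells b \<subseteq> Pow unit_cube"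
  using elementary_interval_subset by (auto simp: cubic_cells_def)

lemma unit_cube_in_cubic_cells:
  assumes "0 < b"
  shows "(unit_cube :: (real ^ 'd::finite) set) \<in> cubic_cells b"
proof -
  let ?E = "elementary_interval b (\<lambda>_. 0) (\<lambda>_. 0) :: (real ^ 'd) set"
  have "?E = unit_cube"
    by (auto simp: elementary_interval_def unit_cube_def)
  moreover have "?E \<in> cubic_cells b"
    unfolding cubic_cells_def by (intro insertI2 CollectI exI[of _ 0] exI[of _ "\<lambda>_. 0"]) (auto simp: cell_indices_def)
  ultimately show ?thesis by simp
qed

text \<open>The trace of an open set on the cube is the union of the cubes contained in it: there
  are countably many, and those around a given point shrink to it.\<close>

lemma sets_uniform_cube_generated:
  assumes b: "2 \<le> b"
  shows "sets (uniform_cube :: (real ^ 'd::finite) measure) = sigma_sets unit_cube (cubic_cells b)"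
proof
  have b0: "0 < b" using b by simp
  have "cubic_cells b \<subseteq> sets (uniform_cube :: (real ^ 'd) measure)"
    using elementary_interval_sets_uniform[OF b0] by (auto simp: cubic_cells_def)
  then show "sigma_sets unit_cube (cubic_cells b) \<subseteq> sets (uniform_cube :: (real ^ 'd) measure)"
    using sets.sigma_sets_subset by (metis space_uniform_cube)
  have op: "unit_cube \<inter> S \<in> sigma_sets unit_cube (cubic_cells b)" if S: "open S" for S :: "(real ^ 'd) set"
  proof -
    define I where "I = {(k, \<tau>) |k \<tau>. \<tau> \<in> cell_indices b (\<lambda>_. k) \<and>
      (elementary_interval b (\<lambda>_. k) \<tau> :: (real ^ 'd) set) \<subseteq> S}"
    have "unit_cube \<inter> S = (\<Union>(k, \<tau>)\<in>I. elementary_interval b (\<lambda>_. k) \<tau>)"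
    proof
      show "(\<Union>(k, \<tau>)\<in>I. elementary_interval b (\<lambda>_. k) \<tau>) \<subseteq> unit_cube \<inter> S"
        using elementary_interval_subset[OF b0] by (auto simp: I_def)
      show "unit_cube \<inter> S \<subseteq> (\<Union>(k, \<tau>)\<in>I. elementary_interval b (\<lambda>_. k) \<tau>)"
      proof
        fix x assume x: "x \<in> unit_cube \<inter> S"
        then obtain e where e: "e > 0" "ball x e \<subseteq> S" using S open_contains_ball by blast
        have "(\<lambda>k. sqrt (real CARD('d)) / real b ^ k) \<longlonglongrightarrow> 0"
          using b by (intro tendsto_divide_0[OF tendsto_const] filterlim_at_top_imp_at_infinity
              filterlim_realpow_sequentially_gt1) auto
        then obtain k where k: "sqrt (real CARD('d)) / real b ^ k < e"
          using e(1) by (metis eventually_sequentially order_refl order_tendstoD(2))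
        let ?\<tau> = "cells b (\<lambda>_. k) x"
        have \<tau>: "?\<tau> \<in> cell_indices b (\<lambda>_. k)" using x cells_in_cell_indices[OF b0] by blast
        have "elementary_interval b (\<lambda>_. k) ?\<tau> \<subseteq> S"
        proof
          fix y assume y: "y \<in> elementary_interval b (\<lambda>_. k) ?\<tau>"
          then have yc: "y \<in> unit_cube" using elementary_interval_subset[OF b0 \<tau>] by blast
          then have "norm (x - y) \<le> sqrt (real CARD('d)) / real b ^ k"
            using y x by (intro cells_dist[OF b0]) (simp_all add: mem_elementary_interval_iff[OF b0])
          then show "y \<in> S" using e k by (auto simp: dist_norm subset_iff)
        qed
        then have "(k, ?\<tau>) \<in> I" using \<tau> by (simp add: I_def)
        moreover have "x \<in> elementary_interval b (\<lambda>_. k) ?\<tau>"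
          using x by (simp add: mem_elementary_interval_iff[OF b0])
        ultimately show "x \<in> (\<Union>(k, \<tau>)\<in>I. elementary_interval b (\<lambda>_. k) \<tau>)" by blast
      qed
    qed
    also have "\<dots> \<in> sigma_sets unit_cube (cubic_cells b)"
    proof (rule sigma_sets_UNION)
      show "countable ((\<lambda>(k, \<tau>). elementary_interval b (\<lambda>_. k) \<tau>) ` I)"
        by (intro countable_image) simp
      show "s \<in> sigma_sets unit_cube (cubic_cells b)"
        if "s \<in> (\<lambda>(k, \<tau>). elementary_interval b (\<lambda>_. k) \<tau>) ` I" for s :: "(real ^ 'd) set"
        using that by (intro sigma_sets.Basic) (auto simp: I_def cubic_cells_def)
    qed
    finally show ?thesis .
  qed
  have "sets (uniform_cube :: (real ^ 'd) measure) = (\<inter>) unit_cube ` sigma_sets UNIV {S. open S}"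
    by (simp add: uniform_cube_def sets_restrict_space borel_def)
  also have "\<dots> = sigma_sets unit_cube ((\<inter>) unit_cube ` {S. open S})"
  proof (rule sigma_sets_Int)
    show "unit_cube \<in> sigma_sets UNIV {S :: (real ^ 'd) set. open S}"
      using unit_cube_sets by (simp add: borel_def)
  qed simp
  also have "\<dots> \<subseteq> sigma_sets unit_cube (cubic_cells b)"
    using op by (intro sigma_sets_mono) auto
  finally show "sets (uniform_cube :: (real ^ 'd) measure) \<subseteq> sigma_sets unit_cube (cubic_cells b)" .
qed


subsection \<open>Scrambled points are uniform and form a net\<close>

definition point_digit :: "nat \<Rightarrow> real ^ 'd::finite \<Rightarrow> 'd \<times> nat \<Rightarrow> nat" where
  "point_digit b x q = digit b (x $ fst q) (Suc (snd q))"

definition digit_positions :: "('d::finite \<Rightarrow> nat) \<Rightarrow> ('d \<times> nat) set" where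
  "digit_positions k = (SIGMA j:UNIV. {..<k j})"

lemma finite_digit_positions: "finite (digit_positions k)"
  by (simp add: digit_positions_def)

lemma card_digit_positions: "card (digit_positions k) = (\<Sum>j\<in>UNIV. k j)"
  by (simp add: digit_positions_def)

lemma cells_eq_iff_point_digit:
  assumes "0 < b" "x \<in> unit_cube" "y \<in> unit_cube"
  shows "cells b k x = cells b k y \<longleftrightarrow> (\<forall>q\<in>digit_positions k. point_digit b x q = point_digit b y q)"
proof -
  have "cells b k x = cells b k y \<longleftrightarrow> (\<forall>j. cell b (k j) (x $ j) = cell b (k j) (y $ j))"
    by (simp add: cells_def fun_eq_iff)
  also have "\<dots> \<longleftrightarrow> (\<forall>j. \<forall>i<k j. digit b (x $ j) (Suc i) = digit b (y $ j) (Suc i))"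
    using assms by (subst cell_eq_iff_digits) (auto simp: unit_cube_def)
  also have "\<dots> \<longleftrightarrow> (\<forall>q\<in>digit_positions k. point_digit b x q = point_digit b y q)"
    by (auto simp: digit_positions_def point_digit_def)
  finally show ?thesis .
qed

context net_scrambling
begin

definition regular :: "'w \<Rightarrow> bool" where
  "regular \<omega> \<longleftrightarrow> \<omega> \<in> space M \<and> (\<forall>i<b ^ m. \<forall>j k. \<exists>l\<ge>k. sdigit i \<omega> (j, l) \<noteq> b - 1)"

lemma AE_regular: "AE \<omega> in M. regular \<omega>"
  using AE_sdigit_not_top AE_space by eventually_elim (simp add: regular_def)

lemma u_coord:
  assumes "i < b ^ m" "\<omega> \<in> space M"
  shows "u i \<omega> $ j = frac (digit_tail b (\<lambda>k. sdigit i \<omega> (j, k)) 0)"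
  unfolding u_eq[OF assms] scramble_def scramble_coord_def digit_tail_def sdigit_def node_perm_def
    node_def adigit_def
  by (simp del: upt_Suc)

lemma u_cube: "i < b ^ m \<Longrightarrow> \<omega> \<in> space M \<Longrightarrow> u i \<omega> \<in> unit_cube"
  by (simp add: unit_cube_def u_coord frac_lt_1)

lemma point_digit_u:
  assumes "i < b ^ m" "regular \<omega>"
  shows "point_digit b (u i \<omega>) q = sdigit i \<omega> q"
proof -
  obtain j k where q: "q = (j, k)" by force
  let ?d = "\<lambda>k. sdigit i \<omega> (j, k)"
  have \<omega>: "\<omega> \<in> space M" using assms by (simp add: regular_def)
  have d: "\<And>k. ?d k < b" by (rule sdigit_less[OF \<omega>])
  have top: "\<And>k. \<exists>l\<ge>k. ?d l \<noteq> b - 1" using assms by (simp add: regular_def)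
  have "u i \<omega> $ j = digit_tail b ?d 0"
    using u_coord[OF assms(1) \<omega>, of j] digit_tail_nonneg[where d = ?d and k = 0, OF b d]
      digit_tail_less[where d = ?d and k = 0, OF b d top]
    by (metis frac_eq)
  then show ?thesis
    using digit_digit_tail[where d = ?d and k = k, OF b d top] by (simp add: point_digit_def q)
qed

text \<open>Each coordinate is \<open>frac\<close> of a pointwise limit of finite digit
  sums.\<close>

lemma u_measurable:
  assumes i: "i < b ^ m"
  shows "u i \<in> measurable M uniform_cube"
  unfolding uniform_cube_def
proof (rule measurable_restrict_space2)
  show "u i \<in> space M \<rightarrow> unit_cube" using u_cube[OF i] by auto
  have frac: "(\<lambda>x :: real. frac x) \<in> borel_measurable borel"
    unfolding frac_def by measurable
  have "(\<lambda>\<omega>. u i \<omega> $ j) \<in> borel_measurable M" for j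
  proof -
    have "(\<lambda>\<omega>. digit_tail b (\<lambda>k. sdigit i \<omega> (j, k)) 0) \<in> borel_measurable M"
    proof (rule borel_measurable_LIMSEQ_real)
      show "(\<lambda>\<omega>. \<Sum>k<n. real (sdigit i \<omega> (j, k + 0)) / real b ^ Suc k) \<in> borel_measurable M" for n
        by measurable
      show "(\<lambda>n. \<Sum>k<n. real (sdigit i \<omega> (j, k + 0)) / real b ^ Suc k)
          \<longlonglongrightarrow> digit_tail b (\<lambda>k. sdigit i \<omega> (j, k)) 0" if "\<omega> \<in> space M" for \<omega>
        unfolding digit_tail_def
        by (rule summable_LIMSEQ[OF summable_digits[where d = "\<lambda>k. sdigit i \<omega> (j, k)" and k = 0, OF b sdigit_less[OF that]]])
    qed
    from measurable_compose[OF this frac] show ?thesis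
      by (rule measurable_cong[THEN iffD2, rotated]) (simp add: u_coord[OF i])
  qed
  then show "u i \<in> measurable M lborel"
    by (simp add: borel_measurable_euclidean_space[of "u i"] Basis_vec_def inner_axis)
qed

lemma prob_u_cell:
  assumes i: "i < b ^ m" and \<tau>: "\<tau> \<in> cell_indices b k"
  shows "prob (u i -` elementary_interval b k \<tau> \<inter> space M) = 1 / real b ^ (\<Sum>j\<in>UNIV. k j)"
proof -
  let ?E = "elementary_interval b k \<tau> :: (real ^ 'd) set" and ?D = "digit_positions k"
  define c where "c = point_digit b (corner b k \<tau> :: real ^ 'd)"
  have corner: "corner b k \<tau> \<in> ?E" "corner b k \<tau> \<in> unit_cube"
    using corner_in_elementary_interval[OF b_pos] elementary_interval_subset[OF b_pos \<tau>] by blast+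
  have "prob (u i -` ?E \<inter> space M) = prob {\<omega> \<in> space M. \<forall>q\<in>?D. sdigit i \<omega> q = c q}"
  proof (rule finite_measure_eq_AE)
    show "AE \<omega> in M. \<omega> \<in> u i -` ?E \<inter> space M \<longleftrightarrow> \<omega> \<in> {\<omega> \<in> space M. \<forall>q\<in>?D. sdigit i \<omega> q = c q}"
      using AE_regular
    proof eventually_elim
      case (elim \<omega>)
      then have \<omega>: "\<omega> \<in> space M" by (simp add: regular_def)
      have "u i \<omega> \<in> ?E \<longleftrightarrow> cells b k (u i \<omega>) = cells b k (corner b k \<tau>)"
        using corner by (simp add: mem_elementary_interval_iff[OF b_pos] u_cube[OF i \<omega>])
      also have "\<dots> \<longleftrightarrow> (\<forall>q\<in>?D. sdigit i \<omega> q = c q)"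
        unfolding cells_eq_iff_point_digit[OF b_pos u_cube[OF i \<omega>] corner(2)]
        by (simp add: point_digit_u[OF i elim] c_def)
      finally show ?case using \<omega> by simp
    qed
    show "u i -` ?E \<inter> space M \<in> events"
      by (rule measurable_sets[OF u_measurable[OF i] elementary_interval_sets_uniform[OF b_pos \<tau>]])
    show "{\<omega> \<in> space M. \<forall>q\<in>?D. sdigit i \<omega> q = c q} \<in> events"
      using finite_digit_positions[of k] by measurable
  qed
  also have "\<dots> = 1 / real b ^ card ?D"
    by (intro prob_sdigit finite_digit_positions) (simp add: c_def point_digit_def digit_less b_pos)
  finally show ?thesis by (simp add: card_digit_positions)
qed

text \<open>Both measures agree on the cubic cells by \<open>prob_u_cell\<close>, and these form an
  intersection-stable generator.\<close>

lemma distr_u: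
  assumes i: "i < b ^ m"
  shows "distr M uniform_cube (u i) = uniform_cube"
proof (rule measure_eqI_generator_eq[OF Int_stable_cubic_cells[OF b_pos] cubic_cells_subset[OF b_pos]])
  show "emeasure (distr M uniform_cube (u i)) X = emeasure uniform_cube X"
    if "X \<in> cubic_cells b" for X :: "(real ^ 'd) set"
  proof (cases "X = {}")
    case False
    then obtain k \<tau> where X: "X = elementary_interval b (\<lambda>_. k) \<tau>" and \<tau>: "\<tau> \<in> cell_indices b (\<lambda>_. k)"
      using \<open>X \<in> cubic_cells b\<close> by (auto simp: cubic_cells_def)
    have "emeasure (distr M uniform_cube (u i)) X = emeasure M (u i -` X \<inter> space M)"
      unfolding X by (rule emeasure_distr[OF u_measurable[OF i] elementary_interval_sets_uniform[OF b_pos \<tau>]])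
    also have "\<dots> = emeasure uniform_cube X"
      unfolding X U.emeasure_eq_measure emeasure_eq_measure
      by (simp add: measure_elementary_interval[OF b_pos \<tau>] prob_u_cell[OF i \<tau>])
    finally show ?thesis .
  qed simp
  show "sets (distr M uniform_cube (u i)) = sigma_sets unit_cube (cubic_cells b)"
    "sets (uniform_cube :: (real ^ 'd) measure) = sigma_sets unit_cube (cubic_cells b)"
    by (simp_all add: sets_uniform_cube_generated[OF b])
  show "range (\<lambda>_. unit_cube) \<subseteq> (cubic_cells b :: (real ^ 'd) set set)"
    using unit_cube_in_cubic_cells[OF b_pos] by auto
  show "emeasure (distr M uniform_cube (u i)) unit_cube \<noteq> \<infinity>" for n :: nat
    using u_measurable[OF i] by (subst emeasure_distr) (auto simp: sets_uniform_cube unit_cube_sets)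
qed simp

lemma
  assumes i: "i < b ^ m" and f: "f \<in> borel_measurable uniform_cube"
  shows integrable_u_iff: "integrable M (\<lambda>\<omega>. f (u i \<omega>) :: real) \<longleftrightarrow> integrable uniform_cube f"
    and expectation_u: "expectation (\<lambda>\<omega>. f (u i \<omega>)) = (LINT x|uniform_cube. f x)"
    and f_u_measurable: "(\<lambda>\<omega>. f (u i \<omega>)) \<in> borel_measurable M"
  using integrable_distr_eq[OF u_measurable[OF i] f] integral_distr[OF u_measurable[OF i] f]
    measurable_compose[OF u_measurable[OF i] f]
  by (simp_all add: distr_u[OF i])

text \<open>Induction on the depth, one coordinate at a time: while two points agree, their next
  digit is moved by one and the same injective permutation; once they are separated, they stay
  so.\<close>

lemma cell_scrambled_eq:
  assumes "i < b ^ m" "i' < b ^ m" "regular \<omega>"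
  shows "cells b k (u i \<omega>) = cells b k (u i' \<omega>) \<longleftrightarrow> cells b k (a i) = cells b k (a i')"
proof -
  have \<omega>: "\<omega> \<in> space M" using assms by (simp add: regular_def)
  have "cell b n (u i \<omega> $ j) = cell b n (u i' \<omega> $ j) \<longleftrightarrow> cell b n (a i $ j) = cell b n (a i' $ j)" for j n
  proof (induction n)
    case 0
    show ?case
      using assms a_cube u_cube[OF _ \<omega>] by (auto simp: unit_cube_def cell_0)
  next
    case (Suc n)
    have split: "cell b (Suc n) x = cell b (Suc n) y \<longleftrightarrow>
        cell b n x = cell b n y \<and> digit b x (Suc n) = digit b y (Suc n)"
      if "0 \<le> x" "0 \<le> y" for x y
      using that by (metis b_pos cell_Suc cell_Suc_div digit_eq_cell_mod)
    have nonneg: "0 \<le> u i \<omega> $ j" "0 \<le> u i' \<omega> $ j" "0 \<le> a i $ j" "0 \<le> a i' $ j"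
      using u_cube[OF assms(1) \<omega>] u_cube[OF assms(2) \<omega>] a_cube assms by (auto simp: unit_cube_def)
    have lt: "a i $ j < 1" "a i' $ j < 1"
      using a_cube assms by (auto simp: unit_cube_def)
    show ?case
    proof (cases "cell b n (a i $ j) = cell b n (a i' $ j)")
      case False
      then show ?thesis using Suc split nonneg by simp
    next
      case True
      then have node: "node i (j, n) = node i' (j, n)"
        using prefix_eq_iff[OF b_pos nonneg(3) lt(1) nonneg(4) lt(2), of n] by (simp add: node_def)
      have dig: "digit b (u i \<omega> $ j) (Suc n) = node_perm (node i (j, n)) \<omega> (digit b (a i $ j) (Suc n))"
        "digit b (u i' \<omega> $ j) (Suc n) = node_perm (node i (j, n)) \<omega> (digit b (a i' $ j) (Suc n))"
        using point_digit_u[OF assms(1,3), of "(j, n)"] point_digit_u[OF assms(2,3), of "(j, n)"] node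
        by (simp_all add: point_digit_def sdigit_def adigit_def)
      have "inj (node_perm (node i (j, n)) \<omega>)"
        using permutes_inj[OF node_perm_permutes[OF node_in \<omega>]] .
      then show ?thesis
        using True Suc split[OF nonneg(1,2)] split[OF nonneg(3,4)] dig by (simp add: inj_eq)
    qed
  qed
  then show ?thesis by (simp add: cells_def fun_eq_iff)
qed

text \<open>Scrambling is injective on the finitely many cells, hence permutes them.\<close>

lemma tmd_net_u:
  assumes "regular \<omega>"
  shows "tmd_net b t m (\<lambda>i. u i \<omega>)"
  unfolding tmd_net_def
proof (intro conjI allI impI)
  have \<omega>: "\<omega> \<in> space M" using assms by (simp add: regular_def)
  show "t \<le> m" using net by (simp add: tmd_net_def)
  show "u i \<omega> \<in> unit_cube" if "i < b ^ m" for i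
    using u_cube[OF that \<omega>] .
  fix k \<tau> assume "(\<forall>j. \<tau> j < b ^ k j) \<and> (\<Sum>j\<in>(UNIV :: 'd set). k j) + t = m"
  then have \<tau>: "\<tau> \<in> cell_indices b k" and k: "(\<Sum>j\<in>UNIV. k j) + t = m"
    by (auto simp: cell_indices_def)
  let ?N = "{..<b ^ m}"
  define A where "A \<sigma> = {i \<in> ?N. cells b k (a i) = \<sigma>}" for \<sigma>
  have cardA: "card (A \<sigma>) = b ^ t" if "\<sigma> \<in> cell_indices b k" for \<sigma>
    using net_card_cell[OF b_pos net _ that] k unfolding A_def
    by (simp add: algebra_simps flip: k)
  \<comment> \<open>One net point in each cell; the image of its cell under scrambling is the cell
    of the scrambled point.\<close>
  define r where "r \<sigma> = (SOME i. i \<in> A \<sigma>)" for \<sigma>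
  have r: "r \<sigma> \<in> A \<sigma>" if "\<sigma> \<in> cell_indices b k" for \<sigma>
  proof -
    have "A \<sigma> \<noteq> {}" using cardA[OF that] b_pos by (metis card.empty power_not_zero less_not_refl)
    then show ?thesis unfolding r_def by (simp add: some_in_eq)
  qed
  let ?h = "\<lambda>\<sigma>. cells b k (u (r \<sigma>) \<omega>)"
  have "inj_on ?h (cell_indices b k)"
  proof (rule inj_onI)
    fix \<sigma> \<sigma>' assume *: "\<sigma> \<in> cell_indices b k" "\<sigma>' \<in> cell_indices b k" "?h \<sigma> = ?h \<sigma>'"
    then have "cells b k (a (r \<sigma>)) = cells b k (a (r \<sigma>'))"
      using cell_scrambled_eq[OF _ _ assms] r by (auto simp: A_def)
    then show "\<sigma> = \<sigma>'" using r *(1,2) by (auto simp: A_def)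
  qed
  moreover have "?h ` cell_indices b k \<subseteq> cell_indices b k"
    using r cells_in_cell_indices[OF b_pos u_cube[OF _ \<omega>]] by (auto simp: A_def)
  ultimately have surj: "?h ` cell_indices b k = cell_indices b k"
    by (intro endo_inj_surj finite_cell_indices)
  have "\<tau> \<in> ?h ` cell_indices b k"
    using \<tau> by (simp only: surj)
  then obtain \<sigma> where \<sigma>: "\<tau> = ?h \<sigma>" "\<sigma> \<in> cell_indices b k"
    by (rule imageE)
  have "{i. i < b ^ m \<and> u i \<omega> \<in> elementary_interval b k \<tau>} = A \<sigma>"
  proof -
    have "u i \<omega> \<in> elementary_interval b k \<tau> \<longleftrightarrow> cells b k (a i) = \<sigma>" if i: "i < b ^ m" for i
    proof -
      have "u i \<omega> \<in> elementary_interval b k \<tau> \<longleftrightarrow> cells b k (u i \<omega>) = cells b k (u (r \<sigma>) \<omega>)"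
        using mem_elementary_interval_iff[OF b_pos u_cube[OF i \<omega>]] \<sigma>(1) by simp
      also have "\<dots> \<longleftrightarrow> cells b k (a i) = cells b k (a (r \<sigma>))"
        using r[OF \<sigma>(2)] by (intro cell_scrambled_eq[OF i _ assms]) (simp add: A_def)
      finally show ?thesis using r[OF \<sigma>(2)] by (simp add: A_def)
    qed
    then show ?thesis by (auto simp: A_def)
  qed
  then show "card {i. i < b ^ m \<and> u i \<omega> \<in> elementary_interval b k \<tau>} = b ^ t"
    using cardA[OF \<sigma>(2)] by simp
qed

end


subsection \<open>Density of step functions in the square integrable functions\<close>

definition L2 :: "'a measure \<Rightarrow> ('a \<Rightarrow> real) \<Rightarrow> bool" where
  "L2 M f \<longleftrightarrow> f \<in> borel_measurable M \<and> integrable M (\<lambda>x. (f x)\<^sup>2)"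

lemma square_add_le: "(x + y)\<^sup>2 \<le> 2 * x\<^sup>2 + 2 * (y :: real)\<^sup>2"
  using zero_le_power2[of "x - y"] by (simp add: power2_sum power2_diff)

lemma L2_add:
  assumes "L2 M f" "L2 M g"
  shows "L2 M (\<lambda>x. f x + g x)"
proof -
  have "integrable M (\<lambda>x. (f x + g x)\<^sup>2)"
  proof (rule Bochner_Integration.integrable_bound)
    show "integrable M (\<lambda>x. 2 * (f x)\<^sup>2 + 2 * (g x)\<^sup>2)"
      using assms by (simp add: L2_def)
    show "(\<lambda>x. (f x + g x)\<^sup>2) \<in> borel_measurable M"
      using assms by (auto simp: L2_def)
    show "AE x in M. norm ((f x + g x)\<^sup>2) \<le> norm (2 * (f x)\<^sup>2 + 2 * (g x)\<^sup>2)"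
      by (auto intro!: AE_I2 order_trans[OF square_add_le])
  qed
  then show ?thesis using assms by (auto simp: L2_def intro!: borel_measurable_add)
qed

lemma L2_scale: "L2 M f \<Longrightarrow> L2 M (\<lambda>x. c * f x)"
  by (auto simp: L2_def power_mult_distrib intro!: borel_measurable_times)

lemma L2_diff:
  assumes "L2 M f" "L2 M g"
  shows "L2 M (\<lambda>x. f x - g x)"
  using L2_add[OF assms(1) L2_scale[OF assms(2), of "-1"]] by simp

lemma L2_integral_add_le:
  assumes "L2 M f" "L2 M g"
  shows "(LINT x|M. (f x + g x)\<^sup>2) \<le> 2 * (LINT x|M. (f x)\<^sup>2) + 2 * (LINT x|M. (g x)\<^sup>2)"
proof -
  have "(LINT x|M. (f x + g x)\<^sup>2) \<le> (LINT x|M. 2 * (f x)\<^sup>2 + 2 * (g x)\<^sup>2)"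
    using L2_add[OF assms] assms by (intro integral_mono square_add_le) (simp_all add: L2_def)
  then show ?thesis using assms by (simp add: L2_def)
qed

lemma (in prob_space) L2_bounded:
  assumes "f \<in> borel_measurable M" "\<And>x. x \<in> space M \<Longrightarrow> \<bar>f x\<bar> \<le> B"
  shows "L2 M f"
proof -
  have "integrable M (\<lambda>x. (f x)\<^sup>2)"
  proof (rule integrable_const_bound[where B = "B\<^sup>2"])
    have "norm ((f x)\<^sup>2) \<le> B\<^sup>2" if "x \<in> space M" for x
      using power_mono[OF assms(2)[OF that], of 2] by simp
    then show "AE x in M. norm ((f x)\<^sup>2) \<le> B\<^sup>2" by auto
  qed (use assms in simp)
  then show ?thesis using assms by (simp add: L2_def)
qed

lemma (in prob_space) L2_integrable:
  assumes "L2 M f"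
  shows "integrable M f"
proof (rule Bochner_Integration.integrable_bound)
  show "integrable M (\<lambda>x. 1 + (f x)\<^sup>2)" using assms by (simp add: L2_def)
  have "\<bar>y\<bar> \<le> 1 + y\<^sup>2" for y :: real
    using zero_le_power2[of "\<bar>y\<bar> - 1"] by (simp add: power2_diff)
  then show "AE x in M. norm (f x) \<le> norm (1 + (f x)\<^sup>2)"
    by (auto intro!: AE_I2 order_trans[OF _ abs_ge_self])
qed (use assms in \<open>simp add: L2_def\<close>)

lemma (in prob_space) square_expectation_le:
  assumes "L2 M f"
  shows "(expectation f)\<^sup>2 \<le> expectation (\<lambda>x. (f x)\<^sup>2)"
proof -
  have "0 \<le> expectation (\<lambda>x. (f x - expectation f)\<^sup>2)" by simp
  also have "\<dots> = expectation (\<lambda>x. (f x)\<^sup>2) - (expectation f)\<^sup>2"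
    using L2_integrable[OF assms] assms by (intro variance_eq) (simp_all add: L2_def)
  finally show ?thesis by simp
qed

lemma step_fun_mono:
  assumes "0 < b" "step_fun b (\<lambda>_. l) f" "l \<le> k"
  shows "step_fun b (\<lambda>_. k) f"
  using assms cells_const_mono[OF assms(1) _ _ _ assms(3)] unfolding step_fun_def by blast

lemma step_fun_L2:
  fixes f :: "real ^ 'd::finite \<Rightarrow> real"
  assumes "0 < b" "step_fun b k f"
  shows "L2 uniform_cube f"
proof (rule U.L2_bounded[OF step_fun_measurable[OF assms]])
  fix x :: "real ^ 'd" assume "x \<in> space uniform_cube"
  then have x: "x \<in> unit_cube" by simp
  have "\<bar>f x\<bar> \<le> (\<Sum>\<tau>\<in>cell_indices b k. \<bar>f (corner b k \<tau>) * indicator (elementary_interval b k \<tau>) x\<bar>)"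
    unfolding step_fun_eq_sum[OF assms x] by (rule sum_abs)
  also have "\<dots> \<le> (\<Sum>\<tau>\<in>cell_indices b k. \<bar>f (corner b k \<tau>)\<bar>)"
    by (intro sum_mono) (auto simp: indicator_def)
  finally show "\<bar>f x\<bar> \<le> (\<Sum>\<tau>\<in>cell_indices b k. \<bar>f (corner b k \<tau>)\<bar>)" .
qed

text \<open>The mean square closure of the step functions on cubes; the lemmas below show that it is
  all of L2.\<close>

definition approximable :: "nat \<Rightarrow> (real ^ 'd::finite \<Rightarrow> real) \<Rightarrow> bool" where
  "approximable b f \<longleftrightarrow> L2 uniform_cube f \<and>
     (\<forall>e>0. \<exists>k s. step_fun b (\<lambda>_. k) s \<and> (LINT x|uniform_cube. (f x - s x)\<^sup>2) \<le> e)"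

lemma approximable_limit:
  assumes b: "0 < b" and f: "L2 uniform_cube f"
    and ap: "\<And>e. e > 0 \<Longrightarrow> \<exists>g. approximable b g \<and> (LINT x|uniform_cube. (f x - g x)\<^sup>2) \<le> e"
  shows "approximable b f"
  unfolding approximable_def
proof (intro conjI allI impI f)
  fix e :: real assume "e > 0"
  \<comment> \<open>Each of the two errors is doubled when the square of their sum is split; e / 4
    apiece therefore gives e.\<close>
  then obtain g where g: "approximable b g" "(LINT x|uniform_cube. (f x - g x)\<^sup>2) \<le> e / 4"
    using ap[of "e / 4"] by auto
  then obtain k s where s: "step_fun b (\<lambda>_. k) s" "(LINT x|uniform_cube. (g x - s x)\<^sup>2) \<le> e / 4"
    using \<open>e > 0\<close> unfolding approximable_def by (meson divide_pos_pos zero_less_numeral)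
  have gL: "L2 uniform_cube g" using g by (simp add: approximable_def)
  have "(LINT x|uniform_cube. (f x - s x)\<^sup>2) = (LINT x|uniform_cube. ((f x - g x) + (g x - s x))\<^sup>2)"
    by simp
  also have "\<dots> \<le> 2 * (LINT x|uniform_cube. (f x - g x)\<^sup>2) + 2 * (LINT x|uniform_cube. (g x - s x)\<^sup>2)"
    by (intro L2_integral_add_le L2_diff f gL step_fun_L2[OF b s(1)])
  also have "\<dots> \<le> e" using g(2) s(2) by simp
  finally show "\<exists>k s. step_fun b (\<lambda>_. k) s \<and> (LINT x|uniform_cube. (f x - s x)\<^sup>2) \<le> e"
    using s(1) by blast
qed

lemma approximable_step_fun: "0 < b \<Longrightarrow> step_fun b (\<lambda>_. k) f \<Longrightarrow> approximable b f"
  unfolding approximable_def by (auto intro!: step_fun_L2 exI[of _ k] exI[of _ f])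

lemma approximable_add:
  assumes b: "0 < b" and f: "approximable b f" and g: "approximable b g"
  shows "approximable b (\<lambda>x. f x + g x)"
  unfolding approximable_def
proof (intro conjI allI impI)
  have L: "L2 uniform_cube f" "L2 uniform_cube g" using f g by (simp_all add: approximable_def)
  then show "L2 uniform_cube (\<lambda>x. f x + g x)" by (rule L2_add)
  fix e :: real assume "e > 0"
  then have "e / 4 > 0" by simp
  then obtain k s l r where s: "step_fun b (\<lambda>_. k) s" "(LINT x|uniform_cube. (f x - s x)\<^sup>2) \<le> e / 4"
    and r: "step_fun b (\<lambda>_. l) r" "(LINT x|uniform_cube. (g x - r x)\<^sup>2) \<le> e / 4"
    using f g unfolding approximable_def by meson
  have "step_fun b (\<lambda>_. max k l) s" "step_fun b (\<lambda>_. max k l) r"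
    using step_fun_mono[OF b s(1)] step_fun_mono[OF b r(1)] by simp_all
  then have "step_fun b (\<lambda>_. max k l) (\<lambda>x. s x + r x)"
    unfolding step_fun_def by metis
  moreover have "(LINT x|uniform_cube. ((f x + g x) - (s x + r x))\<^sup>2) \<le> e"
  proof -
    have "(LINT x|uniform_cube. ((f x + g x) - (s x + r x))\<^sup>2)
        = (LINT x|uniform_cube. ((f x - s x) + (g x - r x))\<^sup>2)"
      by (simp add: algebra_simps)
    also have "\<dots> \<le> 2 * (LINT x|uniform_cube. (f x - s x)\<^sup>2) + 2 * (LINT x|uniform_cube. (g x - r x)\<^sup>2)"
      by (intro L2_integral_add_le L2_diff L step_fun_L2[OF b s(1)] step_fun_L2[OF b r(1)])
    also have "\<dots> \<le> e" using s(2) r(2) by simp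
    finally show ?thesis .
  qed
  ultimately show "\<exists>k s. step_fun b (\<lambda>_. k) s \<and> (LINT x|uniform_cube. ((f x + g x) - s x)\<^sup>2) \<le> e"
    by blast
qed

lemma approximable_scale:
  assumes b: "0 < b" and f: "approximable b f"
  shows "approximable b (\<lambda>x. c * f x)"
  unfolding approximable_def
proof (intro conjI allI impI)
  show "L2 uniform_cube (\<lambda>x. c * f x)" using f by (simp add: approximable_def L2_scale)
  fix e :: real assume "e > 0"
  then have "e / (1 + c\<^sup>2) > 0" by (simp add: add_pos_nonneg)
  then obtain k s where s: "step_fun b (\<lambda>_. k) s" "(LINT x|uniform_cube. (f x - s x)\<^sup>2) \<le> e / (1 + c\<^sup>2)"
    using f unfolding approximable_def by meson
  have "(LINT x|uniform_cube. (c * f x - c * s x)\<^sup>2) = c\<^sup>2 * (LINT x|uniform_cube. (f x - s x)\<^sup>2)"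
    by (simp add: power_mult_distrib flip: right_diff_distrib)
  also have "\<dots> \<le> c\<^sup>2 * (e / (1 + c\<^sup>2))"
    by (intro mult_left_mono s(2)) simp
  also have "\<dots> \<le> e"
    using \<open>e > 0\<close> by (simp add: divide_le_eq add_pos_nonneg algebra_simps)
  finally have "(LINT x|uniform_cube. (c * f x - c * s x)\<^sup>2) \<le> e" .
  moreover have "step_fun b (\<lambda>_. k) (\<lambda>x. c * s x)"
    using s(1) unfolding step_fun_def by metis
  ultimately show "\<exists>k s. step_fun b (\<lambda>_. k) s \<and> (LINT x|uniform_cube. (c * f x - s x)\<^sup>2) \<le> e"
    by blast
qed

lemma approximable_cong:
  assumes "\<And>x. x \<in> unit_cube \<Longrightarrow> f x = g x" "approximable b f"
  shows "approximable b g"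
proof -
  have "L2 uniform_cube f = L2 uniform_cube g"
    unfolding L2_def using assms(1)
    by (intro arg_cong2[where f = "(\<and>)"] measurable_cong Bochner_Integration.integrable_cong) auto
  moreover have "(LINT x|uniform_cube. (f x - s x)\<^sup>2) = (LINT x|uniform_cube. (g x - s x)\<^sup>2)" for s
    using assms(1) by (intro Bochner_Integration.integral_cong) auto
  ultimately show ?thesis using assms(2) by (simp add: approximable_def)
qed

lemma approximable_sum:
  assumes "0 < b" "\<And>i. i \<in> I \<Longrightarrow> approximable b (f i)"
  shows "approximable b (\<lambda>x. \<Sum>i\<in>I. f i x)"
  using assms(2)
proof (induction I rule: infinite_finite_induct)
  case (insert i I)
  then have "approximable b (\<lambda>x. f i x + (\<Sum>i\<in>I. f i x))"
    by (intro approximable_add[OF assms(1)]) auto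
  with insert.hyps show ?case by simp
qed (auto intro!: approximable_step_fun[OF assms(1), of 0] simp: step_fun_def)

lemma L2_dominated_convergence:
  assumes s: "\<And>i. s i \<in> borel_measurable M" and f: "L2 M f" and w: "integrable M w"
    and lim: "\<And>x. x \<in> space M \<Longrightarrow> (\<lambda>i. s i x) \<longlonglongrightarrow> f x"
    and bd: "\<And>i x. x \<in> space M \<Longrightarrow> (f x - s i x)\<^sup>2 \<le> w x"
    and e: "e > 0"
  shows "\<exists>i. (LINT x|M. (f x - s i x)\<^sup>2) \<le> e"
proof -
  have "(\<lambda>i. LINT x|M. (f x - s i x)\<^sup>2) \<longlonglongrightarrow> (LINT x|M. 0)"
  proof (rule integral_dominated_convergence[where w = w])
    show "AE x in M. (\<lambda>i. (f x - s i x)\<^sup>2) \<longlonglongrightarrow> 0"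
    proof (rule AE_I2)
      fix x assume "x \<in> space M"
      from tendsto_power[OF tendsto_diff[OF tendsto_const[of "f x"] lim[OF this]], of 2]
      show "(\<lambda>i. (f x - s i x)\<^sup>2) \<longlonglongrightarrow> 0" by simp
    qed
    show "AE x in M. norm ((f x - s i x)\<^sup>2) \<le> w x" for i
      using bd by auto
  qed (use s f w in \<open>auto simp: L2_def\<close>)
  then have "\<forall>\<^sub>F i in sequentially. (LINT x|M. (f x - s i x)\<^sup>2) < e"
    using e by (intro order_tendstoD(2)) simp_all
  then show ?thesis
    by (meson eventually_happens less_imp_le sequentially_bot)
qed

text \<open>Dynkin induction from the cubic cells: the sets with approximable indicator are closed
  under complement and, by dominated convergence, under countable disjoint union.\<close>

lemma approximable_indicator:
  fixes A :: "(real ^ 'd::finite) set"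
  assumes b: "2 \<le> b" and A: "A \<in> sets uniform_cube"
  shows "approximable b (indicator A)"
proof -
  have b0: "0 < b" using b by simp
  have "A \<in> sigma_sets unit_cube (cubic_cells b)"
    using A sets_uniform_cube_generated[OF b] by blast
  from Int_stable_cubic_cells[OF b0] cubic_cells_subset[OF b0] this show ?thesis
  proof (induction rule: sigma_sets_induct_disjoint)
    case (basic A)
    show ?case
    proof (cases "A = {}")
      case True
      then show ?thesis by (intro approximable_step_fun[OF b0, of 0]) (simp add: step_fun_def)
    next
      case False
      then obtain k \<tau> where A: "A = elementary_interval b (\<lambda>_. k) \<tau>"
        using basic by (auto simp: cubic_cells_def)
      show ?thesis
        by (intro approximable_step_fun[OF b0, of k])
          (auto simp: step_fun_def A indicator_def mem_elementary_interval_iff[OF b0])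
    qed
  next
    case empty
    show ?case by (intro approximable_step_fun[OF b0, of 0]) (simp add: step_fun_def)
  next
    case (compl A)
    have "approximable b (\<lambda>_ :: real ^ 'd. 1)"
      by (intro approximable_step_fun[OF b0, of 0]) (simp add: step_fun_def)
    from approximable_add[OF b0 this approximable_scale[OF b0 compl.IH, of "-1"]]
    show ?case
      by (rule approximable_cong[rotated]) (auto simp: indicator_def)
  next
    case (union A)
    have meas: "A i \<in> sets uniform_cube" for i
      using union.hyps(2) by (auto simp: sets_uniform_cube_generated[OF b])
    have sum: "(\<Sum>i<n. indicator (A i) x :: real) = indicator (\<Union>i<n. A i) x" for n x
      using union.hyps(1) by (subst indicator_UN_disjoint) (auto intro: disjoint_family_on_mono)
    show ?case
    proof (rule approximable_limit[OF b0])
      show L: "L2 uniform_cube (indicat_real (\<Union>i. A i))"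
        using meas by (intro U.L2_bounded[where B = 1]) (auto simp: indicator_def)
      fix e :: real assume "e > 0"
      have "\<exists>n. (LINT x|uniform_cube. (indicator (\<Union>i. A i) x - (\<Sum>i<n. indicator (A i) x))\<^sup>2) \<le> e"
      proof (rule L2_dominated_convergence[where w = "\<lambda>_. 1"])
        show "(\<lambda>n. \<Sum>i<n. indicator (A i) x) \<longlonglongrightarrow> indicat_real (\<Union>i. A i) x" for x
          unfolding sum by (rule LIMSEQ_indicator_UN)
        show "(indicator (\<Union>i. A i) x - (\<Sum>i<n. indicator (A i) x))\<^sup>2 \<le> (1 :: real)" for n x
          unfolding sum by (auto simp: indicator_def)
      qed (use L meas \<open>e > 0\<close> in auto)
      moreover have "approximable b (\<lambda>x. \<Sum>i<n. indicator (A i) x)" for n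
        by (intro approximable_sum b0 union.IH)
      ultimately show "\<exists>g. approximable b g \<and> (LINT x|uniform_cube. (indicator (\<Union>i. A i) x - g x)\<^sup>2) \<le> e"
        by blast
    qed
  qed
qed

lemma L2_approximable:
  fixes f :: "real ^ 'd::finite \<Rightarrow> real"
  assumes b: "2 \<le> b" and f: "L2 uniform_cube f"
  shows "approximable b f"
proof -
  have b0: "0 < b" using b by simp
  have simple: "approximable b h" if "simple_function uniform_cube h" for h :: "real ^ 'd \<Rightarrow> real"
  proof -
    have "emeasure uniform_cube {y \<in> space uniform_cube. h y \<noteq> 0} \<noteq> \<infinity>"
      by (simp add: U.emeasure_eq_measure)
    with that show ?thesis
    proof (induction rule: integrable_simple_function_induct)
      case (cong f g)
      then show ?case using approximable_cong[of f g] by simp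
    next
      case (indicator A y)
      then show ?case
        using approximable_scale[OF b0 approximable_indicator[OF b indicator(1)], of y]
        by (simp add: mult.commute)
    next
      case (add f g)
      then show ?case by (intro approximable_add[OF b0])
    qed
  qed
  have "f \<in> borel_measurable uniform_cube" using f by (simp add: L2_def)
  from borel_measurable_implies_sequence_metric[OF this, of 0]
  obtain s where "\<forall>i. simple_function uniform_cube (s i)"
    "\<forall>x\<in>space uniform_cube. (\<lambda>i. s i x) \<longlonglongrightarrow> f x"
    "\<forall>i. \<forall>x\<in>space uniform_cube. dist (s i x) 0 \<le> 2 * dist (f x) 0"
    by blast
  then have s: "simple_function uniform_cube (s i)"
    "x \<in> space uniform_cube \<Longrightarrow> (\<lambda>i. s i x) \<longlonglongrightarrow> f x"
    "x \<in> space uniform_cube \<Longrightarrow> \<bar>s i x\<bar> \<le> 2 * \<bar>f x\<bar>" for i x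
    by (simp_all add: dist_norm)
  show ?thesis
  proof (rule approximable_limit[OF b0 f])
    fix e :: real assume e: "e > 0"
    have "\<exists>i. (LINT x|uniform_cube. (f x - s i x)\<^sup>2) \<le> e"
    proof (rule L2_dominated_convergence[OF _ f _ s(2) _ e])
      show "s i \<in> borel_measurable uniform_cube" for i
        using s(1) by (rule borel_measurable_simple_function)
      \<comment> \<open>The simple functions satisfy |s| <= 2 |f|, so |f - s| <= 3 |f|, and the
        square is dominated by 9 f^2.\<close>
      show "integrable uniform_cube (\<lambda>x. 9 * (f x)\<^sup>2)" using f by (simp add: L2_def)
      fix i x assume "x \<in> space (uniform_cube :: (real ^ 'd) measure)"
      from s(3)[OF this, of i] have "\<bar>f x - s i x\<bar> \<le> \<bar>3 * f x\<bar>"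
        unfolding abs_mult by linarith
      then have "(f x - s i x)\<^sup>2 \<le> (3 * f x)\<^sup>2" by (simp only: abs_le_square_iff)
      then show "(f x - s i x)\<^sup>2 \<le> 9 * (f x)\<^sup>2" by (simp add: power_mult_distrib)
    qed
    then show "\<exists>g. approximable b g \<and> (LINT x|uniform_cube. (f x - g x)\<^sup>2) \<le> e"
      using simple s(1) by blast
  qed
qed


subsection \<open>The variance of scrambled net averages\<close>

lemma L2_measurable_square: "L2 M f \<Longrightarrow> (\<lambda>x. (f x)\<^sup>2) \<in> borel_measurable M"
  unfolding L2_def by (blast intro: borel_measurable_integrable)

lemma measure_unit_cube [simp]: "measure uniform_cube unit_cube = 1"
  by (simp add: measure_def emeasure_uniform_cube sets_uniform_cube unit_cube_sets emeasure_unit_cube)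

section \<open>Depth of a digit set, and digit functions as step functions\<close>

lemma exists_le_with_sum:
  fixes K :: "'d::finite \<Rightarrow> nat"
  assumes "n \<le> (\<Sum>j\<in>UNIV. K j)"
  shows "\<exists>K'. (\<forall>j. K' j \<le> K j) \<and> (\<Sum>j\<in>UNIV. K' j) = n"
  using assms
proof (induction n)
  case 0
  show ?case by (rule exI[of _ "\<lambda>_. 0"]) simp
next
  case (Suc n)
  then obtain K' where K': "\<forall>j. K' j \<le> K j" "(\<Sum>j\<in>UNIV. K' j) = n" by auto
  have "\<exists>j. K' j < K j"
  proof (rule ccontr)
    assume "\<not> ?thesis"
    then have "(\<Sum>j\<in>UNIV. K j) \<le> (\<Sum>j\<in>UNIV. K' j)" by (intro sum_mono) (simp add: not_less)
    then show False using K' Suc.prems by simp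
  qed
  then obtain j where j: "K' j < K j" by blast
  have "(\<Sum>i\<in>UNIV. (K'(j := Suc (K' j))) i) = Suc (K' j) + (\<Sum>i\<in>UNIV - {j}. K' i)"
    by (subst sum.remove[of UNIV j]) (auto intro!: sum.cong)
  also have "\<dots> = Suc (\<Sum>j\<in>UNIV. K' j)"
    by (simp add: sum.remove[of UNIV j K'])
  finally show ?case
    using K' j by (intro exI[of _ "K'(j := Suc (K' j))"]) auto
qed

text \<open>The depth in coordinate j at which all digits of S become visible, 0 if S has none
  there. If it is positive, the deepest digit, of index \<open>level S j - 1\<close>, belongs to S
  itself.\<close>

definition level :: "('d \<times> nat) set \<Rightarrow> 'd \<Rightarrow> nat" where
  "level S j = Max (insert 0 (Suc ` {k. (j, k) \<in> S}))"

lemma finite_section: "finite S \<Longrightarrow> finite {k. (j, k) \<in> S}"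
  by (rule finite_subset[of _ "snd ` S"]) force+

lemma less_level:
  assumes "finite S" "(j, k) \<in> S"
  shows "k < level S j"
proof -
  have "Suc k \<le> level S j"
    unfolding level_def using finite_section[OF assms(1)] assms(2) by (intro Max_ge) auto
  then show ?thesis by simp
qed

lemma level_mem:
  assumes "finite S" "0 < level S j"
  shows "(j, level S j - 1) \<in> S"
proof -
  have "level S j \<in> insert 0 (Suc ` {k. (j, k) \<in> S})"
    unfolding level_def using finite_section[OF assms(1)] by (intro Max_in) auto
  then show ?thesis using assms(2) by auto
qed

lemma subset_digit_positions_level: "finite S \<Longrightarrow> S \<subseteq> digit_positions (level S)"
  using less_level by (fastforce simp: digit_positions_def)

lemma step_fun_point_digit:
  assumes "0 < b" "depends_on G S" "S \<subseteq> digit_positions k"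
  shows "step_fun b k (\<lambda>x. G (point_digit b x))"
  unfolding step_fun_def
proof (intro ballI impI)
  fix x y :: "real ^ 'a" assume "x \<in> unit_cube" "y \<in> unit_cube" "cells b k x = cells b k y"
  then show "G (point_digit b x) = G (point_digit b y)"
    using cells_eq_iff_point_digit[OF assms(1)] assms(3) by (intro depends_onD[OF assms(2)]) blast
qed

text \<open>G evaluates f at some point of the cube with the prescribed digits. For a pattern that
  no point has, the choice is arbitrary and harmless, since G is compared with f only at digits of
  actual points.\<close>

lemma step_fun_eq_point_digit:
  fixes f :: "real ^ 'd::finite \<Rightarrow> real"
  assumes "0 < b" "step_fun b k f"
  obtains G where "depends_on G (digit_positions k)" "\<And>x. x \<in> unit_cube \<Longrightarrow> f x = G (point_digit b x)"
proof
  define A where "A y = {x. x \<in> unit_cube \<and> (\<forall>q\<in>digit_positions k. point_digit b x q = y q)}"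
    for y :: "'d \<times> nat \<Rightarrow> nat"
  define G where "G y = f (SOME x. x \<in> A y)" for y
  show "depends_on G (digit_positions k)"
    unfolding depends_on_def
  proof (intro allI impI)
    fix x y :: "'d \<times> nat \<Rightarrow> nat" assume "\<forall>q\<in>digit_positions k. x q = y q"
    then have "A x = A y" unfolding A_def by auto
    then show "G x = G y" by (simp add: G_def)
  qed
  fix x :: "real ^ 'd" assume x: "x \<in> unit_cube"
  then have "x \<in> A (point_digit b x)" by (simp add: A_def)
  then have "(SOME y. y \<in> A (point_digit b x)) \<in> A (point_digit b x)" by (rule someI)
  then have "(SOME y. y \<in> A (point_digit b x)) \<in> unit_cube"
    "cells b k (SOME y. y \<in> A (point_digit b x)) = cells b k x"
    using cells_eq_iff_point_digit[OF assms(1) _ x] by (auto simp: A_def)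
  then show "f x = G (point_digit b x)"
    using assms(2) x unfolding G_def step_fun_def by metis
qed

lemma expectation_square_sum:
  fixes X :: "'i \<Rightarrow> 'a \<Rightarrow> real"
  assumes "\<And>p q. p \<in> I \<Longrightarrow> q \<in> I \<Longrightarrow> integrable M (\<lambda>\<omega>. X p \<omega> * X q \<omega>)"
  shows "(LINT \<omega>|M. (\<Sum>p\<in>I. X p \<omega>)\<^sup>2) = (\<Sum>p\<in>I. \<Sum>q\<in>I. LINT \<omega>|M. X p \<omega> * X q \<omega>)"
proof -
  have "(LINT \<omega>|M. (\<Sum>p\<in>I. X p \<omega>)\<^sup>2) = (LINT \<omega>|M. (\<Sum>p\<in>I. \<Sum>q\<in>I. X p \<omega> * X q \<omega>))"
    by (simp add: power2_eq_square sum_product)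
  also have "\<dots> = (\<Sum>p\<in>I. LINT \<omega>|M. (\<Sum>q\<in>I. X p \<omega> * X q \<omega>))"
    using assms by (intro Bochner_Integration.integral_sum Bochner_Integration.integrable_sum)
  also have "\<dots> = (\<Sum>p\<in>I. \<Sum>q\<in>I. LINT \<omega>|M. X p \<omega> * X q \<omega>)"
    using assms by (intro sum.cong refl Bochner_Integration.integral_sum)
  finally show ?thesis .
qed

context net_scrambling
begin

lemma t_le_m: "t \<le> m"
  using net by (simp add: tmd_net_def)

text \<open>A node records the digits before its own position, so sharing the deepest node of S in
  coordinate j means sharing \<open>level S j - 1\<close> digits, one less than the level.\<close>

lemma cells_eq_if_nodes_eq:
  assumes S: "finite S" and i: "i < b ^ m" "i' < b ^ m"
    and nodes: "\<forall>q\<in>S. node i' q = node i q" and K: "\<And>j. K j \<le> level S j - 1"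
  shows "cells b K (a i') = cells b K (a i)"
proof
  fix j
  have cube: "0 \<le> a i $ j" "a i $ j < 1" "0 \<le> a i' $ j" "a i' $ j < 1"
    using a_cube[OF i(1)] a_cube[OF i(2)] by (auto simp: unit_cube_def)
  have "cell b (level S j - 1) (a i' $ j) = cell b (level S j - 1) (a i $ j)"
  proof (cases "level S j = 0")
    case True
    then show ?thesis using cube by (simp add: cell_0)
  next
    case False
    then have "(j, level S j - 1) \<in> S" using level_mem[OF S] by simp
    with nodes have "node i' (j, level S j - 1) = node i (j, level S j - 1)" by blast
    then show ?thesis
      unfolding node_def using prefix_eq_iff[OF b_pos cube(3,4,1,2)] by simp
  qed
  then show "cells b K (a i') j = cells b K (a i) j"
    unfolding cells_def by (rule cell_eq_mono[OF b_pos cube(3,4,1,2) _ K])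
qed

lemma card_nodes_eq_le:
  assumes S: "finite S" and i: "i < b ^ m" and large: "m < (\<Sum>j\<in>UNIV. level S j) + t"
  shows "card {i'. i' < b ^ m \<and> (\<forall>q\<in>S. node i' q = node i q)} \<le> b ^ (t + CARD('d))"
proof -
  \<comment> \<open>Agreement on all nodes fixes \<open>level - 1\<close> digits per coordinate, in
    total at most CARD('d) fewer than the levels. The cap m - t keeps the cell large enough for the
    net to count it; in either case m - n <= t + CARD('d).\<close>
  define n where "n = min (\<Sum>j\<in>UNIV. level S j - 1) (m - t)"
  have "n \<le> (\<Sum>j\<in>UNIV. level S j - 1)" by (simp add: n_def)
  from exists_le_with_sum[OF this]
  obtain K where K: "\<And>j. K j \<le> level S j - 1" "(\<Sum>j\<in>UNIV. K j) = n" by auto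
  have nm: "n + t \<le> m" using t_le_m by (simp add: n_def)
  have "(\<Sum>j\<in>UNIV. level S j) \<le> (\<Sum>j\<in>(UNIV :: 'd set). (level S j - 1) + 1)"
    by (intro sum_mono) simp
  also have "\<dots> = (\<Sum>j\<in>UNIV. level S j - 1) + CARD('d)"
    by (subst sum.distrib) simp
  finally have "(\<Sum>j\<in>UNIV. level S j) \<le> (\<Sum>j\<in>UNIV. level S j - 1) + CARD('d)" .
  then have mn: "m - n \<le> t + CARD('d)"
    using large t_le_m by (auto simp: n_def min_def)
  have "{i'. i' < b ^ m \<and> (\<forall>q\<in>S. node i' q = node i q)} \<subseteq> {i'. i' < b ^ m \<and> cells b K (a i') = cells b K (a i)}"
    using cells_eq_if_nodes_eq[OF S i _ _ K(1)] by auto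
  then have "card {i'. i' < b ^ m \<and> (\<forall>q\<in>S. node i' q = node i q)}
      \<le> card {i'. i' < b ^ m \<and> cells b K (a i') = cells b K (a i)}"
    by (intro card_mono) auto
  also have "\<dots> = b ^ (m - n)"
    using net_card_cell[OF b_pos net, of K "cells b K (a i)"] K(2) nm
      cells_in_cell_indices[OF b_pos a_cube[OF i]] by simp
  also have "\<dots> \<le> b ^ (t + CARD('d))"
    using mn b_pos by (intro power_increasing) auto
  finally show ?thesis .
qed

lemma expectation_sdigit_eq:
  assumes "i < b ^ m" "finite S" "depends_on G S"
  shows "expectation (\<lambda>\<omega>. G (sdigit i \<omega>)) = (LINT x|uniform_cube. G (point_digit b x))"
proof -
  have step: "step_fun b (level S) (\<lambda>x. G (point_digit b x))"
    by (intro step_fun_point_digit[OF b_pos assms(3)] subset_digit_positions_level assms)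
  note meas = step_fun_measurable[OF b_pos step]
  have "expectation (\<lambda>\<omega>. G (sdigit i \<omega>)) = expectation (\<lambda>\<omega>. G (point_digit b (u i \<omega>)))"
  proof (rule integral_cong_AE)
    show "AE \<omega> in M. G (sdigit i \<omega>) = G (point_digit b (u i \<omega>))"
      using AE_regular
    proof eventually_elim
      case (elim \<omega>)
      then show ?case using point_digit_u[OF assms(1) elim] by (metis ext)
    qed
  qed (use depends_on_sdigit_measurable[OF assms(2,3)] f_u_measurable[OF assms(1) meas] in auto)
  also have "\<dots> = (LINT x|uniform_cube. G (point_digit b x))"
    by (rule expectation_u[OF assms(1) meas])
  finally show ?thesis .
qed

text \<open>At this depth the component is a step function that the scrambled points, again a net,
  integrate exactly, and its integral vanishes because one digit is centered.\<close>

lemma sum_sdigit_centered_eq_0: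
  assumes S: "finite S" "depends_on G S" and q: "q \<in> S" "centered b q G"
    and small: "(\<Sum>j\<in>UNIV. level S j) + t \<le> m" and \<omega>: "regular \<omega>"
  shows "(\<Sum>i<b ^ m. G (sdigit i \<omega>)) = 0"
proof -
  have step: "step_fun b (level S) (\<lambda>x. G (point_digit b x))"
    by (intro step_fun_point_digit[OF b_pos S(2)] subset_digit_positions_level S)
  have 0: "0 < b ^ m" using b_pos by simp
  have "(\<Sum>i<b ^ m. G (sdigit i \<omega>)) = (\<Sum>i<b ^ m. G (point_digit b (u i \<omega>)))"
    using point_digit_u[OF _ \<omega>] by (intro sum.cong refl arg_cong[where f = G] ext) simp
  also have "\<dots> = real (b ^ m) * (LINT x|uniform_cube. G (point_digit b x))"
    by (rule net_step_fun_exact[OF b_pos tmd_net_u[OF \<omega>] small step])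
  also have "(LINT x|uniform_cube. G (point_digit b x)) = expectation (\<lambda>\<omega>. G (sdigit 0 \<omega>) * 1)"
    using expectation_sdigit_eq[OF 0 S] by simp
  also have "\<dots> = 0"
    using expectation_centered_eq_0[OF S q(2), of "{}" "\<lambda>_. 1" 0 0] by (simp add: depends_on_def)
  finally show ?thesis by simp
qed

text \<open>Different Hoeffding components are uncorrelated. A component with few digits is integrated
  exactly; for one with many digits, a point is correlated with at most \<open>b ^ (t + d)\<close> others.\<close>

lemma variance_digit_function_le:
  assumes D: "finite D" "depends_on G D"
  shows "\<exists>h. expectation (\<lambda>\<omega>. (\<Sum>i<b ^ m. G (sdigit i \<omega>) - h)\<^sup>2)
      \<le> real (b ^ (t + CARD('d))) * (\<Sum>i<b ^ m. expectation (\<lambda>\<omega>. (G (sdigit i \<omega>))\<^sup>2))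
    \<and> (\<forall>i. expectation (\<lambda>\<omega>. G (sdigit i \<omega>)) = h)"
proof -
  obtain H where "hoeffding_family b D G H"
    using hoeffding_decomposition[OF D(1) b_pos] by blast
  note H = hoeffding_familyD[OF this]
  have fin: "finite S" if "S \<subseteq> D" for S using that D(1) finite_subset by blast
  have dep: "depends_on (H S) S" if "S \<subseteq> D" for S
  proof -
    have "D - (D - S) = S" using that by blast
    then show ?thesis using H(2)[OF that D(2)] by simp
  qed
  define h where "h = H {} (\<lambda>_. 0)"
  have h: "H {} x = h" for x
    unfolding h_def using depends_onD[OF dep[of "{}"]] by simp
  define E where "E S S' i i' = expectation (\<lambda>\<omega>. H S (sdigit i \<omega>) * H S' (sdigit i' \<omega>))" for S S' i i'
  have int: "integrable M (\<lambda>\<omega>. H S (sdigit i \<omega>) * H S' (sdigit i' \<omega>))"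
    if "S \<subseteq> D" "S' \<subseteq> D" for S S' i i'
    by (rule depends_on_sdigit_integrable[OF fin[OF that(1)] dep[OF that(1)] fin[OF that(2)] dep[OF that(2)]])
  \<comment> \<open>The factor centered at q has mean 0 unless the other factor uses the same
    permutation, that is, unless q is in S' and both points share its node.\<close>
  have E_sub: "E S S' i i' = 0" if S: "S \<subseteq> D" "S' \<subseteq> D" and q: "q \<in> S" and ne: "q \<in> S' \<Longrightarrow> node i' q \<noteq> node i q" for S S' i i' q
    unfolding E_def
  proof (rule expectation_centered_eq_0[OF fin[OF S(1)] dep[OF S(1)] H(3)[OF S(1) q] fin[OF S(2)] dep[OF S(2)]])
    fix q' assume "q' \<in> S'"
    then show "node i' q' \<noteq> node i q" using ne node_eqD by metis
  qed
  have E_comm: "E S S' i i' = E S' S i' i" for S S' i i'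
    by (simp add: E_def mult.commute)
  have E_ne: "E S S' i i' = 0" if "S \<subseteq> D" "S' \<subseteq> D" "S \<noteq> S'" for S S' i i'
  proof -
    from \<open>S \<noteq> S'\<close> consider q where "q \<in> S" "q \<notin> S'" | q where "q \<in> S'" "q \<notin> S" by blast
    then show ?thesis
    proof cases
      case 1
      then show ?thesis using E_sub[OF that(1,2)] by blast
    next
      case 2
      then show ?thesis using E_sub[OF that(2,1)] unfolding E_comm[of S] by blast
    qed
  qed
  have E_mean: "expectation (\<lambda>\<omega>. G (sdigit i \<omega>)) = h" for i
  proof -
    have "expectation (\<lambda>\<omega>. G (sdigit i \<omega>)) = expectation (\<lambda>\<omega>. \<Sum>S\<in>Pow D. H S (sdigit i \<omega>))"
      by (simp add: H(1))
    also have "\<dots> = (\<Sum>S\<in>Pow D. expectation (\<lambda>\<omega>. H S (sdigit i \<omega>)))"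
    proof (rule Bochner_Integration.integral_sum)
      fix S assume "S \<in> Pow D"
      then show "integrable M (\<lambda>\<omega>. H S (sdigit i \<omega>))"
        using depends_on_sdigit_integrable[OF fin dep, of S "{}" "\<lambda>_. 1" i i] by (simp add: depends_on_def)
    qed
    also have "\<dots> = (\<Sum>S\<in>Pow D. if S = {} then h else 0)"
    proof (rule sum.cong[OF refl])
      fix S assume S: "S \<in> Pow D"
      show "expectation (\<lambda>\<omega>. H S (sdigit i \<omega>)) = (if S = {} then h else 0)"
      proof (cases "S = {}")
        case True
        then show ?thesis by (simp add: h prob_space)
      next
        case False
        then obtain q where q: "q \<in> S" by blast
        have "S \<subseteq> D" using S by simp
        from expectation_centered_eq_0[OF fin[OF this] dep[OF this] H(3)[OF this q], of "{}" "\<lambda>_. 1" i i]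
        show ?thesis using False by (simp add: depends_on_def)
      qed
    qed
    also have "\<dots> = h" using D(1) by (simp add: sum.delta)
    finally show ?thesis .
  qed
  \<comment> \<open>Parseval's identity for the orthogonal components.\<close>
  have E_square: "expectation (\<lambda>\<omega>. (G (sdigit i \<omega>))\<^sup>2) = (\<Sum>S\<in>Pow D. E S S i i)" for i
  proof -
    have "expectation (\<lambda>\<omega>. (G (sdigit i \<omega>))\<^sup>2) = expectation (\<lambda>\<omega>. (\<Sum>S\<in>Pow D. H S (sdigit i \<omega>))\<^sup>2)"
      by (simp add: H(1))
    also have "\<dots> = (\<Sum>S\<in>Pow D. \<Sum>S'\<in>Pow D. E S S' i i)"
      unfolding E_def by (intro expectation_square_sum int) auto
    also have "\<dots> = (\<Sum>S\<in>Pow D. \<Sum>S'\<in>Pow D. if S' = S then E S S i i else 0)"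
      using E_ne by (intro sum.cong refl) auto
    also have "\<dots> = (\<Sum>S\<in>Pow D. E S S i i)"
      using D(1) by (simp add: sum.delta)
    finally show ?thesis .
  qed
  have E_nonneg: "0 \<le> E S S i i" for S i
    by (simp add: E_def)
  have E_diag: "(\<Sum>i<b ^ m. \<Sum>i'<b ^ m. E S S i i') \<le> real (b ^ (t + CARD('d))) * (\<Sum>i<b ^ m. E S S i i)"
    if S: "S \<subseteq> D" and large: "m < (\<Sum>j\<in>UNIV. level S j) + t" for S
  proof -
    \<comment> \<open>Correlations live on the symmetric relation of sharing all nodes of S. There 2
      x y <= x^2 + y^2 reduces them to diagonal terms, and each row of c has at most b^(t + d) ones
      by \<open>card_nodes_eq_le\<close>.\<close>
    define c where "c i i' = (of_bool (\<forall>q\<in>S. node i' q = node i q) :: real)" for i i'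
    have "E S S i i' \<le> c i i' * ((E S S i i + E S S i' i') / 2)" for i i'
    proof (cases "\<forall>q\<in>S. node i' q = node i q")
      case False
      then show ?thesis using E_sub[OF S S] by (auto simp: c_def)
    next
      case True
      have "x * y \<le> (x * x + y * y) / 2" for x y :: real
        using zero_le_power2[of "x - y"] by (simp add: power2_eq_square algebra_simps)
      then have "E S S i i' \<le> expectation (\<lambda>\<omega>. (H S (sdigit i \<omega>) * H S (sdigit i \<omega>)
          + H S (sdigit i' \<omega>) * H S (sdigit i' \<omega>)) / 2)"
        unfolding E_def using int[OF S S] by (intro integral_mono) auto
      also have "\<dots> = (E S S i i + E S S i' i') / 2"
        unfolding E_def using int[OF S S] by simp
      finally show ?thesis using True by (simp add: c_def)
    qed
    then have "(\<Sum>i<b ^ m. \<Sum>i'<b ^ m. E S S i i')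
        \<le> (\<Sum>i<b ^ m. \<Sum>i'<b ^ m. c i i' * ((E S S i i + E S S i' i') / 2))"
      by (intro sum_mono)
    also have "\<dots> = ((\<Sum>i<b ^ m. \<Sum>i'<b ^ m. c i i' * E S S i i) + (\<Sum>i<b ^ m. \<Sum>i'<b ^ m. c i i' * E S S i' i')) / 2"
      by (simp add: algebra_simps add_divide_distrib sum.distrib sum_divide_distrib)
    also have "(\<Sum>i<b ^ m. \<Sum>i'<b ^ m. c i i' * E S S i' i') = (\<Sum>i<b ^ m. \<Sum>i'<b ^ m. c i i' * E S S i i)"
    proof -
      have "c i i' = c i' i" for i i' unfolding c_def by (simp add: eq_commute)
      then show ?thesis by (subst sum.swap) simp
    qed
    also have "((\<Sum>i<b ^ m. \<Sum>i'<b ^ m. c i i' * E S S i i) + (\<Sum>i<b ^ m. \<Sum>i'<b ^ m. c i i' * E S S i i)) / 2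
        = (\<Sum>i<b ^ m. (\<Sum>i'<b ^ m. c i i') * E S S i i)"
      by (simp add: sum_distrib_right)
    also have "\<dots> \<le> (\<Sum>i<b ^ m. real (b ^ (t + CARD('d))) * E S S i i)"
    proof (intro sum_mono mult_right_mono E_nonneg)
      fix i assume "i \<in> {..<b ^ m}"
      then have i: "i < b ^ m" by simp
      have "(\<Sum>i'<b ^ m. c i i') = real (card {i'. i' < b ^ m \<and> (\<forall>q\<in>S. node i' q = node i q)})"
        unfolding c_def by (simp add: sum_of_bool_eq Int_def)
      also have "\<dots> \<le> real (b ^ (t + CARD('d)))"
        using card_nodes_eq_le[OF fin[OF S] i large] by (rule of_nat_mono)
      finally show "(\<Sum>i'<b ^ m. c i i') \<le> real (b ^ (t + CARD('d)))" .
    qed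
    finally show ?thesis by (simp add: sum_distrib_left)
  qed
  \<comment> \<open>The components too deep for the net; the sums of all other nonempty ones vanish
    almost surely, and the empty one is the mean h.\<close>
  define L where "L = {S. S \<subseteq> D \<and> m < (\<Sum>j\<in>UNIV. level S j) + t}"
  have L: "finite L" "L \<subseteq> Pow D" "\<And>S. S \<in> L \<Longrightarrow> S \<subseteq> D"
    using D(1) by (auto simp: L_def)
  define Z where "Z = (\<lambda>(S, i) \<omega>. H S (sdigit i \<omega>))"
  have Z_sum: "(\<Sum>i<b ^ m. G (sdigit i \<omega>) - h) = (\<Sum>p\<in>L \<times> {..<b ^ m}. Z p \<omega>)" if \<omega>: "regular \<omega>" for \<omega>
  proof -
    have "G x - h = (\<Sum>S\<in>Pow D - {{}}. H S x)" for x
      unfolding H(1) using sum.remove[of "Pow D" "{}" "\<lambda>S. H S x"] D(1) by (simp add: h)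
    then have "(\<Sum>i<b ^ m. G (sdigit i \<omega>) - h) = (\<Sum>i<b ^ m. \<Sum>S\<in>Pow D - {{}}. H S (sdigit i \<omega>))"
      by simp
    also have "\<dots> = (\<Sum>S\<in>Pow D - {{}}. \<Sum>i<b ^ m. H S (sdigit i \<omega>))"
      by (rule sum.swap)
    also have "\<dots> = (\<Sum>S\<in>L. \<Sum>i<b ^ m. H S (sdigit i \<omega>))"
    proof (rule sum.mono_neutral_right)
      have "level {} j = 0" for j :: 'd by (simp add: level_def)
      then show "L \<subseteq> Pow D - {{}}" using t_le_m by (auto simp: L_def)
      show "\<forall>S\<in>Pow D - {{}} - L. (\<Sum>i<b ^ m. H S (sdigit i \<omega>)) = 0"
      proof
        fix S assume S: "S \<in> Pow D - {{}} - L"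
        then obtain q where "q \<in> S" by blast
        then show "(\<Sum>i<b ^ m. H S (sdigit i \<omega>)) = 0"
          using S by (intro sum_sdigit_centered_eq_0[OF fin dep _ H(3) _ \<omega>]) (auto simp: L_def)
      qed
    qed (use D(1) in simp)
    also have "\<dots> = (\<Sum>p\<in>L \<times> {..<b ^ m}. Z p \<omega>)"
      by (simp add: sum.cartesian_product Z_def case_prod_unfold)
    finally show ?thesis .
  qed
  have "expectation (\<lambda>\<omega>. (\<Sum>i<b ^ m. G (sdigit i \<omega>) - h)\<^sup>2) = expectation (\<lambda>\<omega>. (\<Sum>p\<in>L \<times> {..<b ^ m}. Z p \<omega>)\<^sup>2)"
  proof (rule integral_cong_AE)
    show "AE \<omega> in M. (\<Sum>i<b ^ m. G (sdigit i \<omega>) - h)\<^sup>2 = (\<Sum>p\<in>L \<times> {..<b ^ m}. Z p \<omega>)\<^sup>2"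
      using AE_regular by eventually_elim (simp add: Z_sum)
    show "(\<lambda>\<omega>. (\<Sum>i<b ^ m. G (sdigit i \<omega>) - h)\<^sup>2) \<in> borel_measurable M"
      using depends_on_sdigit_measurable[OF D]
      by (intro borel_measurable_power borel_measurable_sum borel_measurable_diff) auto
    show "(\<lambda>\<omega>. (\<Sum>p\<in>L \<times> {..<b ^ m}. Z p \<omega>)\<^sup>2) \<in> borel_measurable M"
      using depends_on_sdigit_measurable[OF fin dep] L(3)
      by (intro borel_measurable_power borel_measurable_sum) (auto simp: Z_def)
  qed
  also have "\<dots> = (\<Sum>p\<in>L \<times> {..<b ^ m}. \<Sum>q\<in>L \<times> {..<b ^ m}. expectation (\<lambda>\<omega>. Z p \<omega> * Z q \<omega>))"
    using L(3) by (intro expectation_square_sum) (auto simp: Z_def intro!: int)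
  also have "\<dots> = (\<Sum>S\<in>L. \<Sum>i<b ^ m. \<Sum>S'\<in>L. \<Sum>i'<b ^ m. E S S' i i')"
    by (simp add: sum.cartesian_product' Z_def E_def)
  also have "\<dots> = (\<Sum>S\<in>L. \<Sum>i<b ^ m. \<Sum>S'\<in>L. if S' = S then \<Sum>i'<b ^ m. E S S i i' else 0)"
    using E_ne L(3) by (intro sum.cong refl) auto
  also have "\<dots> = (\<Sum>S\<in>L. \<Sum>i<b ^ m. \<Sum>i'<b ^ m. E S S i i')"
    using L(1) by (simp add: sum.delta)
  also have "\<dots> \<le> (\<Sum>S\<in>L. real (b ^ (t + CARD('d))) * (\<Sum>i<b ^ m. E S S i i))"
    by (intro sum_mono E_diag) (auto simp: L_def)
  \<comment> \<open>The diagonal terms are nonnegative, so all components may be put back; by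
    \<open>E_square\<close> they add up to the second moment of G.\<close>
  also have "\<dots> \<le> (\<Sum>S\<in>Pow D. real (b ^ (t + CARD('d))) * (\<Sum>i<b ^ m. E S S i i))"
    using D(1) L(2) E_nonneg by (intro sum_mono2) (auto intro!: mult_nonneg_nonneg sum_nonneg)
  also have "\<dots> = real (b ^ (t + CARD('d))) * (\<Sum>S\<in>Pow D. \<Sum>i<b ^ m. E S S i i)"
    by (simp add: sum_distrib_left)
  also have "(\<Sum>S\<in>Pow D. \<Sum>i<b ^ m. E S S i i) = (\<Sum>i<b ^ m. expectation (\<lambda>\<omega>. (G (sdigit i \<omega>))\<^sup>2))"
    unfolding E_square by (rule sum.swap)
  finally show ?thesis using E_mean by blast
qed

section \<open>Mean square integration error for square integrable functions\<close>

definition net_error :: "(real ^ 'd \<Rightarrow> real) \<Rightarrow> 'w \<Rightarrow> real" where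
  "net_error f \<omega> = (\<Sum>i<b ^ m. f (u i \<omega>) - (LINT x|uniform_cube. f x))"

lemma L2_net_error:
  assumes "L2 uniform_cube f"
  shows "L2 M (net_error f)"
proof -
  have *: "L2 M (\<lambda>\<omega>. f (u i \<omega>) - c)" if "i < b ^ m" for i c
  proof (rule L2_diff)
    have "f \<in> borel_measurable uniform_cube" "(\<lambda>x. (f x)\<^sup>2) \<in> borel_measurable uniform_cube"
      using assms by (auto simp: L2_def)
    then show "L2 M (\<lambda>\<omega>. f (u i \<omega>))"
      using assms f_u_measurable[OF that] integrable_u_iff[OF that, of "\<lambda>x. (f x)\<^sup>2"] by (simp add: L2_def)
  qed (simp add: L2_def)
  have "L2 M (\<lambda>\<omega>. \<Sum>i\<in>I. f (u i \<omega>) - c)" if "I \<subseteq> {..<b ^ m}" for I c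
    using finite_subset[OF that finite_lessThan] that
  proof (induction I rule: finite_induct)
    case empty
    show ?case by (simp add: L2_def)
  next
    case (insert i I)
    then have "L2 M (\<lambda>\<omega>. (f (u i \<omega>) - c) + (\<Sum>i\<in>I. f (u i \<omega>) - c))"
      by (intro L2_add *) auto
    with insert.hyps show ?case by simp
  qed
  from this[OF subset_refl] show ?thesis by (simp add: net_error_def[abs_def])
qed

lemma net_error_step_fun:
  assumes f: "step_fun b (\<lambda>_. k) f"
  shows "expectation (\<lambda>\<omega>. (net_error f \<omega>)\<^sup>2)
    \<le> real (b ^ (t + CARD('d))) * real (b ^ m) * (LINT x|uniform_cube. (f x)\<^sup>2)"
proof -
  let ?D = "digit_positions (\<lambda>_ :: 'd. k)"
  obtain G where G: "depends_on G ?D" and fG: "\<And>x. x \<in> unit_cube \<Longrightarrow> f x = G (point_digit b x)"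
    using step_fun_eq_point_digit[OF b_pos f] by blast
  note D = finite_digit_positions[of "\<lambda>_ :: 'd. k"] G
  from variance_digit_function_le[OF D] obtain h where
    h: "expectation (\<lambda>\<omega>. (\<Sum>i<b ^ m. G (sdigit i \<omega>) - h)\<^sup>2)
      \<le> real (b ^ (t + CARD('d))) * (\<Sum>i<b ^ m. expectation (\<lambda>\<omega>. (G (sdigit i \<omega>))\<^sup>2))"
    "\<And>i. expectation (\<lambda>\<omega>. G (sdigit i \<omega>)) = h"
    by blast
  have 0: "0 < b ^ m" using b_pos by simp
  have "(LINT x|uniform_cube. G (point_digit b x)) = (LINT x|uniform_cube. f x)"
    using fG by (intro Bochner_Integration.integral_cong) auto
  then have mean: "(LINT x|uniform_cube. f x) = h"
    using expectation_sdigit_eq[OF 0 D] h(2) by simp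
  have sq: "expectation (\<lambda>\<omega>. (G (sdigit i \<omega>))\<^sup>2) = (LINT x|uniform_cube. (f x)\<^sup>2)" if "i < b ^ m" for i
  proof -
    have "depends_on (\<lambda>x. (G x)\<^sup>2) ?D" using G unfolding depends_on_def by metis
    from expectation_sdigit_eq[OF that D(1) this]
    have "expectation (\<lambda>\<omega>. (G (sdigit i \<omega>))\<^sup>2) = (LINT x|uniform_cube. (G (point_digit b x))\<^sup>2)" .
    also have "\<dots> = (LINT x|uniform_cube. (f x)\<^sup>2)"
      using fG by (intro Bochner_Integration.integral_cong) auto
    finally show ?thesis .
  qed
  have "expectation (\<lambda>\<omega>. (net_error f \<omega>)\<^sup>2) = expectation (\<lambda>\<omega>. (\<Sum>i<b ^ m. G (sdigit i \<omega>) - h)\<^sup>2)"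
  proof (rule integral_cong_AE)
    show "AE \<omega> in M. (net_error f \<omega>)\<^sup>2 = (\<Sum>i<b ^ m. G (sdigit i \<omega>) - h)\<^sup>2"
      using AE_regular
    proof eventually_elim
      case (elim \<omega>)
      have "f (u i \<omega>) = G (sdigit i \<omega>)" if "i < b ^ m" for i
      proof -
        have "point_digit b (u i \<omega>) = sdigit i \<omega>" by (rule ext) (rule point_digit_u[OF that elim])
        then show ?thesis using fG u_cube[OF that] elim by (simp add: regular_def)
      qed
      then show ?case by (simp add: net_error_def mean)
    qed
    show "(\<lambda>\<omega>. (net_error f \<omega>)\<^sup>2) \<in> borel_measurable M"
      by (intro L2_measurable_square L2_net_error step_fun_L2[OF b_pos f])
    show "(\<lambda>\<omega>. (\<Sum>i<b ^ m. G (sdigit i \<omega>) - h)\<^sup>2) \<in> borel_measurable M"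
      using depends_on_sdigit_measurable[OF D]
      by (intro borel_measurable_power borel_measurable_sum borel_measurable_diff) auto
  qed
  also have "\<dots> \<le> real (b ^ (t + CARD('d))) * (\<Sum>i<b ^ m. LINT x|uniform_cube. (f x)\<^sup>2)"
    using h(1) sq by simp
  finally show ?thesis by (simp add: mult.assoc)
qed

text \<open>Only the Cauchy--Schwarz inequality over the points and their uniformity are used, at
  the price of N^2 instead of N. It serves for remainders of arbitrarily small norm, where that
  power is harmless.\<close>

lemma net_error_crude:
  assumes f: "L2 uniform_cube f"
  shows "expectation (\<lambda>\<omega>. (net_error f \<omega>)\<^sup>2) \<le> (real (b ^ m))\<^sup>2 * (4 * (LINT x|uniform_cube. (f x)\<^sup>2))"
proof -
  define c where "c = (LINT x|uniform_cube. f x)"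
  have L: "L2 uniform_cube (\<lambda>x. f x - c)"
    by (rule L2_diff[OF f]) (simp add: L2_def)
  then have meas: "(\<lambda>x. (f x - c)\<^sup>2) \<in> borel_measurable uniform_cube"
    by (rule L2_measurable_square)
  have int: "integrable M (\<lambda>\<omega>. (f (u i \<omega>) - c)\<^sup>2)" if "i < b ^ m" for i
    using L integrable_u_iff[OF that meas] by (simp add: L2_def)
  have "(LINT x|uniform_cube. (f x - c)\<^sup>2) = (LINT x|uniform_cube. (f x + - c)\<^sup>2)" by simp
  also have "\<dots> \<le> 2 * (LINT x|uniform_cube. (f x)\<^sup>2) + 2 * (LINT x|(uniform_cube :: (real ^ 'd) measure). (- c)\<^sup>2)"
    by (rule L2_integral_add_le[OF f]) (simp add: L2_def)
  also have "\<dots> \<le> 4 * (LINT x|uniform_cube. (f x)\<^sup>2)"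
    using U.square_expectation_le[OF f] by (simp add: c_def)
  finally have var: "(LINT x|uniform_cube. (f x - c)\<^sup>2) \<le> 4 * (LINT x|uniform_cube. (f x)\<^sup>2)" .
  have "expectation (\<lambda>\<omega>. (net_error f \<omega>)\<^sup>2) \<le> expectation (\<lambda>\<omega>. (\<Sum>i<b ^ m. (f (u i \<omega>) - c)\<^sup>2) * real (b ^ m))"
  proof (rule integral_mono)
    show "integrable M (\<lambda>\<omega>. (net_error f \<omega>)\<^sup>2)"
      using L2_net_error[OF f] by (simp add: L2_def)
    show "integrable M (\<lambda>\<omega>. (\<Sum>i<b ^ m. (f (u i \<omega>) - c)\<^sup>2) * real (b ^ m))"
      using int by auto
    show "(net_error f \<omega>)\<^sup>2 \<le> (\<Sum>i<b ^ m. (f (u i \<omega>) - c)\<^sup>2) * real (b ^ m)" for \<omega>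
      using sum_squared_le_sum_of_squares[of "\<lambda>i. f (u i \<omega>) - c" "{..<b ^ m}"]
      by (simp add: net_error_def c_def)
  qed
  also have "\<dots> = (\<Sum>i<b ^ m. expectation (\<lambda>\<omega>. (f (u i \<omega>) - c)\<^sup>2)) * real (b ^ m)"
    using int by (simp add: Bochner_Integration.integral_sum)
  also have "\<dots> = (real (b ^ m))\<^sup>2 * (LINT x|uniform_cube. (f x - c)\<^sup>2)"
    using expectation_u[OF _ meas] by (simp add: power2_eq_square)
  also have "\<dots> \<le> (real (b ^ m))\<^sup>2 * (4 * (LINT x|uniform_cube. (f x)\<^sup>2))"
    by (intro mult_left_mono var) simp
  finally show ?thesis .
qed

lemma net_error_add:
  assumes "L2 uniform_cube f" "L2 uniform_cube g"
  shows "net_error (\<lambda>x. f x + g x) \<omega> = net_error f \<omega> + net_error g \<omega>"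
  using U.L2_integrable[OF assms(1)] U.L2_integrable[OF assms(2)]
  by (simp add: net_error_def sum.distrib algebra_simps sum_subtractf)

theorem net_error_L2:
  assumes f: "L2 uniform_cube f"
  shows "expectation (\<lambda>\<omega>. (net_error f \<omega>)\<^sup>2)
    \<le> 4 * real (b ^ (t + CARD('d))) * real (b ^ m) * (LINT x|uniform_cube. (f x)\<^sup>2)"
proof (rule field_le_epsilon)
  let ?C = "real (b ^ (t + CARD('d)))" and ?N = "real (b ^ m)"
  let ?I = "\<lambda>f :: real ^ 'd \<Rightarrow> real. LINT x|uniform_cube. (f x)\<^sup>2"
  fix e :: real assume e: "0 < e"
  \<comment> \<open>With f = s + r, the step part costs 2 C N I(s) with I(s) <= 2 I(f) + 2 I(r), the
    remainder 2 N^2 times 4 I(r). Collecting I(r) gives K; the product of the two factors 2 is the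
    constant 4 in front of I(f).\<close>
  define K where "K = 4 * ?C * ?N + 8 * ?N\<^sup>2"
  have K: "0 < K" using b_pos by (simp add: K_def add_pos_pos)
  obtain k s where s: "step_fun b (\<lambda>_. k) s" "?I (\<lambda>x. f x - s x) \<le> e / K"
    using L2_approximable[OF b f] e K unfolding approximable_def by (meson divide_pos_pos)
  define r where "r x = f x - s x" for x
  have sL: "L2 uniform_cube s" by (rule step_fun_L2[OF b_pos s(1)])
  have rL: "L2 uniform_cube r" unfolding r_def by (rule L2_diff[OF f sL])
  have r: "?I r \<le> e / K" using s(2) by (simp add: r_def)
  have "?I s = ?I (\<lambda>x. f x + - 1 * r x)" by (simp add: r_def)
  also have "\<dots> \<le> 2 * ?I f + 2 * ?I (\<lambda>x. - 1 * r x)"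
    by (intro L2_integral_add_le f L2_scale rL)
  also have "\<dots> = 2 * ?I f + 2 * ?I r" by simp
  finally have Is: "?I s \<le> 2 * ?I f + 2 * ?I r" .
  have "expectation (\<lambda>\<omega>. (net_error f \<omega>)\<^sup>2) = expectation (\<lambda>\<omega>. (net_error s \<omega> + net_error r \<omega>)\<^sup>2)"
    using net_error_add[OF sL rL] by (simp add: r_def)
  also have "\<dots> \<le> 2 * expectation (\<lambda>\<omega>. (net_error s \<omega>)\<^sup>2) + 2 * expectation (\<lambda>\<omega>. (net_error r \<omega>)\<^sup>2)"
    by (intro L2_integral_add_le L2_net_error sL rL)
  also have "\<dots> \<le> 2 * (?C * ?N * ?I s) + 2 * (?N\<^sup>2 * (4 * ?I r))"
    by (intro add_mono mult_left_mono net_error_step_fun[OF s(1)] net_error_crude rL) simp_all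
  also have "\<dots> \<le> 2 * (?C * ?N * (2 * ?I f + 2 * ?I r)) + 2 * (?N\<^sup>2 * (4 * ?I r))"
    by (intro add_mono mult_left_mono Is order_refl) simp_all
  also have "\<dots> = 4 * ?C * ?N * ?I f + K * ?I r"
    by (simp add: K_def algebra_simps)
  also have "\<dots> \<le> 4 * ?C * ?N * ?I f + e"
    using r K by (simp add: field_simps)
  finally show "expectation (\<lambda>\<omega>. (net_error f \<omega>)\<^sup>2) \<le> 4 * ?C * ?N * ?I f + e" .
qed

text \<open>The step function is integrated exactly by almost every scrambled net, so subtracting it
  leaves the error unchanged but reduces the norm in the bound.\<close>

lemma net_error_L2_minus_step_fun:
  assumes f: "L2 uniform_cube f" and s: "step_fun b (\<lambda>_. k) s" and k: "k * CARD('d) + t \<le> m"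
  shows "expectation (\<lambda>\<omega>. (net_error f \<omega>)\<^sup>2)
    \<le> 4 * real (b ^ (t + CARD('d))) * real (b ^ m) * (LINT x|uniform_cube. (f x - s x)\<^sup>2)"
proof -
  have sL: "L2 uniform_cube s" by (rule step_fun_L2[OF b_pos s])
  have rL: "L2 uniform_cube (\<lambda>x. f x - s x)" by (rule L2_diff[OF f sL])
  have s0: "net_error s \<omega> = 0" if "regular \<omega>" for \<omega>
    using net_step_fun_exact[OF b_pos tmd_net_u[OF that] _ s] k
    by (simp add: net_error_def sum_subtractf mult.commute)
  have "expectation (\<lambda>\<omega>. (net_error f \<omega>)\<^sup>2) = expectation (\<lambda>\<omega>. (net_error (\<lambda>x. f x - s x) \<omega>)\<^sup>2)"
  proof (rule integral_cong_AE)
    show "AE \<omega> in M. (net_error f \<omega>)\<^sup>2 = (net_error (\<lambda>x. f x - s x) \<omega>)\<^sup>2"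
      using AE_regular
    proof eventually_elim
      case (elim \<omega>)
      show ?case using net_error_add[OF sL rL, of \<omega>] s0[OF elim] by simp
    qed
  qed (intro L2_measurable_square L2_net_error f rL)+
  also have "\<dots> \<le> 4 * real (b ^ (t + CARD('d))) * real (b ^ m) * (LINT x|uniform_cube. (f x - s x)\<^sup>2)"
    by (rule net_error_L2[OF rL])
  finally show ?thesis .
qed

end


subsection \<open>Functions of bounded Hardy--Krause variation\<close>

definition upd :: "real ^ 'd::finite \<Rightarrow> 'd \<Rightarrow> real \<Rightarrow> real ^ 'd" where
  "upd x j s = (\<chi> i. if i = j then s else x $ i)"

lemma alternating_sum_cong:
  assumes "\<And>i. i \<in> w \<Longrightarrow> lo i = lo' i" "\<And>i. i \<in> w \<Longrightarrow> hi i = hi' i"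
  shows "alternating_sum f w lo hi = alternating_sum f w lo' hi'"
  unfolding alternating_sum_def
  using assms by (intro sum.cong refl arg_cong2[where f = "(*)"] arg_cong[where f = f]) (auto simp: vec_eq_iff)

text \<open>Moebius inversion expresses an increment along one coordinate through Vitali increments.\<close>

lemma abs_line_increment_le:
  fixes f :: "real ^ 'd::finite \<Rightarrow> real"
  shows "\<bar>f (upd x j r') - f (upd x j r)\<bar> \<le> (\<Sum>T\<in>Pow (UNIV - {j}).
    \<bar>alternating_sum f (insert j T) (\<lambda>i. if i = j then r else x $ i) (\<lambda>i. if i = j then r' else 1)\<bar>)"
proof -
  let ?lo = "\<lambda>i. if i = j then r else x $ i" and ?hi = "\<lambda>i. if i = j then r' else 1"
  \<comment> \<open>Coordinates outside T and different from j are set to 1, where the Hardy--Krause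
    variation is anchored; \<open>g'\<close> is then the alternating transform of \<open>g\<close>,
    which is its own inverse.\<close>
  define pt where "pt T s = (\<chi> i. if i = j then s else if i \<in> T then x $ i else 1)" for T and s :: real
  define g where "g T = f (pt T r') - f (pt T r)" for T
  define g' where "g' T = (\<Sum>S\<in>Pow T. (-1) ^ card S * g S)" for T
  have alt: "alternating_sum f (insert j T) ?lo ?hi = g' T" if T: "j \<notin> T" for T
  proof -
    let ?F = "\<lambda>S. (-1) ^ card S * f (\<chi> i. if i \<notin> insert j T then 1 else if i \<in> S then ?lo i else ?hi i)"
    have "alternating_sum f (insert j T) ?lo ?hi = sum ?F (Pow T) + sum ?F (insert j ` Pow T)"
      unfolding alternating_sum_def Pow_insert using T by (intro sum.union_disjoint) auto
    also have "sum ?F (insert j ` Pow T) = (\<Sum>S\<in>Pow T. ?F (insert j S))"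
      using T by (subst sum.reindex) (auto simp: inj_on_def)
    also have "sum ?F (Pow T) + (\<Sum>S\<in>Pow T. ?F (insert j S)) = (\<Sum>S\<in>Pow T. ?F S + ?F (insert j S))"
      by (rule sum.distrib[symmetric])
    also have "\<dots> = g' T"
      unfolding g'_def
    proof (rule sum.cong[OF refl])
      fix S assume S: "S \<in> Pow T"
      then have jS: "j \<notin> S" using T by auto
      have "(\<chi> i. if i \<notin> insert j T then 1 else if i \<in> S then ?lo i else ?hi i) = pt S r'"
        "(\<chi> i. if i \<notin> insert j T then 1 else if i \<in> insert j S then ?lo i else ?hi i) = pt S r"
        using S jS by (auto simp: pt_def vec_eq_iff)
      then show "?F S + ?F (insert j S) = (-1) ^ card S * g S"
        using jS by (simp add: g_def algebra_simps)
    qed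
    finally show ?thesis .
  qed
  have "pt (UNIV - {j}) s = upd x j s" for s by (simp add: pt_def upd_def vec_eq_iff)
  then have "f (upd x j r') - f (upd x j r) = g (UNIV - {j})"
    by (simp add: g_def)
  also have "\<dots> = (\<Sum>T\<in>Pow (UNIV - {j}). (-1) ^ card T * g' T)"
    by (rule inclusion_exclusion_symmetric) (simp_all add: g'_def)
  finally have "\<bar>f (upd x j r') - f (upd x j r)\<bar> \<le> (\<Sum>T\<in>Pow (UNIV - {j}). \<bar>(-1) ^ card T * g' T\<bar>)"
    using sum_abs by metis
  also have "\<dots> = (\<Sum>T\<in>Pow (UNIV - {j}). \<bar>alternating_sum f (insert j T) ?lo ?hi\<bar>)"
    by (intro sum.cong refl) (subst alt, auto simp: abs_mult power_abs)
  finally show ?thesis .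
qed

text \<open>The boxes [s k, s (k + 1)] times the product of the [x_i, 1] belong to one grid,
  obtained by cutting every other axis at x_i.\<close>

lemma sum_alternating_le_vitali:
  fixes f :: "real ^ 'd::finite \<Rightarrow> real"
  assumes x: "\<And>i. i \<noteq> j \<Longrightarrow> 0 \<le> x $ i \<and> x $ i < 1" and j: "j \<in> w"
    and s: "s 0 = 0" "s n = 1" "\<And>k. k < n \<Longrightarrow> s k < s (Suc k)"
  shows "(\<Sum>k<n. ennreal \<bar>alternating_sum f w (\<lambda>i. if i = j then s k else x $ i)
    (\<lambda>i. if i = j then s (Suc k) else 1)\<bar>) \<le> vitali_variation f w"
proof -
  \<comment> \<open>Partition points must increase strictly, so an axis with x_i = 0 is left uncut;
    \<open>\<kappa> k\<close> takes the last interval, [x_i, 1], on every axis but j.\<close>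
  define nn where "nn i = (if i = j then n else if x $ i = 0 then 1 else 2 :: nat)" for i
  define ss where "ss i k = (if i = j then s k else if k = 0 then 0
    else if k = 1 \<and> x $ i \<noteq> 0 then x $ i else 1)" for i and k :: nat
  define \<kappa> where "\<kappa> k = (\<lambda>i\<in>w. if i = j then k else nn i - 1)" for k
  let ?A = "\<lambda>k. ennreal \<bar>alternating_sum f w (\<lambda>i. ss i (k i)) (\<lambda>i. ss i (Suc (k i)))\<bar>"
  have grid: "\<forall>i\<in>w. ss i 0 = 0 \<and> ss i (nn i) = 1 \<and> (\<forall>k<nn i. ss i k < ss i (Suc k))"
  proof
    fix i assume "i \<in> w"
    show "ss i 0 = 0 \<and> ss i (nn i) = 1 \<and> (\<forall>k<nn i. ss i k < ss i (Suc k))"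
    proof (cases "i = j")
      case True
      then show ?thesis using s by (simp add: ss_def nn_def)
    next
      case False
      then have "0 \<le> x $ i" "x $ i < 1" using x by auto
      then show ?thesis using False by (auto simp: ss_def nn_def less_Suc_eq numeral_2_eq_2)
    qed
  qed
  have "(\<Sum>k<n. ennreal \<bar>alternating_sum f w (\<lambda>i. if i = j then s k else x $ i)
      (\<lambda>i. if i = j then s (Suc k) else 1)\<bar>) = (\<Sum>k<n. ?A (\<kappa> k))"
    by (intro sum.cong refl arg_cong[where f = "\<lambda>y. ennreal \<bar>y\<bar>"] alternating_sum_cong)
      (auto simp: \<kappa>_def ss_def nn_def)
  also have "\<dots> = (\<Sum>k\<in>\<kappa> ` {..<n}. ?A k)"
  proof -
    have "inj_on \<kappa> {..<n}"
    proof (rule inj_onI)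
      fix k l assume "\<kappa> k = \<kappa> l"
      from fun_cong[OF this, of j] show "k = l" using j by (simp add: \<kappa>_def)
    qed
    then show ?thesis by (simp add: sum.reindex)
  qed
  also have "\<dots> \<le> (\<Sum>k\<in>(\<Pi>\<^sub>E i\<in>w. {..<nn i}). ?A k)"
    by (intro sum_mono2 finite_PiE) (auto simp: \<kappa>_def nn_def)
  also have "\<dots> \<le> vitali_variation f w"
    unfolding vitali_variation_def using grid by (intro SUP_upper2[of "(nn, ss)"]) auto
  finally show ?thesis .
qed

text \<open>The variation along a line parallel to axis j. Distinct T give distinct index sets
  \<open>insert j T\<close>, so their Vitali variations are distinct summands of the Hardy--Krause
  variation.\<close>

lemma line_variation_le_hk:
  fixes f :: "real ^ 'd::finite \<Rightarrow> real"
  assumes x: "\<And>i. i \<noteq> j \<Longrightarrow> 0 \<le> x $ i \<and> x $ i < 1"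
    and s: "s 0 = 0" "s n = 1" "\<And>k. k < n \<Longrightarrow> s k < s (Suc k)"
  shows "(\<Sum>k<n. ennreal \<bar>f (upd x j (s (Suc k))) - f (upd x j (s k))\<bar>) \<le> hk_variation f"
proof -
  let ?P = "Pow (UNIV - {j})"
  let ?alt = "\<lambda>T k. alternating_sum f (insert j T) (\<lambda>i. if i = j then s k else x $ i)
    (\<lambda>i. if i = j then s (Suc k) else 1)"
  have "(\<Sum>k<n. ennreal \<bar>f (upd x j (s (Suc k))) - f (upd x j (s k))\<bar>)
      \<le> (\<Sum>k<n. ennreal (\<Sum>T\<in>?P. \<bar>?alt T k\<bar>))"
    by (intro sum_mono ennreal_leI abs_line_increment_le)
  also have "\<dots> = (\<Sum>T\<in>?P. \<Sum>k<n. ennreal \<bar>?alt T k\<bar>)"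
    by (subst sum.swap) (simp add: sum_ennreal)
  also have "\<dots> \<le> (\<Sum>T\<in>?P. vitali_variation f (insert j T))"
    by (intro sum_mono sum_alternating_le_vitali x s) simp_all
  also have "\<dots> = (\<Sum>w\<in>insert j ` ?P. vitali_variation f w)"
    by (subst sum.reindex) (auto simp: inj_on_def)
  also have "\<dots> \<le> hk_variation f"
    unfolding hk_variation_def by (intro sum_mono2) auto
  finally show ?thesis .
qed

lemma cell_increments_le_hk:
  fixes f :: "real ^ 'd::finite \<Rightarrow> real"
  assumes f: "hk_variation f < \<infinity>" and n: "0 < n" and \<xi>: "0 \<le> \<xi>" "\<xi> < 1"
    and x: "\<And>i. i \<noteq> j \<Longrightarrow> 0 \<le> x $ i \<and> x $ i < 1"
  shows "(\<Sum>c<n. \<bar>f (upd x j ((real c + \<xi>) / real n)) - f (upd x j (real c / real n))\<bar>)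
    \<le> enn2real (hk_variation f)"
proof (cases "\<xi> = 0")
  case False
  then have \<xi>0: "0 < \<xi>" using \<xi> by simp
  \<comment> \<open>The partition c / n < (c + \<xi>) / n < (c + 1) / n; the increments wanted are
    those of its even-numbered intervals.\<close>
  define s where "s k = (real (k div 2) + (if odd k then \<xi> else 0)) / real n" for k
  have "s k < s (Suc k)" for k
  proof (cases "even k")
    case True
    then have "Suc k div 2 = k div 2" by (auto elim: evenE)
    then show ?thesis using True n \<xi>0 by (simp add: s_def divide_strict_right_mono)
  next
    case False
    then have "Suc k div 2 = Suc (k div 2)" by (auto elim: oddE)
    then show ?thesis using False n \<xi> by (simp add: s_def divide_strict_right_mono)
  qed
  then have *: "(\<Sum>k<2 * n. ennreal \<bar>f (upd x j (s (Suc k))) - f (upd x j (s k))\<bar>) \<le> hk_variation f"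
    using n by (intro line_variation_le_hk x) (simp_all add: s_def)
  let ?g = "\<lambda>k. \<bar>f (upd x j (s (Suc k))) - f (upd x j (s k))\<bar>"
  have "(\<Sum>c<n. \<bar>f (upd x j ((real c + \<xi>) / real n)) - f (upd x j (real c / real n))\<bar>) = (\<Sum>c<n. ?g (2 * c))"
    by (simp add: s_def)
  also have "\<dots> = sum ?g ((*) 2 ` {..<n})"
    by (subst sum.reindex) (auto simp: inj_on_def)
  also have "\<dots> \<le> (\<Sum>k<2 * n. ?g k)"
    by (intro sum_mono2) auto
  also have "\<dots> = enn2real (ennreal (\<Sum>k<2 * n. ?g k))"
    by (subst enn2real_ennreal) (auto intro: sum_nonneg)
  also have "\<dots> \<le> enn2real (hk_variation f)"
    using * f by (intro enn2real_mono) (simp_all add: sum_ennreal)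
  finally show ?thesis .
qed simp

text \<open>The involution exchanging \<open>q j\<close> with \<open>c\<close> shows that every
  index is hit n times.\<close>

lemma sum_fun_upd_average:
  fixes G :: "('d::finite \<Rightarrow> nat) \<Rightarrow> real"
  shows "(\<Sum>q\<in>(\<Pi>\<^sub>E i\<in>UNIV. {..<n}). \<Sum>c<n. G (q(j := c))) = real n * (\<Sum>q\<in>(\<Pi>\<^sub>E i\<in>UNIV. {..<n}). G q)"
proof -
  let ?Q = "\<Pi>\<^sub>E i\<in>(UNIV :: 'd set). {..<n}"
  let ?swap = "\<lambda>(q, c). (q(j := c), q j) :: ('d \<Rightarrow> nat) \<times> nat"
  have "(\<Sum>q\<in>?Q. \<Sum>c<n. G (q(j := c))) = (\<Sum>p\<in>?Q \<times> {..<n}. G (fst (?swap p)))"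
    by (simp add: sum.cartesian_product' case_prod_unfold)
  also have "\<dots> = (\<Sum>p\<in>?Q \<times> {..<n}. G (fst p))"
    by (rule sum.reindex_bij_witness[of _ ?swap ?swap]) (auto simp: PiE_iff)
  also have "\<dots> = real n * (\<Sum>q\<in>?Q. G q)"
    by (simp add: sum.cartesian_product' sum_distrib_left)
  finally show ?thesis .
qed

text \<open>The offset \<xi> is switched on one coordinate at a time. Each switch is a sum over n^(d
  - 1) lines, written as n^d / n, and on each line it costs at most the total variation.\<close>

lemma grid_increments_le_hk:
  fixes f :: "real ^ 'd::finite \<Rightarrow> real"
  assumes f: "hk_variation f < \<infinity>" and n: "0 < n" and \<xi>: "\<xi> \<in> unit_cube"
  shows "(\<Sum>q\<in>(\<Pi>\<^sub>E i\<in>UNIV. {..<n}).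
      \<bar>f (\<chi> i. (real (q i) + (if i \<in> J then \<xi> $ i else 0)) / real n) - f (\<chi> i. real (q i) / real n)\<bar>)
    \<le> real (card J) * (real n ^ CARD('d) / real n) * enn2real (hk_variation f)"
proof -
  let ?Q = "\<Pi>\<^sub>E i\<in>(UNIV :: 'd set). {..<n}" and ?V = "enn2real (hk_variation f)"
  define z where "z J q = (\<chi> i. (real (q i) + (if i \<in> J then \<xi> $ i else 0)) / real n)"
    for J and q :: "'d \<Rightarrow> nat"
  have \<xi>01: "0 \<le> \<xi> $ i" "\<xi> $ i < 1" for i using \<xi> by (auto simp: unit_cube_def)
  have z01: "0 \<le> z J q $ i \<and> z J q $ i < 1" if "q \<in> ?Q" for J q i
  proof -
    have "Suc (q i) \<le> n" using that by (auto simp: PiE_iff Suc_le_eq)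
    then have "real (q i) + 1 \<le> real n" by linarith
    then show ?thesis using \<xi>01[of i] n by (auto simp: z_def)
  qed
  have "(\<Sum>q\<in>?Q. \<bar>f (z J q) - f (z {} q)\<bar>) \<le> real (card J) * (real n ^ CARD('d) / real n) * ?V"
    using finite[of J]
  proof (induction J rule: finite_induct)
    case empty
    show ?case by simp
  next
    case (insert j J)
    let ?G = "\<lambda>q. \<bar>f (z (insert j J) q) - f (z J q)\<bar>"
    have "(\<Sum>c<n. ?G (q(j := c))) \<le> ?V" if q: "q \<in> ?Q" for q
    proof -
      have "z (insert j J) (q(j := c)) = upd (z J q) j ((real c + \<xi> $ j) / real n)"
        "z J (q(j := c)) = upd (z J q) j (real c / real n)" for c
        using insert.hyps by (auto simp: z_def upd_def vec_eq_iff)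
      then show ?thesis
        using cell_increments_le_hk[OF f n \<xi>01, of j "z J q"] z01[OF q] by simp
    qed
    then have "real n * (\<Sum>q\<in>?Q. ?G q) \<le> (\<Sum>q\<in>?Q. ?V)"
      unfolding sum_fun_upd_average[where j = j and n = n and G = ?G, symmetric] by (intro sum_mono)
    also have "\<dots> = real n ^ CARD('d) * ?V"
      by (simp add: card_PiE)
    finally have "(\<Sum>q\<in>?Q. ?G q) \<le> real n ^ CARD('d) / real n * ?V"
      using n by (simp add: field_simps)
    moreover have "(\<Sum>q\<in>?Q. \<bar>f (z (insert j J) q) - f (z {} q)\<bar>)
        \<le> (\<Sum>q\<in>?Q. ?G q + \<bar>f (z J q) - f (z {} q)\<bar>)"
      by (intro sum_mono) linarith
    ultimately show ?case
      using insert by (simp add: sum.distrib algebra_simps add_divide_distrib)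
  qed
  then show ?thesis by (simp add: z_def)
qed

text \<open>The grid with n = 1 has the single cell with corner 0.\<close>

lemma hk_abs_diff_le:
  fixes f :: "real ^ 'd::finite \<Rightarrow> real"
  assumes f: "hk_variation f < \<infinity>" and x: "x \<in> unit_cube"
  shows "\<bar>f x - f 0\<bar> \<le> real CARD('d) * enn2real (hk_variation f)"
proof -
  have "(\<Pi>\<^sub>E i\<in>(UNIV :: 'd set). {..<Suc 0}) = {\<lambda>_. 0}" by (auto simp: fun_eq_iff PiE_iff)
  moreover have "(\<chi> i. x $ i) = x" "(\<chi> i. (0 :: real)) = (0 :: real ^ 'd)" by (simp_all add: vec_eq_iff)
  ultimately show ?thesis
    using grid_increments_le_hk[OF f _ x, of 1 UNIV] by simp
qed

lemma nn_integral_elementary_interval: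
  fixes h :: "real ^ 'd::finite \<Rightarrow> ennreal"
  assumes b: "0 < b" and h: "h \<in> borel_measurable borel"
  shows "(\<integral>\<^sup>+x. h x * indicator (elementary_interval b (\<lambda>_. k) \<tau>) x \<partial>lborel)
    = ennreal ((1 / real b ^ k) ^ CARD('d)) *
      (\<integral>\<^sup>+\<xi>. h (corner b (\<lambda>_. k) \<tau> + (1 / real b ^ k) *\<^sub>R \<xi>) * indicator unit_cube \<xi> \<partial>lborel)"
proof -
  let ?c = "1 / real b ^ k" and ?E = "elementary_interval b (\<lambda>_. k) \<tau> :: (real ^ 'd) set"
  let ?T = "\<lambda>\<xi> :: real ^ 'd. corner b (\<lambda>_. k) \<tau> + ?c *\<^sub>R \<xi>"
  have c: "?c > 0" using b by simp
  have meas: "(\<lambda>x. h x * indicator ?E x) \<in> borel_measurable borel"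
  proof -
    note [measurable] = h elementary_interval_sets[of b "\<lambda>_. k" \<tau>]
    show ?thesis by measurable
  qed
  have ind: "indicator ?E (?T \<xi>) = (indicator unit_cube \<xi> :: ennreal)" for \<xi>
  proof -
    have "\<not> real b ^ k \<le> 0" using b by (simp add: not_le)
    then have "?T \<xi> \<in> ?E \<longleftrightarrow> \<xi> \<in> unit_cube"
      using b by (simp add: elementary_interval_def unit_cube_def corner_def add_divide_distrib
          divide_less_cancel zero_le_divide_iff)
    then show ?thesis by (simp add: indicator_def)
  qed
  have lb: "(lborel :: (real ^ 'd) measure) = density (distr lborel borel ?T) (\<lambda>_. \<bar>?c\<bar> ^ DIM(real ^ 'd))"
    using c by (intro lborel_affine) simp
  have "(\<integral>\<^sup>+x. h x * indicator ?E x \<partial>lborel)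
      = (\<integral>\<^sup>+x. h x * indicator ?E x \<partial>density (distr lborel borel ?T) (\<lambda>_. \<bar>?c\<bar> ^ DIM(real ^ 'd)))"
    by (subst lb) simp
  also have "\<dots> = (\<integral>\<^sup>+x. ennreal (?c ^ CARD('d)) * (h x * indicator ?E x) \<partial>distr lborel borel ?T)"
    using meas c by (subst nn_integral_density) simp_all
  also have "\<dots> = ennreal (?c ^ CARD('d)) * (\<integral>\<^sup>+\<xi>. h (?T \<xi>) * indicator ?E (?T \<xi>) \<partial>lborel)"
    using meas by (simp add: nn_integral_cmult nn_integral_distr)
  finally show ?thesis unfolding ind .
qed

text \<open>All cells are rescaled to the unit cube, so the mean of |\<phi> - s| becomes b^(-kd)
  times the integral over offsets \<xi> of a sum over cells, which
  \<open>grid_increments_le_hk\<close> bounds by V b^(kd) / b^k. Since |\<phi> - s| <= 2 V, the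
  square costs a further factor 2 V.\<close>

lemma hk_step_approximation:
  fixes \<phi> :: "real ^ 'd::finite \<Rightarrow> real"
  assumes b: "2 \<le> b" and \<phi>: "\<phi> \<in> borel_measurable uniform_cube" and hk: "bounded_hk_variation \<phi>"
  shows "\<exists>C\<ge>0. \<forall>k. integrable uniform_cube (\<lambda>x. (\<phi> x - \<phi> (corner b (\<lambda>_. k) (cells b (\<lambda>_. k) x)))\<^sup>2) \<and>
    (LINT x|uniform_cube. (\<phi> x - \<phi> (corner b (\<lambda>_. k) (cells b (\<lambda>_. k) x)))\<^sup>2) \<le> C / real b ^ k"
proof -
  have b0: "0 < b" using b by simp
  obtain f where f\<phi>: "\<And>u. u \<in> unit_cube \<Longrightarrow> f u = \<phi> u" and f: "hk_variation f < \<infinity>"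
    using hk by (auto simp: bounded_hk_variation_def)
  define V where "V = real CARD('d) * enn2real (hk_variation f)"
  have V: "0 \<le> V" by (simp add: V_def)
  have osc: "\<bar>\<phi> x - \<phi> y\<bar> \<le> 2 * V" if "x \<in> unit_cube" "y \<in> unit_cube" for x y
    using hk_abs_diff_le[OF f that(1)] hk_abs_diff_le[OF f that(2)] f\<phi> that unfolding V_def by fastforce
  have "integrable uniform_cube (\<lambda>x. (\<phi> x - \<phi> (corner b (\<lambda>_. k) (cells b (\<lambda>_. k) x)))\<^sup>2) \<and>
    (LINT x|uniform_cube. (\<phi> x - \<phi> (corner b (\<lambda>_. k) (cells b (\<lambda>_. k) x)))\<^sup>2) \<le> 2 * V * V / real b ^ k" for k
  proof -
    let ?k = "\<lambda>_ :: 'd. k" and ?n = "b ^ k"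
    define s where "s x = \<phi> (corner b ?k (cells b ?k x))" for x
    have n: "0 < ?n" using b0 by simp
    have s: "step_fun b ?k s" by (simp add: step_fun_def s_def)
    have s_meas: "s \<in> borel_measurable uniform_cube" by (rule step_fun_measurable[OF b0 s])
    have corner: "corner b ?k \<tau> \<in> unit_cube" if "\<tau> \<in> cell_indices b ?k" for \<tau>
      using elementary_interval_subset[OF b0 that] corner_in_elementary_interval[OF b0] by blast
    have s_osc: "\<bar>\<phi> x - s x\<bar> \<le> 2 * V" if "x \<in> unit_cube" for x
      unfolding s_def by (intro osc that corner cells_in_cell_indices[OF b0])
    define h where "h x = ennreal \<bar>\<phi> x - s x\<bar> * indicator unit_cube x" for x
    have h_meas: "h \<in> borel_measurable borel"
    proof -
      have "(\<lambda>x. ennreal \<bar>\<phi> x - s x\<bar>) \<in> borel_measurable (restrict_space borel unit_cube)"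
        using \<phi> s_meas measurable_cong_sets[of "uniform_cube :: (real ^ 'd) measure" "restrict_space borel unit_cube" borel borel]
        by (simp add: uniform_cube_def sets_restrict_space)
      then show ?thesis
        unfolding h_def by (subst (asm) borel_measurable_restrict_space_iff_ennreal) auto
    qed
    have Qeq: "cell_indices b ?k = (\<Pi>\<^sub>E i\<in>UNIV. {..<?n})" by (simp add: cell_indices_def)
    have "(\<integral>\<^sup>+x. ennreal \<bar>\<phi> x - s x\<bar> \<partial>uniform_cube) = (\<integral>\<^sup>+x. h x \<partial>lborel)"
      unfolding uniform_cube_def h_def by (subst nn_integral_restrict_space) auto
    also have "\<dots> = (\<integral>\<^sup>+x. (\<Sum>\<tau>\<in>cell_indices b ?k. h x * indicator (elementary_interval b ?k \<tau>) x) \<partial>lborel)"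
    proof (rule nn_integral_cong)
      fix x :: "real ^ 'd"
      show "h x = (\<Sum>\<tau>\<in>cell_indices b ?k. h x * indicator (elementary_interval b ?k \<tau>) x)"
      proof (cases "x \<in> unit_cube")
        case True
        have "(\<Sum>\<tau>\<in>cell_indices b ?k. h x * indicator (elementary_interval b ?k \<tau>) x)
            = (\<Sum>\<tau>\<in>cell_indices b ?k. if \<tau> = cells b ?k x then h x else 0)"
          using mem_elementary_interval_iff[OF b0 True] by (intro sum.cong) (auto simp: indicator_def)
        then show ?thesis
          using cells_in_cell_indices[OF b0 True, of ?k] finite_cell_indices[of b ?k] by (simp add: sum.delta')
      qed (simp add: h_def)
    qed
    also have "\<dots> = (\<Sum>\<tau>\<in>cell_indices b ?k. \<integral>\<^sup>+x. h x * indicator (elementary_interval b ?k \<tau>) x \<partial>lborel)"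
    proof -
      note [measurable] = h_meas elementary_interval_sets
      show ?thesis by (intro nn_integral_sum) measurable
    qed
    also have "\<dots> = (\<Sum>\<tau>\<in>cell_indices b ?k. ennreal ((1 / real b ^ k) ^ CARD('d)) *
        (\<integral>\<^sup>+\<xi>. h (corner b ?k \<tau> + (1 / real b ^ k) *\<^sub>R \<xi>) * indicator unit_cube \<xi> \<partial>lborel))"
      by (intro sum.cong refl nn_integral_elementary_interval b0 h_meas)
    also have "\<dots> = ennreal ((1 / real b ^ k) ^ CARD('d)) * (\<integral>\<^sup>+\<xi>. (\<Sum>\<tau>\<in>cell_indices b ?k.
        h (corner b ?k \<tau> + (1 / real b ^ k) *\<^sub>R \<xi>) * indicator unit_cube \<xi>) \<partial>lborel)"
    proof -
      have "(\<lambda>\<xi>. h (corner b ?k \<tau> + (1 / real b ^ k) *\<^sub>R \<xi>) * indicator unit_cube \<xi>) \<in> borel_measurable lborel" for \<tau>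
      proof -
        note [measurable] = h_meas
        show ?thesis by measurable
      qed
      then show ?thesis by (subst nn_integral_sum) (simp_all add: sum_distrib_left)
    qed
    also have "\<dots> \<le> ennreal ((1 / real b ^ k) ^ CARD('d)) *
        (\<integral>\<^sup>+\<xi>. ennreal (real ?n ^ CARD('d) / real ?n * V) * indicator (unit_cube :: (real ^ 'd) set) \<xi> \<partial>lborel)"
    proof (intro mult_left_mono nn_integral_mono)
      fix \<xi> :: "real ^ 'd"
      show "(\<Sum>\<tau>\<in>cell_indices b ?k. h (corner b ?k \<tau> + (1 / real b ^ k) *\<^sub>R \<xi>) * indicator unit_cube \<xi>)
          \<le> ennreal (real ?n ^ CARD('d) / real ?n * V) * indicator unit_cube \<xi>"
      proof (cases "\<xi> \<in> unit_cube")
        case True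
        have "h (corner b ?k \<tau> + (1 / real b ^ k) *\<^sub>R \<xi>) = ennreal \<bar>f (\<chi> i. (real (\<tau> i) + \<xi> $ i) / real ?n)
            - f (\<chi> i. real (\<tau> i) / real ?n)\<bar>" if \<tau>: "\<tau> \<in> cell_indices b ?k" for \<tau>
        proof -
          let ?y = "corner b ?k \<tau> + (1 / real b ^ k) *\<^sub>R \<xi>"
          have y: "?y = (\<chi> i. (real (\<tau> i) + \<xi> $ i) / real ?n)"
            by (simp add: vec_eq_iff corner_def add_divide_distrib)
          have yE: "?y \<in> elementary_interval b ?k \<tau>"
            using True b0 unfolding y
            by (simp add: elementary_interval_def unit_cube_def divide_right_mono divide_strict_right_mono)
          then have yc: "?y \<in> unit_cube" using elementary_interval_subset[OF b0 \<tau>] by blast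
          then have "s ?y = \<phi> (corner b ?k \<tau>)"
            using yE by (simp add: s_def mem_elementary_interval_iff[OF b0])
          then have "h ?y = ennreal \<bar>f ?y - f (corner b ?k \<tau>)\<bar>"
            using yc corner[OF \<tau>] by (simp add: h_def f\<phi>)
          then show ?thesis unfolding y by (simp add: corner_def)
        qed
        then have "(\<Sum>\<tau>\<in>cell_indices b ?k. h (corner b ?k \<tau> + (1 / real b ^ k) *\<^sub>R \<xi>))
            = ennreal (\<Sum>\<tau>\<in>cell_indices b ?k. \<bar>f (\<chi> i. (real (\<tau> i) + \<xi> $ i) / real ?n) - f (\<chi> i. real (\<tau> i) / real ?n)\<bar>)"
          by (simp add: sum_ennreal)
        also have "\<dots> \<le> ennreal (real ?n ^ CARD('d) / real ?n * V)"
          using grid_increments_le_hk[OF f n True, of UNIV] unfolding Qeq V_def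
          by (intro ennreal_leI) (simp add: mult_ac)
        finally show ?thesis using True by simp
      qed simp
    qed simp
    also have "\<dots> = ennreal (V / real b ^ k)"
    proof -
      have "(\<integral>\<^sup>+\<xi>. ennreal (real ?n ^ CARD('d) / real ?n * V) * indicator (unit_cube :: (real ^ 'd) set) \<xi> \<partial>lborel)
          = ennreal (real ?n ^ CARD('d) / real ?n * V)"
        using unit_cube_sets by (simp add: nn_integral_cmult_indicator emeasure_unit_cube)
      moreover have "(1 / real b ^ k) ^ CARD('d) * (real ?n ^ CARD('d) / real ?n * V) = V / real b ^ k"
        using b0 by (simp add: power_divide)
      ultimately show ?thesis
        using V by (metis ennreal_mult' zero_le_divide_1_iff zero_le_power of_nat_0_le_iff)
    qed
    finally have nn: "(\<integral>\<^sup>+x. ennreal \<bar>\<phi> x - s x\<bar> \<partial>uniform_cube) \<le> ennreal (V / real b ^ k)" .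
    have diff_meas: "(\<lambda>x. \<phi> x - s x) \<in> borel_measurable uniform_cube"
      using \<phi> s_meas by (rule borel_measurable_diff)
    have diff_int: "integrable uniform_cube (\<lambda>x. \<phi> x - s x)"
      using s_osc by (intro U.integrable_const_bound[where B = "2 * V"] diff_meas) auto
    have "(LINT x|uniform_cube. \<bar>\<phi> x - s x\<bar>) = enn2real (\<integral>\<^sup>+x. ennreal \<bar>\<phi> x - s x\<bar> \<partial>uniform_cube)"
      using diff_meas by (intro integral_eq_nn_integral) auto
    also have "\<dots> \<le> enn2real (ennreal (V / real b ^ k))"
      using nn by (intro enn2real_mono) simp_all
    finally have L1: "(LINT x|uniform_cube. \<bar>\<phi> x - s x\<bar>) \<le> V / real b ^ k"
      using V by simp
    have sq_int: "integrable uniform_cube (\<lambda>x. (\<phi> x - s x)\<^sup>2)"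
      using U.L2_bounded[OF diff_meas, of "2 * V"] s_osc by (simp add: L2_def)
    have "(LINT x|uniform_cube. (\<phi> x - s x)\<^sup>2) \<le> (LINT x|uniform_cube. 2 * V * \<bar>\<phi> x - s x\<bar>)"
    proof (rule integral_mono)
      show "integrable uniform_cube (\<lambda>x. (\<phi> x - s x)\<^sup>2)" by (rule sq_int)
      show "integrable uniform_cube (\<lambda>x. 2 * V * \<bar>\<phi> x - s x\<bar>)" using diff_int by simp
      fix x :: "real ^ 'd" assume "x \<in> space uniform_cube"
      then have "\<bar>\<phi> x - s x\<bar> * \<bar>\<phi> x - s x\<bar> \<le> 2 * V * \<bar>\<phi> x - s x\<bar>"
        by (intro mult_right_mono s_osc) simp_all
      then show "(\<phi> x - s x)\<^sup>2 \<le> 2 * V * \<bar>\<phi> x - s x\<bar>" by (simp add: power2_eq_square)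
    qed
    also have "\<dots> \<le> 2 * V * (V / real b ^ k)"
      unfolding integral_mult_right_zero using V by (intro mult_left_mono L1) simp
    finally show ?thesis using sq_int by (simp add: s_def)
  qed
  then show ?thesis using V by (intro exI[of _ "2 * V * V"]) simp
qed


subsection \<open>Empirical quantiles\<close>

definition emp_cdf :: "nat \<Rightarrow> (nat \<Rightarrow> real) \<Rightarrow> real \<Rightarrow> real" where
  "emp_cdf n x y = (\<Sum>i<n. of_bool (x i \<le> y)) / real n"

definition emp_shortfall :: "nat \<Rightarrow> (nat \<Rightarrow> real) \<Rightarrow> real \<Rightarrow> real" where
  "emp_shortfall n x y = (\<Sum>i<n. max (y - x i) 0) / real n"

context
  fixes n :: nat and x :: "nat \<Rightarrow> real" and p :: real
  assumes n: "0 < n" and p: "0 < p" "p < 1"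
begin

lemma emp_cdf_mono: "y \<le> z \<Longrightarrow> emp_cdf n x y \<le> emp_cdf n x z"
  unfolding emp_cdf_def by (intro divide_right_mono sum_mono) auto

text \<open>The empirical distribution function jumps only at sample points, so the infimum is
  attained at the least sample point in A.\<close>

lemma emp_quantile_le_iff: "quantile (emp_cdf n x) p \<le> y \<longleftrightarrow> p \<le> emp_cdf n x y"
proof -
  define A where "A = {x i |i. i < n \<and> p \<le> emp_cdf n x (x i)}"
  have A: "finite A" unfolding A_def by (rule finite_subset[of _ "x ` {..<n}"]) auto
  have attained: "\<exists>z\<in>A. z \<le> y" if y: "p \<le> emp_cdf n x y" for y
  proof -
    define B where "B = {i. i < n \<and> x i \<le> y}"
    have B: "finite B" by (simp add: B_def)
    have "B \<noteq> {}"
    proof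
      assume "B = {}"
      then have "emp_cdf n x y = 0" by (auto simp: emp_cdf_def B_def)
      then show False using y p by simp
    qed
    define z where "z = Max (x ` B)"
    have "z \<in> x ` B" using B \<open>B \<noteq> {}\<close> by (simp add: z_def)
    then obtain i where i: "i < n" "x i \<le> y" "z = x i" by (auto simp: B_def)
    have "x l \<le> z" if "l < n" "x l \<le> y" for l
      unfolding z_def using B that by (intro Max_ge) (auto simp: B_def)
    then have "emp_cdf n x y \<le> emp_cdf n x z"
      unfolding emp_cdf_def by (intro divide_right_mono sum_mono) auto
    then have "z \<in> A" using i y by (auto simp: A_def)
    then show ?thesis using i by auto
  qed
  have "p \<le> emp_cdf n x (Max (x ` {..<n}))"
  proof -
    have "x i \<le> Max (x ` {..<n})" if "i < n" for i using that by simp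
    then have "emp_cdf n x (Max (x ` {..<n})) = 1" using n by (simp add: emp_cdf_def)
    then show ?thesis using p by simp
  qed
  then have "A \<noteq> {}" using attained by blast
  define a where "a = Min A"
  have "a \<in> A" using A \<open>A \<noteq> {}\<close> by (simp add: a_def)
  then have a: "p \<le> emp_cdf n x a" by (auto simp: A_def)
  have iff: "p \<le> emp_cdf n x y \<longleftrightarrow> a \<le> y" for y
  proof
    assume "p \<le> emp_cdf n x y"
    then obtain z where "z \<in> A" "z \<le> y" using attained by blast
    moreover from this have "a \<le> z" using A by (simp add: a_def)
    ultimately show "a \<le> y" by simp
  next
    assume "a \<le> y"
    then show "p \<le> emp_cdf n x y" using emp_cdf_mono a by (meson order_trans)
  qed
  then have "{y. p \<le> emp_cdf n x y} = {a..}" by auto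
  then have "quantile (emp_cdf n x) p = a" by (simp add: quantile_def)
  then show ?thesis using iff by simp
qed

text \<open>\<open>y - emp_shortfall n x y / p\<close> is concave in \<open>y\<close> with supergradient
  \<open>1 - emp_cdf n x y / p\<close> and is maximal at the empirical quantile.\<close>

lemma emp_shortfall_increment:
  assumes "y \<le> z"
  shows "(z - y) * emp_cdf n x y \<le> emp_shortfall n x z - emp_shortfall n x y"
    and "emp_shortfall n x z - emp_shortfall n x y \<le> (z - y) * emp_cdf n x z"
    and "emp_shortfall n x z - emp_shortfall n x y \<le> (z - y) * ((\<Sum>i<n. of_bool (x i < z)) / real n)"
proof -
  have diff: "emp_shortfall n x z - emp_shortfall n x y = (\<Sum>i<n. max (z - x i) 0 - max (y - x i) 0) / real n"
    by (simp add: emp_shortfall_def sum_subtractf diff_divide_distrib)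
  have "(z - y) * emp_cdf n x y = (\<Sum>i<n. (z - y) * of_bool (x i \<le> y)) / real n"
    by (simp add: emp_cdf_def sum_distrib_left)
  also have "\<dots> \<le> emp_shortfall n x z - emp_shortfall n x y"
    unfolding diff using assms by (intro divide_right_mono sum_mono) auto
  finally show "(z - y) * emp_cdf n x y \<le> emp_shortfall n x z - emp_shortfall n x y" .
  have "emp_shortfall n x z - emp_shortfall n x y \<le> (\<Sum>i<n. (z - y) * of_bool (x i \<le> z)) / real n"
    unfolding diff using assms by (intro divide_right_mono sum_mono) auto
  also have "\<dots> = (z - y) * emp_cdf n x z"
    by (simp add: emp_cdf_def sum_distrib_left)
  finally show "emp_shortfall n x z - emp_shortfall n x y \<le> (z - y) * emp_cdf n x z" .
  have "emp_shortfall n x z - emp_shortfall n x y \<le> (\<Sum>i<n. (z - y) * of_bool (x i < z)) / real n"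
    unfolding diff using assms by (intro divide_right_mono sum_mono) auto
  also have "\<dots> = (z - y) * ((\<Sum>i<n. of_bool (x i < z)) / real n)"
    by (simp add: sum_distrib_left)
  finally show "emp_shortfall n x z - emp_shortfall n x y \<le> (z - y) * ((\<Sum>i<n. of_bool (x i < z)) / real n)" .
qed

text \<open>The sample points strictly below the quantile are counted by the empirical distribution
  function at the largest of them, where it is still below p.\<close>

lemma emp_cdf_left_limit_le:
  "(\<Sum>i<n. of_bool (x i < quantile (emp_cdf n x) p)) / real n \<le> p"
proof -
  let ?q = "quantile (emp_cdf n x) p"
  define B where "B = {i. i < n \<and> x i < ?q}"
  have B: "finite B" by (simp add: B_def)
  show ?thesis
  proof (cases "B = {}")
    case True
    then have "(\<Sum>i<n. of_bool (x i < ?q) :: real) = 0" by (intro sum.neutral) (auto simp: B_def)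
    then show ?thesis using p by simp
  next
    case False
    define z where "z = Max (x ` B)"
    have "z \<in> x ` B" using B False by (simp add: z_def)
    then have "z < ?q" by (auto simp: B_def)
    then have "emp_cdf n x z < p" using emp_quantile_le_iff[of z] by linarith
    have "x l \<le> z" if "l < n" "x l < ?q" for l
      unfolding z_def using B that by (intro Max_ge) (auto simp: B_def)
    then have "(\<Sum>i<n. of_bool (x i < ?q)) / real n \<le> emp_cdf n x z"
      unfolding emp_cdf_def by (intro divide_right_mono sum_mono) auto
    then show ?thesis using \<open>emp_cdf n x z < p\<close> by simp
  qed
qed

lemma emp_cvar_deviation:
  assumes "\<bar>quantile (emp_cdf n x) p - v\<bar> \<le> R"
  shows "\<bar>(quantile (emp_cdf n x) p - emp_shortfall n x (quantile (emp_cdf n x) p) / p) - (v - emp_shortfall n x v / p)\<bar>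
    \<le> R / p * \<bar>emp_cdf n x v - p\<bar>"
proof -
  let ?q = "quantile (emp_cdf n x) p"
  define D where "D = (?q - emp_shortfall n x ?q / p) - (v - emp_shortfall n x v / p)"
  \<comment> \<open>Nonnegativity is the maximality at the quantile q: the left limit at q is at
    most p if v <= q, and the value at q is at least p if q < v. The upper bound is the
    supergradient inequality at v.\<close>
  have "0 \<le> p * D \<and> p * D \<le> \<bar>?q - v\<bar> * \<bar>emp_cdf n x v - p\<bar>"
  proof (cases "v \<le> ?q")
    case True
    have pD: "p * D = (?q - v) * p - (emp_shortfall n x ?q - emp_shortfall n x v)"
      using p by (simp add: D_def field_simps)
    have "emp_shortfall n x ?q - emp_shortfall n x v \<le> (?q - v) * p"
      using emp_shortfall_increment(3)[OF True] mult_left_mono[OF emp_cdf_left_limit_le, of "?q - v"] True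
      by simp
    moreover have "p * D \<le> (?q - v) * (p - emp_cdf n x v)"
      using emp_shortfall_increment(1)[OF True] unfolding pD by (simp add: algebra_simps)
    moreover have "(?q - v) * (p - emp_cdf n x v) \<le> \<bar>?q - v\<bar> * \<bar>emp_cdf n x v - p\<bar>"
      using abs_ge_self[of "(?q - v) * (p - emp_cdf n x v)"] by (simp add: abs_mult abs_minus_commute)
    ultimately show ?thesis unfolding pD by linarith
  next
    case False
    then have le: "?q \<le> v" by simp
    have pD: "p * D = (emp_shortfall n x v - emp_shortfall n x ?q) - (v - ?q) * p"
      using p by (simp add: D_def field_simps)
    have "p \<le> emp_cdf n x ?q" using emp_quantile_le_iff[of ?q] by simp
    then have "(v - ?q) * p \<le> (v - ?q) * emp_cdf n x ?q" using le by (intro mult_left_mono) auto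
    then have "(v - ?q) * p \<le> emp_shortfall n x v - emp_shortfall n x ?q"
      using emp_shortfall_increment(1)[OF le] by simp
    moreover have "p * D \<le> (v - ?q) * (emp_cdf n x v - p)"
      using emp_shortfall_increment(2)[OF le] unfolding pD by (simp add: algebra_simps)
    moreover have "(v - ?q) * (emp_cdf n x v - p) \<le> \<bar>?q - v\<bar> * \<bar>emp_cdf n x v - p\<bar>"
      using abs_ge_self[of "(v - ?q) * (emp_cdf n x v - p)"] by (simp add: abs_mult abs_minus_commute)
    ultimately show ?thesis unfolding pD by linarith
  qed
  then have "p * \<bar>D\<bar> \<le> \<bar>?q - v\<bar> * \<bar>emp_cdf n x v - p\<bar>"
    using p by (simp add: zero_le_mult_iff)
  also have "\<dots> \<le> R * \<bar>emp_cdf n x v - p\<bar>"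
    using assms by (intro mult_right_mono) auto
  finally show ?thesis using p by (simp add: D_def field_simps)
qed

lemma emp_quantile_deviation:
  assumes "p \<le> F (v + R) - r" "F (v - R) + r < p"
    and "\<bar>emp_cdf n x (v + R) - F (v + R)\<bar> \<le> r" "\<bar>emp_cdf n x (v - R) - F (v - R)\<bar> \<le> r"
  shows "\<bar>quantile (emp_cdf n x) p - v\<bar> \<le> R"
proof -
  have "quantile (emp_cdf n x) p \<le> v + R" using assms by (subst emp_quantile_le_iff) linarith
  moreover have "\<not> quantile (emp_cdf n x) p \<le> v - R" using assms by (subst emp_quantile_le_iff) linarith
  ultimately show ?thesis by linarith
qed

end


subsection \<open>The distribution function near the quantile\<close>

text \<open>The lower constant must exceed 1/2: with R = 2 r / f(v), the increment of F over a
  length R then exceeds r. The upper bound gives the continuity of F at v.\<close>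

lemma density_increment_bounds:
  assumes dens: "has_density_near F f v" and pos: "0 < f v" and cont: "isCont f v"
  shows "\<exists>\<eta>>0. \<forall>x y. \<bar>x - v\<bar> \<le> \<eta> \<and> \<bar>y - v\<bar> \<le> \<eta> \<and> x < y \<longrightarrow>
    3 / 4 * f v * (y - x) \<le> F y - F x \<and> F y - F x \<le> 2 * f v * (y - x)"
proof -
  obtain J where J: "open J" "v \<in> J"
    "\<And>x y. x \<in> J \<Longrightarrow> y \<in> J \<Longrightarrow> x < y \<Longrightarrow> (f has_integral (F y - F x)) {x..y}"
    using dens unfolding has_density_near_def by blast
  obtain e1 where e1: "e1 > 0" "ball v e1 \<subseteq> J" using J open_contains_ball by blast
  have "\<forall>\<^sub>F x in at v. dist (f x) (f v) < f v / 4"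
    using cont pos unfolding isCont_def by (intro tendstoD) auto
  then obtain e2 where e2: "e2 > 0" "\<And>x. x \<noteq> v \<Longrightarrow> dist x v < e2 \<Longrightarrow> dist (f x) (f v) < f v / 4"
    unfolding eventually_at by blast
  define \<eta> where "\<eta> = min e1 e2 / 2"
  have \<eta>: "\<eta> > 0" "\<eta> < e1" "\<eta> < e2" using e1 e2 by (auto simp: \<eta>_def)
  have fb: "3 / 4 * f v \<le> f x \<and> f x \<le> 2 * f v" if "\<bar>x - v\<bar> \<le> \<eta>" for x
  proof (cases "x = v")
    case True
    then show ?thesis using pos by simp
  next
    case False
    then have "\<bar>f x - f v\<bar> < f v / 4" using e2(2)[of x] that \<eta> by (simp add: dist_real_def)
    then show ?thesis using pos by linarith
  qed
  have "3 / 4 * f v * (y - x) \<le> F y - F x \<and> F y - F x \<le> 2 * f v * (y - x)"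
    if xy: "\<bar>x - v\<bar> \<le> \<eta>" "\<bar>y - v\<bar> \<le> \<eta>" "x < y" for x y
  proof -
    have "x \<in> J" "y \<in> J" using xy \<eta> e1(2) by (auto simp: subset_iff dist_real_def)
    then have int: "(f has_integral (F y - F x)) {x..y}" using J(3) xy by blast
    have c: "((\<lambda>_. c) has_integral c * (y - x)) {x..y}" for c :: real
      using has_integral_const_real[of c x y] xy by (simp add: mult.commute)
    have fb': "3 / 4 * f v \<le> f z \<and> f z \<le> 2 * f v" if "z \<in> {x..y}" for z
      using that xy by (intro fb) auto
    show ?thesis
      using has_integral_le[OF c int] has_integral_le[OF int c] fb' by blast
  qed
  then show ?thesis using \<eta> by blast
qed

text \<open>F is below p to the left of v and at least p to its right; the increment bound rules out
  a jump at v. The limits of F at both infinities make the infimum defining v a proper one.\<close>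

lemma cdf_quantile_eq:
  assumes "prob_space M" "sets M = sets borel" and p: "0 < p" "p < 1" and v: "v = quantile (cdf M) p"
    and C: "\<eta> > 0" "\<And>x y. \<bar>x - v\<bar> \<le> \<eta> \<and> \<bar>y - v\<bar> \<le> \<eta> \<and> x < y \<Longrightarrow> cdf M y - cdf M x \<le> C * (y - x)"
  shows "cdf M v = p"
proof -
  interpret M: real_distribution M
    using assms(1,2) by (simp add: real_distribution_def real_distribution_axioms_def)
  let ?S = "{x. p \<le> cdf M x}"
  have "\<forall>\<^sub>F x in at_top. p < cdf M x"
    using M.cdf_lim_at_top_prob p by (intro order_tendstoD(1)) auto
  then obtain x1 where "p < cdf M x1" by (meson eventually_happens trivial_limit_at_top_linorder)
  then have ne: "?S \<noteq> {}" by (auto intro: less_imp_le)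
  have "\<forall>\<^sub>F x in at_bot. cdf M x < p"
    using M.cdf_lim_at_bot p by (intro order_tendstoD(2)) auto
  then obtain x0 where x0: "\<And>x. x \<le> x0 \<Longrightarrow> cdf M x < p" by (auto simp: eventually_at_bot_linorder)
  have bdd: "bdd_below ?S"
  proof (rule bdd_belowI[of _ x0])
    fix x assume "x \<in> ?S"
    then show "x0 \<le> x" using x0[of x] by (cases "x \<le> x0") auto
  qed
  have below: "cdf M x < p" if "x < v" for x
  proof (rule ccontr)
    assume "\<not> ?thesis"
    then have "v \<le> x" unfolding v quantile_def using bdd by (intro cInf_lower) auto
    then show False using that by simp
  qed
  have above: "p \<le> cdf M x" if x: "v < x" for x
  proof -
    have "Inf ?S < x" using x v by (simp add: quantile_def)
    then obtain s where "s \<in> ?S" "s < x" using cInf_lessD[OF ne] by blast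
    then show ?thesis using M.cdf_nondecreasing[of s x] by auto
  qed
  have "cdf M v \<le> p + e \<and> p \<le> cdf M v + e" if e: "e > 0" for e
  proof -
    \<comment> \<open>Small enough that F changes by at most e over a length h inside the given
      neighborhood, whatever the sign of C.\<close>
    define h where "h = min \<eta> (e / (\<bar>C\<bar> + 1))"
    have "h \<le> e / (\<bar>C\<bar> + 1)" by (simp add: h_def)
    then have "h * (\<bar>C\<bar> + 1) \<le> e" by (subst (asm) pos_le_divide_eq) auto
    then have h: "0 < h" "h \<le> \<eta>" "h * (\<bar>C\<bar> + 1) \<le> e"
      using C(1) e by (auto simp: h_def)
    have "C * h \<le> \<bar>C\<bar> * h" "\<bar>C\<bar> * h + h = h * (\<bar>C\<bar> + 1)"
      using h by (auto intro: mult_right_mono simp: algebra_simps)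
    then have "C * h \<le> e" using h by linarith
    moreover have "cdf M v - cdf M (v - h) \<le> C * h" "cdf M (v + h) - cdf M v \<le> C * h"
      using C(2)[of "v - h" v] C(2)[of v "v + h"] h C(1) by auto
    ultimately show ?thesis using below[of "v - h"] above[of "v + h"] h by auto
  qed
  then have "cdf M v \<le> p" "p \<le> cdf M v" by (auto intro: field_le_epsilon)
  then show ?thesis by simp
qed


subsection \<open>The discrepancy of a net on a sublevel set\<close>

lemma bounded_sublevel: "bounded (sublevel \<phi> y)"
proof (rule bounded_subset[OF bounded_cbox])
  show "sublevel \<phi> y \<subseteq> cbox 0 (\<chi> j. 1)"
    by (auto simp: sublevel_def unit_cube_def mem_box_cart less_imp_le)
qed

text \<open>A thickening is the sum with a closed ball. Compactness provides the measurability on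
  which monotonicity of the measure relies.\<close>

lemma compact_thickening:
  assumes "compact A"
  shows "compact (thickening A \<epsilon>)"
proof -
  have "thickening A \<epsilon> = {y + z |y z. y \<in> A \<and> z \<in> cball 0 \<epsilon>}"
  proof (intro equalityI subsetI)
    fix x assume "x \<in> thickening A \<epsilon>"
    then obtain y where "y \<in> A" "norm (x - y) \<le> \<epsilon>" by (auto simp: thickening_def)
    then have "x = y + (x - y) \<and> y \<in> A \<and> x - y \<in> cball 0 \<epsilon>" by simp
    then show "x \<in> {y + z |y z. y \<in> A \<and> z \<in> cball 0 \<epsilon>}" by blast
  next
    fix x assume "x \<in> {y + z |y z. y \<in> A \<and> z \<in> cball 0 \<epsilon>}"
    then obtain y where "y \<in> A" "norm (x - y) \<le> \<epsilon>" by auto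
    then show "x \<in> thickening A \<epsilon>" by (auto simp: thickening_def)
  qed
  then show ?thesis by (simp only: compact_sums[OF assms compact_cball])
qed

lemma connected_elementary_interval: "connected (elementary_interval b k \<tau>)"
proof -
  have "convex (elementary_interval b k \<tau>)"
    unfolding elementary_interval_def
  proof (rule convex_box_cart)
    show "convex {x. real (\<tau> j) / real b ^ k j \<le> x \<and> x < (real (\<tau> j) + 1) / real b ^ k j}" for j
    proof -
      have "{x. l \<le> x \<and> x < h} = {l..<h}" for l h :: real by auto
      then show ?thesis by (simp only: convex_real_interval)
    qed
  qed
  then show ?thesis by (rule convex_connected)
qed

text \<open>The indicator is squeezed between two step functions integrated exactly by the net. They
  differ only on cells with points on both sides; such a cell is connected, hence meets the
  frontier, and lies within one cell diameter of it.\<close>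

lemma net_discrepancy_sublevel:
  fixes \<phi> :: "real ^ 'd::finite \<Rightarrow> real"
  assumes b: "0 < b" and net: "tmd_net b t m a" and k: "k * CARD('d) + t \<le> m"
    and \<phi>: "\<phi> \<in> borel_measurable uniform_cube"
    and r: "emeasure lborel (thickening (frontier (sublevel \<phi> y)) (sqrt (real CARD('d)) / real b ^ k)) \<le> ennreal r"
    and r0: "0 \<le> r"
  shows "\<bar>(\<Sum>i<b ^ m. of_bool (\<phi> (a i) \<le> y)) / real (b ^ m) - measure uniform_cube (sublevel \<phi> y)\<bar> \<le> r"
proof -
  let ?k = "\<lambda>_ :: 'd. k" and ?\<Omega> = "sublevel \<phi> y"
  let ?T = "thickening (frontier ?\<Omega>) (sqrt (real CARD('d)) / real b ^ k)"
  define up where "up x = (of_bool (\<exists>z\<in>unit_cube. cells b ?k z = cells b ?k x \<and> \<phi> z \<le> y) :: real)" for x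
  define lo where "lo x = (of_bool (\<forall>z\<in>unit_cube. cells b ?k z = cells b ?k x \<longrightarrow> \<phi> z \<le> y) :: real)" for x
  have up: "step_fun b ?k up" and lo: "step_fun b ?k lo"
    by (auto simp: step_fun_def up_def lo_def)
  have ord: "lo x \<le> of_bool (\<phi> x \<le> y)" "of_bool (\<phi> x \<le> y) \<le> up x" if "x \<in> unit_cube" for x
    using that by (auto simp: up_def lo_def)
  have cube: "a i \<in> unit_cube" if "i < b ^ m" for i using net that by (auto simp: tmd_net_def)
  have \<Omega>: "?\<Omega> \<in> sets uniform_cube"
  proof -
    have "?\<Omega> = \<phi> -` {..y} \<inter> space uniform_cube" by (auto simp: sublevel_def)
    then show ?thesis using measurable_sets[OF \<phi>, of "{..y}"] by simp
  qed
  have ind: "(LINT x|uniform_cube. of_bool (\<phi> x \<le> y)) = measure uniform_cube ?\<Omega>"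
  proof -
    have "(LINT x|uniform_cube. of_bool (\<phi> x \<le> y)) = (LINT x|uniform_cube. indicat_real ?\<Omega> x)"
      by (intro Bochner_Integration.integral_cong) (auto simp: sublevel_def indicator_def)
    moreover have "?\<Omega> \<inter> unit_cube = ?\<Omega>" by (auto simp: sublevel_def)
    ultimately show ?thesis by simp
  qed
  have int\<Omega>: "integrable uniform_cube (\<lambda>x. of_bool (\<phi> x \<le> y) :: real)"
  proof -
    have "(\<lambda>x. of_bool (\<phi> x \<le> y) :: real) \<in> borel_measurable uniform_cube"
      using \<phi> by measurable
    then show ?thesis by (rule U.integrable_const_bound[where B = 1, rotated]) auto
  qed
  note intu = step_fun_integral(1)[OF b up] and intl = step_fun_integral(1)[OF b lo]
  have mid: "(LINT x|uniform_cube. lo x) \<le> measure uniform_cube ?\<Omega>"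
      "measure uniform_cube ?\<Omega> \<le> (LINT x|uniform_cube. up x)"
    unfolding ind[symmetric] using ord by (auto intro!: integral_mono intu intl int\<Omega>)
  have gap: "(LINT x|uniform_cube. up x - lo x) \<le> r"
  proof -
    define B where "B = {x \<in> unit_cube. up x - lo x \<noteq> 0}"
    have "(\<lambda>x. up x - lo x) \<in> borel_measurable uniform_cube"
      by (intro borel_measurable_diff step_fun_measurable[OF b up] step_fun_measurable[OF b lo])
    then have "{x \<in> space uniform_cube. up x - lo x \<noteq> 0} \<in> sets uniform_cube"
      by measurable
    then have B: "B \<in> sets uniform_cube" by (simp add: B_def)
    have "up x - lo x = indicator B x" if "x \<in> unit_cube" for x
      using that ord[OF that] unfolding B_def by (auto simp: up_def lo_def indicator_def)
    then have "(LINT x|uniform_cube. up x - lo x) = (LINT x|uniform_cube. indicat_real B x)"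
      by (intro Bochner_Integration.integral_cong) auto
    also have "\<dots> = measure uniform_cube B"
      using B sets.sets_into_space[OF B] by (simp add: Int_absorb2)
    finally have gap: "(LINT x|uniform_cube. up x - lo x) = measure uniform_cube B" .
    have "B \<subseteq> ?T"
    proof
      fix x assume x: "x \<in> B"
      then have xc: "x \<in> unit_cube" by (simp add: B_def)
      let ?E = "elementary_interval b ?k (cells b ?k x)"
      have xE: "x \<in> ?E" using xc by (simp add: mem_elementary_interval_iff[OF b])
      have E: "?E \<subseteq> unit_cube"
        by (rule elementary_interval_subset[OF b cells_in_cell_indices[OF b xc]])
      have "lo x \<noteq> up x" "lo x \<le> up x"
        using x ord[OF xc] by (auto simp: B_def)
      moreover have "of_bool P \<in> {0 :: real, 1}" for P by simp
      then have "up x \<in> {0, 1}" "lo x \<in> {0, 1}" unfolding up_def lo_def by blast+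
      ultimately have "up x = 1 \<and> lo x = 0" by auto
      then obtain z z' where z: "z \<in> unit_cube" "cells b ?k z = cells b ?k x" "\<phi> z \<le> y"
        and z': "z' \<in> unit_cube" "cells b ?k z' = cells b ?k x" "\<not> \<phi> z' \<le> y"
        by (auto simp: up_def lo_def)
      have "z \<in> ?E \<inter> ?\<Omega>" "z' \<in> ?E - ?\<Omega>"
        using z z' by (simp_all add: mem_elementary_interval_iff[OF b] sublevel_def)
      then obtain w where w: "w \<in> ?E" "w \<in> frontier ?\<Omega>"
        using connected_Int_frontier[OF connected_elementary_interval] by blast
      have wc: "w \<in> unit_cube" using w E by blast
      then have "cells b ?k x = cells b ?k w"
        using w(1) by (simp add: mem_elementary_interval_iff[OF b])
      then have "norm (x - w) \<le> sqrt (real CARD('d)) / real b ^ k"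
        by (rule cells_dist[OF b xc wc])
      then show "x \<in> ?T" using w by (auto simp: thickening_def)
    qed
    moreover have "?T \<in> sets borel"
      using compact_thickening[OF compact_frontier_bounded[OF bounded_sublevel]] by (rule borel_compact)
    ultimately have "emeasure uniform_cube B \<le> emeasure lborel ?T"
      using B by (simp add: emeasure_uniform_cube emeasure_mono)
    also have "\<dots> \<le> ennreal r" by (rule r)
    finally have "measure uniform_cube B \<le> r"
      using r0 by (simp add: U.emeasure_eq_measure)
    then show ?thesis using gap by simp
  qed
  have kk: "(\<Sum>j\<in>(UNIV :: 'd set). k) + t \<le> m" using k by (simp add: mult.commute)
  have avg: "(\<Sum>i<b ^ m. s (a i)) / real (b ^ m) = (LINT x|uniform_cube. s x)" if "step_fun b ?k s" for s
    using net_step_fun_exact[OF b net kk that] b by simp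
  have "(\<Sum>i<b ^ m. lo (a i)) / real (b ^ m) \<le> (\<Sum>i<b ^ m. of_bool (\<phi> (a i) \<le> y)) / real (b ^ m)"
    "(\<Sum>i<b ^ m. of_bool (\<phi> (a i) \<le> y)) / real (b ^ m) \<le> (\<Sum>i<b ^ m. up (a i)) / real (b ^ m)"
    by (intro divide_right_mono sum_mono ord cube; simp)+
  moreover have "(LINT x|uniform_cube. up x) - (LINT x|uniform_cube. lo x) \<le> r"
    using gap intu intl by simp
  ultimately show ?thesis
    using mid unfolding avg[OF up] avg[OF lo] by linarith
qed


subsection \<open>Error of the estimator for one net\<close>

context net_scrambling
begin

abbreviation N :: real where "N \<equiv> real (b ^ m)"

lemma N_pos: "0 < N" using b_pos by simp

end

locale cvar_estimation = net_scrambling M b t m a \<pi> u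
  for M :: "'w measure" and b t m :: nat and a :: "nat \<Rightarrow> real ^ 'd::finite"
    and \<pi> :: "'d \<Rightarrow> nat list \<Rightarrow> 'w \<Rightarrow> nat \<Rightarrow> nat" and u :: "nat \<Rightarrow> 'w \<Rightarrow> real ^ 'd" +
  fixes \<phi> :: "real ^ 'd \<Rightarrow> real" and p v c :: real
    and Fh Kh :: "real \<Rightarrow> 'w \<Rightarrow> real" and vh ch :: "'w \<Rightarrow> real"
  assumes \<phi>: "\<phi> \<in> borel_measurable uniform_cube"
    and p: "0 < p" "p < 1"
    and L2K: "L2 uniform_cube (\<lambda>y. max (v - \<phi> y) 0)"
    and pF: "measure uniform_cube (sublevel \<phi> v) = p"
    and c: "c = v - 1 / p * (LINT y|uniform_cube. max (v - \<phi> y) 0)"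
    and Fh: "\<And>x \<omega>. Fh x \<omega> = 1 / N * (\<Sum>i<b ^ m. of_bool (\<phi> (u i \<omega>) \<le> x))"
    and Kh: "\<And>x \<omega>. Kh x \<omega> = 1 / N * (\<Sum>i<b ^ m. max (x - \<phi> (u i \<omega>)) 0)"
    and vh: "\<And>\<omega>. vh \<omega> = quantile (\<lambda>x. Fh x \<omega>) p"
    and ch: "\<And>\<omega>. ch \<omega> = vh \<omega> - 1 / p * Kh (vh \<omega>) \<omega>"
begin

lemma L2_sublevel: "L2 uniform_cube (\<lambda>y. of_bool (\<phi> y \<le> v))"
proof (rule U.L2_bounded[where B = 1])
  show "(\<lambda>y. of_bool (\<phi> y \<le> v) :: real) \<in> borel_measurable uniform_cube"
    using \<phi> by measurable
qed simp

lemma integral_sublevel: "(LINT y|uniform_cube. of_bool (\<phi> y \<le> v)) = p"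
proof -
  have "(LINT y|uniform_cube. of_bool (\<phi> y \<le> v)) = (LINT y|uniform_cube. indicat_real (sublevel \<phi> v) y)"
    by (intro Bochner_Integration.integral_cong) (auto simp: sublevel_def indicator_def)
  moreover have "sublevel \<phi> v \<inter> unit_cube = sublevel \<phi> v" by (auto simp: sublevel_def)
  ultimately show ?thesis using pF by simp
qed

lemma Fh_emp: "Fh x \<omega> = emp_cdf (b ^ m) (\<lambda>i. \<phi> (u i \<omega>)) x"
  using b_pos by (simp add: Fh emp_cdf_def)

lemma Kh_emp: "Kh x \<omega> = emp_shortfall (b ^ m) (\<lambda>i. \<phi> (u i \<omega>)) x"
  using b_pos by (simp add: Kh emp_shortfall_def)

lemma vh_emp: "vh \<omega> = quantile (emp_cdf (b ^ m) (\<lambda>i. \<phi> (u i \<omega>))) p"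
  using b_pos by (simp add: vh Fh_emp)

lemma Fh_error: "Fh v \<omega> - p = net_error (\<lambda>y. of_bool (\<phi> y \<le> v)) \<omega> / N"
  unfolding net_error_def integral_sublevel Fh sum_subtractf using N_pos by (simp add: diff_divide_distrib)

lemma Kh_error: "Kh v \<omega> - (LINT y|uniform_cube. max (v - \<phi> y) 0) = net_error (\<lambda>y. max (v - \<phi> y) 0) \<omega> / N"
  unfolding net_error_def Kh sum_subtractf using N_pos by (simp add: diff_divide_distrib)

lemma expectation_net_error:
  assumes "L2 uniform_cube f"
  shows "expectation (net_error f) = 0"
proof -
  have f: "f \<in> borel_measurable uniform_cube" using assms by (simp add: L2_def)
  have "integrable M (\<lambda>\<omega>. f (u i \<omega>))" if "i < b ^ m" for i
    using integrable_u_iff[OF that f] U.L2_integrable[OF assms] by simp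
  then have "expectation (net_error f) = (\<Sum>i<b ^ m. expectation (\<lambda>\<omega>. f (u i \<omega>)) - (LINT x|uniform_cube. f x))"
    unfolding net_error_def[abs_def] by (subst Bochner_Integration.integral_sum) (auto simp: prob_space)
  also have "\<dots> = 0" using expectation_u[OF _ f] by simp
  finally show ?thesis .
qed

text \<open>The error has mean 0, so the constant e is the expectation of X.\<close>

lemma variance_eq_net_error:
  assumes f: "L2 uniform_cube f" and X: "\<And>\<omega>. X \<omega> - e = net_error f \<omega> / N"
  shows "variance X = expectation (\<lambda>\<omega>. (net_error f \<omega>)\<^sup>2) / N\<^sup>2"
proof -
  have X': "X = (\<lambda>\<omega>. net_error f \<omega> / N + e)" using X by (simp add: fun_eq_iff algebra_simps)
  have "integrable M (net_error f)" using L2_integrable[OF L2_net_error[OF f]] .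
  then have "expectation X = e"
    unfolding X' using expectation_net_error[OF f] by (simp add: prob_space)
  then show ?thesis by (simp add: X power_divide)
qed

lemmas variance_Fh = variance_eq_net_error[OF L2_sublevel Fh_error]
  and variance_Kh = variance_eq_net_error[OF L2K Kh_error]

text \<open>The event \<open>vh \<le> y\<close> is the event \<open>p \<le> Fh y\<close>, which
  makes the empirical quantile a random variable.\<close>

lemma ch_measurable: "ch \<in> borel_measurable M"
proof -
  have \<phi>u: "(\<lambda>\<omega>. \<phi> (u i \<omega>)) \<in> borel_measurable M" if "i < b ^ m" for i
    using f_u_measurable[OF that \<phi>] .
  have Fh_meas: "Fh x \<in> borel_measurable M" for x
  proof -
    have "(\<lambda>\<omega>. of_bool (\<phi> (u i \<omega>) \<le> x) :: real) \<in> borel_measurable M" if "i < b ^ m" for i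
    proof -
      note [measurable] = \<phi>u[OF that]
      show ?thesis by measurable
    qed
    then show ?thesis
      unfolding Fh[abs_def] by (intro borel_measurable_times borel_measurable_sum) auto
  qed
  have "vh \<in> borel_measurable M"
    unfolding borel_measurable_iff_le
  proof
    fix y
    have "{\<omega> \<in> space M. vh \<omega> \<le> y} = {\<omega> \<in> space M. p \<le> Fh y \<omega>}"
      using emp_quantile_le_iff[of "b ^ m" p] b_pos p by (simp add: vh_emp Fh_emp)
    also have "\<dots> \<in> events" using Fh_meas[of y] by measurable
    finally show "{\<omega> \<in> space M. vh \<omega> \<le> y} \<in> events" .
  qed
  then have "(\<lambda>\<omega>. Kh (vh \<omega>) \<omega>) \<in> borel_measurable M"
    unfolding Kh using \<phi>u
    by (intro borel_measurable_times borel_measurable_sum borel_measurable_max borel_measurable_diff) auto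
  with \<open>vh \<in> borel_measurable M\<close> show ?thesis
    unfolding ch[abs_def] by (intro borel_measurable_diff borel_measurable_times) auto
qed

text \<open>The error is split into -(1 / p) times the integration error of \<open>Kh v\<close> and
  the gain D from optimizing at \<open>vh\<close> instead of v. Each square is doubled, and D is at
  most R / p times the error of \<open>Fh v\<close>.\<close>

lemma cvar_mse_le:
  assumes dev: "AE \<omega> in M. \<bar>vh \<omega> - v\<bar> \<le> R"
  shows "integrable M (\<lambda>\<omega>. (ch \<omega> - c)\<^sup>2)"
    and "expectation (\<lambda>\<omega>. (ch \<omega> - c)\<^sup>2) \<le> 2 / p\<^sup>2 * variance (Kh v) + 2 * (R / p)\<^sup>2 * variance (Fh v)"
proof -
  let ?K = "net_error (\<lambda>y. max (v - \<phi> y) 0)" and ?F = "net_error (\<lambda>y. of_bool (\<phi> y \<le> v))"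
  let ?B = "\<lambda>\<omega>. 2 / p\<^sup>2 * ((?K \<omega>)\<^sup>2 / N\<^sup>2) + 2 * (R / p)\<^sup>2 * ((?F \<omega>)\<^sup>2 / N\<^sup>2)"
  have bound: "AE \<omega> in M. (ch \<omega> - c)\<^sup>2 \<le> ?B \<omega>"
    using dev
  proof eventually_elim
    case (elim \<omega>)
    define D where "D = (vh \<omega> - Kh (vh \<omega>) \<omega> / p) - (v - Kh v \<omega> / p)"
    have "\<bar>D\<bar> \<le> R / p * \<bar>Fh v \<omega> - p\<bar>"
      unfolding D_def using elim b_pos p emp_cvar_deviation[of "b ^ m" p "\<lambda>i. \<phi> (u i \<omega>)" v R]
      by (simp add: vh_emp Kh_emp Fh_emp)
    then have "D\<^sup>2 \<le> (R / p * \<bar>Fh v \<omega> - p\<bar>)\<^sup>2"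
      by (metis abs_ge_zero power2_abs power_mono)
    then have D2: "D\<^sup>2 \<le> (R / p)\<^sup>2 * ((?F \<omega>)\<^sup>2 / N\<^sup>2)"
      by (simp add: Fh_error power_mult_distrib power_divide)
    have "ch \<omega> - c = D + - (1 / p) * (?K \<omega> / N)"
      unfolding Kh_error[symmetric] by (simp add: ch c D_def diff_divide_distrib algebra_simps)
    then have "(ch \<omega> - c)\<^sup>2 \<le> 2 * D\<^sup>2 + 2 * (- (1 / p) * (?K \<omega> / N))\<^sup>2"
      by (simp only: square_add_le)
    also have "(- (1 / p) * (?K \<omega> / N))\<^sup>2 = 1 / p\<^sup>2 * ((?K \<omega>)\<^sup>2 / N\<^sup>2)"
      by (simp add: power_mult_distrib power_divide)
    finally show ?case using D2 by simp
  qed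
  have K_int: "integrable M (\<lambda>\<omega>. (?K \<omega>)\<^sup>2)" and F_int: "integrable M (\<lambda>\<omega>. (?F \<omega>)\<^sup>2)"
    using L2_net_error[OF L2K] L2_net_error[OF L2_sublevel] by (simp_all add: L2_def)
  then have B_int: "integrable M ?B" by simp
  show int: "integrable M (\<lambda>\<omega>. (ch \<omega> - c)\<^sup>2)"
  proof (rule Bochner_Integration.integrable_bound[OF B_int])
    show "(\<lambda>\<omega>. (ch \<omega> - c)\<^sup>2) \<in> borel_measurable M"
      using ch_measurable by measurable
    show "AE \<omega> in M. norm ((ch \<omega> - c)\<^sup>2) \<le> norm (?B \<omega>)"
      using bound by eventually_elim simp
  qed
  have "expectation (\<lambda>\<omega>. (ch \<omega> - c)\<^sup>2) \<le> expectation ?B"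
    using bound by (intro integral_mono_AE int B_int)
  also have "\<dots> = 2 / p\<^sup>2 * variance (Kh v) + 2 * (R / p)\<^sup>2 * variance (Fh v)"
    unfolding variance_Kh variance_Fh using K_int F_int by simp
  finally show "expectation (\<lambda>\<omega>. (ch \<omega> - c)\<^sup>2) \<le> 2 / p\<^sup>2 * variance (Kh v) + 2 * (R / p)\<^sup>2 * variance (Fh v)" .
qed

lemma variance_Fh_le: "variance (Fh v) \<le> 4 * real (b ^ (t + CARD('d))) / N"
proof -
  have "(LINT y|uniform_cube. (of_bool (\<phi> y \<le> v) :: real)\<^sup>2) = p"
    using integral_sublevel by (simp add: power2_eq_square flip: of_bool_conj)
  then have "variance (Fh v) \<le> 4 * real (b ^ (t + CARD('d))) * N * p / N\<^sup>2"
    unfolding variance_Fh using net_error_L2[OF L2_sublevel] by (intro divide_right_mono) simp_all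
  also have "\<dots> = 4 * real (b ^ (t + CARD('d))) / N * p"
    using N_pos by (simp add: power2_eq_square)
  also have "\<dots> \<le> 4 * real (b ^ (t + CARD('d))) / N"
    using p by (intro mult_left_le) simp_all
  finally show ?thesis .
qed

lemma variance_Kh_le:
  assumes "step_fun b (\<lambda>_. k) s" "k * CARD('d) + t \<le> m"
    and "(LINT y|uniform_cube. (max (v - \<phi> y) 0 - s y)\<^sup>2) \<le> e"
  shows "variance (Kh v) \<le> 4 * real (b ^ (t + CARD('d))) / N * e"
proof -
  have "variance (Kh v) \<le> 4 * real (b ^ (t + CARD('d))) * N *
      (LINT y|uniform_cube. (max (v - \<phi> y) 0 - s y)\<^sup>2) / N\<^sup>2"
    unfolding variance_Kh by (intro divide_right_mono net_error_L2_minus_step_fun[OF L2K assms(1,2)]) simp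
  also have "\<dots> = 4 * real (b ^ (t + CARD('d))) / N * (LINT y|uniform_cube. (max (v - \<phi> y) 0 - s y)\<^sup>2)"
    using N_pos by (simp add: power2_eq_square)
  also have "\<dots> \<le> 4 * real (b ^ (t + CARD('d))) / N * e"
    by (intro mult_left_mono assms) simp
  finally show ?thesis .
qed

lemma AE_vh_deviation:
  assumes k: "k * CARD('d) + t \<le> m" and r: "0 \<le> r"
    and bd: "\<And>y. y \<in> {v - R, v + R} \<Longrightarrow>
      emeasure lborel (thickening (frontier (sublevel \<phi> y)) (sqrt (real CARD('d)) / real b ^ k)) \<le> ennreal r"
    and F: "\<And>y. F y = measure uniform_cube (sublevel \<phi> y)"
    and FR: "p \<le> F (v + R) - r" "F (v - R) + r < p"
  shows "AE \<omega> in M. \<bar>vh \<omega> - v\<bar> \<le> R"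
  using AE_regular
proof eventually_elim
  case (elim \<omega>)
  have "\<bar>Fh y \<omega> - F y\<bar> \<le> r" if "y \<in> {v - R, v + R}" for y
    unfolding F Fh using net_discrepancy_sublevel[OF b_pos tmd_net_u[OF elim] k \<phi> bd[OF that] r] by simp
  then show ?case
    using emp_quantile_deviation[of "b ^ m" p F v R r "\<lambda>i. \<phi> (u i \<omega>)"] b_pos p FR
    by (simp add: vh_emp Fh_emp)
qed

end


theorem theorem4p2:
  fixes \<phi> :: "real ^ 'd::finite \<Rightarrow> real"
    and F f\<^sub>X g :: "real \<Rightarrow> real" and p v c :: real
    and b t :: nat
    and M :: "nat \<Rightarrow> 'w measure"
    and u :: "nat \<Rightarrow> nat \<Rightarrow> 'w \<Rightarrow> real ^ 'd"
    and Fhat Khat :: "nat \<Rightarrow> real \<Rightarrow> 'w \<Rightarrow> real"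
    and vhat chat :: "nat \<Rightarrow> 'w \<Rightarrow> real"
    and N a :: "nat \<Rightarrow> real"
  assumes \<phi>_measurable: "\<phi> \<in> borel_measurable uniform_cube"
    and F_eq: "F = cdf (distr uniform_cube borel \<phi>)"
    and p: "0 < p" "p < 1"
    and v_eq: "v = quantile F p"
    and c_eq: "c = v - 1 / p * (LINT y|uniform_cube. max (v - \<phi> y) 0)"
    and A: "has_density_near F f\<^sub>X v" "0 < f\<^sub>X v" "isCont f\<^sub>X v"
    and B: "boundary_condition \<phi> v g"
    and C: "integrable uniform_cube (\<lambda>y. (max (v - \<phi> y) 0)\<^sup>2)"
    and b: "2 \<le> b"
    and N_eq: "\<And>m. N m = real (b ^ m)"
    and net: "\<And>m. t \<le> m \<Longrightarrow> scrambled_net (M m) b t m (u m)"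
    and Fhat_eq: "\<And>m x \<omega>. Fhat m x \<omega> = 1 / N m * (\<Sum>i<b ^ m. of_bool (\<phi> (u m i \<omega>) \<le> x))"
    and Khat_eq: "\<And>m x \<omega>. Khat m x \<omega> = 1 / N m * (\<Sum>i<b ^ m. max (x - \<phi> (u m i \<omega>)) 0)"
    and vhat_eq: "\<And>m \<omega>. vhat m \<omega> = quantile (\<lambda>x. Fhat m x \<omega>) p"
    and chat_eq: "\<And>m \<omega>. chat m \<omega> = vhat m \<omega> - 1 / p * Khat m (vhat m \<omega>) \<omega>"
    and a_eq: "\<And>m. a m = 8 * (g (sqrt (real CARD('d)) * real b powr (1 + real t / real CARD('d))
                                 * N m powr (- 1 / real CARD('d))) / (p * f\<^sub>X v))\<^sup>2"
  shows "(\<forall>\<^sub>F m in sequentially.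
            integrable (M m) (\<lambda>\<omega>. (chat m \<omega> - c)\<^sup>2) \<and>
            prob_space.expectation (M m) (\<lambda>\<omega>. (chat m \<omega> - c)\<^sup>2)
              \<le> 2 / p\<^sup>2 * prob_space.variance (M m) (Khat m v)
                + a m * (4 / (N m)\<^sup>2 + prob_space.variance (M m) (Fhat m v))) \<and>
         a \<longlonglongrightarrow> 0 \<and>
         (\<lambda>m. prob_space.expectation (M m) (\<lambda>\<omega>. (chat m \<omega> - c)\<^sup>2)) \<in> o(\<lambda>m. 1 / N m) \<and>
         (bounded_hk_variation \<phi> \<and> (\<exists>\<kappa>>0. boundary_condition \<phi> v (\<lambda>\<epsilon>. \<kappa> * \<epsilon>)) \<longrightarrow>
            (\<forall>\<epsilon>>0. (\<lambda>m. prob_space.expectation (M m) (\<lambda>\<omega>. (chat m \<omega> - c)\<^sup>2))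
                      \<in> O(\<lambda>m. N m powr (- 1 - 1 / (2 * real CARD('d) - 1) + \<epsilon>))))"
proof -
  let ?d = "CARD('d)"
  have b0: "0 < b" using b by simp
  have d0: "0 < ?d" by simp
  have N_pos: "0 < N m" for m using b0 by (simp add: N_eq)
  have N_top: "filterlim N at_top sequentially"
    unfolding N_eq[abs_def] of_nat_power using b
    by (intro filterlim_at_infinity_imp_filterlim_at_top filterlim_realpow_sequentially_gt1) auto
  have F_measure: "F y = measure uniform_cube (sublevel \<phi> y)" for y
  proof -
    have "\<phi> -` {..y} \<inter> space uniform_cube = sublevel \<phi> y" by (auto simp: sublevel_def)
    then show ?thesis unfolding F_eq cdf_def using \<phi>_measurable by (simp add: measure_distr)
  qed
  obtain \<eta> where \<eta>: "0 < \<eta>"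
    and inc: "\<And>x y. \<bar>x - v\<bar> \<le> \<eta> \<and> \<bar>y - v\<bar> \<le> \<eta> \<and> x < y \<Longrightarrow>
      3 / 4 * f\<^sub>X v * (y - x) \<le> F y - F x \<and> F y - F x \<le> 2 * f\<^sub>X v * (y - x)"
    using density_increment_bounds[OF A] by blast
  have Fv: "F v = p"
    unfolding F_eq
  proof (rule cdf_quantile_eq[OF _ _ p _ \<eta>])
    show "prob_space (distr uniform_cube borel \<phi>)"
      by (rule U.prob_space_distr[OF \<phi>_measurable])
    show "cdf (distr uniform_cube borel \<phi>) y - cdf (distr uniform_cube borel \<phi>) x \<le> 2 * f\<^sub>X v * (y - x)"
      if "\<bar>x - v\<bar> \<le> \<eta> \<and> \<bar>y - v\<bar> \<le> \<eta> \<and> x < y" for x y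
      using inc[OF that] unfolding F_eq by blast
  qed (use v_eq F_eq in simp_all)
  have pF: "measure uniform_cube (sublevel \<phi> v) = p" using Fv F_measure by simp
  have L2K: "L2 uniform_cube (\<lambda>y. max (v - \<phi> y) 0)"
    unfolding L2_def using C \<phi>_measurable by simp
  have estimation: "\<exists>a' \<pi>. cvar_estimation (M m) b t m a' \<pi> (u m) \<phi> p v c (Fhat m) (Khat m) (vhat m) (chat m)"
    if m: "t \<le> m" for m
  proof -
    have "prob_space (M m)" using net[OF m] by (simp add: scrambled_net_def)
    moreover obtain a' \<pi> where "tmd_net b t m a'" "iid_uniform_permutations (M m) b \<pi>"
      "\<forall>i<b ^ m. \<forall>\<omega>\<in>space (M m). u m i \<omega> = scramble b (\<lambda>j l. \<pi> j l \<omega>) (a' i)"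
      using net[OF m] unfolding scrambled_net_def by blast
    ultimately have "net_scrambling (M m) b t m a' \<pi> (u m)"
      by (simp add: net_scrambling_def net_scrambling_axioms_def b)
    then have "cvar_estimation (M m) b t m a' \<pi> (u m) \<phi> p v c (Fhat m) (Khat m) (vhat m) (chat m)"
      unfolding cvar_estimation_def cvar_estimation_axioms_def
      using \<phi>_measurable p L2K pF c_eq by (simp add: Fhat_eq Khat_eq vhat_eq chat_eq N_eq)
    then show ?thesis by blast
  qed
  define varF where "varF m = prob_space.variance (M m) (Fhat m v)" for m
  define varK where "varK m = prob_space.variance (M m) (Khat m v)" for m
  define mse where "mse m = prob_space.expectation (M m) (\<lambda>\<omega>. (chat m \<omega> - c)\<^sup>2)" for m
  define K where "K = 4 * real (b ^ (t + ?d))"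
  define \<epsilon> where "\<epsilon> m = sqrt (real ?d) * real b powr (1 + real t / real ?d) * N m powr (- 1 / real ?d)" for m
  \<comment> \<open>The largest depth at which cubic cells still have volume at least b^(t -
    m).\<close>
  define k where "k m = (m - t) div ?d" for m
  have K0: "0 \<le> K" by (simp add: K_def)
  have varF_nonneg: "0 \<le> varF m" and mse_nonneg: "0 \<le> mse m" for m
    by (simp_all add: varF_def mse_def)
  have varF_le: "varF m \<le> K / N m" if m: "t \<le> m" for m
  proof -
    obtain a' \<pi> where "cvar_estimation (M m) b t m a' \<pi> (u m) \<phi> p v c (Fhat m) (Khat m) (vhat m) (chat m)"
      using estimation[OF m] by blast
    then interpret cvar_estimation "M m" b t m a' \<pi> "u m" \<phi> p v c "Fhat m" "Khat m" "vhat m" "chat m" .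
    show ?thesis using variance_Fh_le by (simp add: varF_def K_def N_eq)
  qed
  have varK_le: "varK m \<le> K / N m * e"
    if m: "l * ?d + t \<le> m" and s: "step_fun b (\<lambda>_. l) s"
      and e: "(LINT y|uniform_cube. (max (v - \<phi> y) 0 - s y)\<^sup>2) \<le> e" for m l s e
  proof -
    obtain a' \<pi> where "cvar_estimation (M m) b t m a' \<pi> (u m) \<phi> p v c (Fhat m) (Khat m) (vhat m) (chat m)"
      using estimation[of m] m by auto
    then interpret cvar_estimation "M m" b t m a' \<pi> "u m" \<phi> p v c "Fhat m" "Khat m" "vhat m" "chat m" .
    show ?thesis using variance_Kh_le[OF s m e] by (simp add: varK_def K_def N_eq)
  qed
  have k_le: "k m * ?d + t \<le> m" if "t \<le> m" for m
  proof -
    have "k m * ?d \<le> m - t" by (simp add: k_def)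
    then show ?thesis using that by simp
  qed
  have cell_diameter: "sqrt (real ?d) / real b ^ k m \<le> \<epsilon> m" if m: "t \<le> m" for m
  proof -
    \<comment> \<open>Rounding down loses less than one digit per coordinate, which is the 1 in the
      exponent 1 + t / d.\<close>
    have "m - t < ?d * (k m + 1)"
      unfolding k_def using dividend_less_div_times[OF d0, of "m - t"] by (simp add: algebra_simps)
    then have "real (m - t) < real (?d * (k m + 1))" by (simp only: of_nat_less_iff)
    then have "real m - real t < real ?d * (real (k m) + 1)"
      using m by (simp add: of_nat_diff algebra_simps)
    then have "(real m - real t) / real ?d < real (k m) + 1"
      using d0 by (simp add: pos_divide_less_eq mult.commute)
    then have "- real (k m) \<le> 1 + real t / real ?d - real m / real ?d"
      by (simp add: diff_divide_distrib)
    then have "real b powr (- real (k m)) \<le> real b powr (1 + real t / real ?d - real m / real ?d)"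
      using b by (intro powr_mono) auto
    also have "\<dots> = real b powr (1 + real t / real ?d) * N m powr (- 1 / real ?d)"
    proof -
      have "N m powr (- 1 / real ?d) = real b powr (real m * (- 1 / real ?d))"
        using b0 by (simp add: N_eq powr_powr flip: powr_realpow)
      then show ?thesis by (simp flip: powr_add)
    qed
    also have "real b powr (- real (k m)) = 1 / real b ^ k m"
      using b0 by (simp add: powr_minus_divide powr_realpow)
    finally have "sqrt (real ?d) * (1 / real b ^ k m)
        \<le> sqrt (real ?d) * (real b powr (1 + real t / real ?d) * N m powr (- 1 / real ?d))"
      by (intro mult_left_mono) auto
    then show ?thesis by (simp add: \<epsilon>_def mult.assoc)
  qed
  have \<epsilon>_pos: "0 < \<epsilon> m" for m
    using b0 N_pos[of m] by (simp add: \<epsilon>_def)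
  have \<epsilon>_lim: "\<epsilon> \<longlonglongrightarrow> 0"
  proof -
    have "(\<lambda>m. N m powr (- 1 / real ?d)) \<longlonglongrightarrow> 0"
      using d0 by (intro tendsto_neg_powr N_top) simp
    from tendsto_mult_right_zero[OF this] show ?thesis by (simp add: \<epsilon>_def[abs_def])
  qed
  have \<epsilon>_at_right: "filterlim \<epsilon> (at_right 0) sequentially"
    using \<epsilon>_lim \<epsilon>_pos by (auto simp: filterlim_at less_imp_neq[symmetric])
  have boundary_lim: "(\<lambda>m. h (\<epsilon> m)) \<longlonglongrightarrow> 0" if "boundary_condition \<phi> v h" for h
  proof -
    have "(h \<longlongrightarrow> 0) (at_right 0)" using that by (simp add: boundary_condition_def)
    then show ?thesis by (rule filterlim_compose[OF _ \<epsilon>_at_right])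
  qed
  \<comment> \<open>Stated for any admissible h, as it is used with g for (1) and (2) and with the
    linear bound for (3).\<close>
  have mse_le: "\<forall>\<^sub>F m in sequentially. integrable (M m) (\<lambda>\<omega>. (chat m \<omega> - c)\<^sup>2) \<and>
      mse m \<le> 2 / p\<^sup>2 * varK m + 8 * (h (\<epsilon> m) / (p * f\<^sub>X v))\<^sup>2 * varF m"
    if h: "boundary_condition \<phi> v h" for h
  proof -
    obtain \<delta> \<epsilon>0 where \<delta>: "0 < \<delta>" "0 < \<epsilon>0" and bd: "\<And>e. 0 < e \<and> e \<le> \<epsilon>0 \<Longrightarrow>
      (SUP x\<in>{x. \<bar>x - v\<bar> \<le> \<delta>}. emeasure lborel (thickening (frontier (sublevel \<phi> x)) e)) \<le> ennreal (h e)"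
      using h unfolding boundary_condition_def by blast
    have h_pos: "0 < h e" if "0 < e" for e using h that by (simp add: boundary_condition_def)
    have "(\<lambda>m. 2 * h (\<epsilon> m) / f\<^sub>X v) \<longlonglongrightarrow> 0"
      using tendsto_divide_zero[OF tendsto_mult_right_zero[OF boundary_lim[OF h]]] .
    then have "\<forall>\<^sub>F m in sequentially. 2 * h (\<epsilon> m) / f\<^sub>X v < min \<delta> \<eta>"
      using \<delta> \<eta> by (intro order_tendstoD(2)) auto
    moreover have "\<forall>\<^sub>F m in sequentially. \<epsilon> m < \<epsilon>0"
      using \<epsilon>_lim \<delta> by (intro order_tendstoD(2)) auto
    ultimately show ?thesis
      using eventually_ge_at_top[of t]
    proof eventually_elim
      case (elim m)
      define r where "r = h (\<epsilon> m)"
      \<comment> \<open>With this radius 2 (R / p)^2 is exactly the factor 8 (h / (p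
        f_X(v)))^2.\<close>
      define R where "R = 2 * r / f\<^sub>X v"
      have r: "0 < r" using h_pos \<epsilon>_pos by (simp add: r_def)
      have R: "0 < R" "R < \<delta>" "R < \<eta>" "f\<^sub>X v * R = 2 * r"
        using r A(2) elim by (auto simp: R_def r_def)
      obtain a' \<pi> where "cvar_estimation (M m) b t m a' \<pi> (u m) \<phi> p v c (Fhat m) (Khat m) (vhat m) (chat m)"
        using estimation[OF elim(3)] by blast
      then interpret cvar_estimation "M m" b t m a' \<pi> "u m" \<phi> p v c "Fhat m" "Khat m" "vhat m" "chat m" .
      have "AE \<omega> in M m. \<bar>vhat m \<omega> - v\<bar> \<le> R"
      proof (rule AE_vh_deviation[OF k_le[OF elim(3)] less_imp_le[OF r] _ F_measure])
        fix y assume "y \<in> {v - R, v + R}"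
        then have y: "\<bar>y - v\<bar> \<le> \<delta>" using R by auto
        let ?A = "frontier (sublevel \<phi> y)"
        have "thickening ?A (sqrt (real ?d) / real b ^ k m) \<subseteq> thickening ?A (\<epsilon> m)"
          using cell_diameter[OF elim(3)] by (auto simp: thickening_def intro: order_trans)
        moreover have "thickening ?A (\<epsilon> m) \<in> sets lborel"
          using borel_compact[OF compact_thickening[OF compact_frontier_bounded[OF bounded_sublevel[of \<phi> y]]]]
          by simp
        ultimately have "emeasure lborel (thickening ?A (sqrt (real ?d) / real b ^ k m))
            \<le> emeasure lborel (thickening ?A (\<epsilon> m))"
          by (rule emeasure_mono)
        also have "\<dots> \<le> (SUP x\<in>{x. \<bar>x - v\<bar> \<le> \<delta>}. emeasure lborel (thickening (frontier (sublevel \<phi> x)) (\<epsilon> m)))"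
          using y by (intro SUP_upper) simp
        also have "\<dots> \<le> ennreal r"
          unfolding r_def using bd[of "\<epsilon> m"] \<epsilon>_pos elim(2) by simp
        finally show "emeasure lborel (thickening ?A (sqrt (real ?d) / real b ^ k m)) \<le> ennreal r" .
      next
        have "3 / 4 * f\<^sub>X v * R \<le> F (v + R) - F v" "3 / 4 * f\<^sub>X v * R \<le> F v - F (v - R)"
          using inc[of v "v + R"] inc[of "v - R" v] R \<eta> by auto
        \<comment> \<open>The increment of F exceeds the discrepancy r by r / 2, which gives the
          strict inequality required on the left.\<close>
        moreover have "3 / 4 * f\<^sub>X v * R = 3 / 2 * r" unfolding mult.assoc R(4) by simp
        ultimately show "p \<le> F (v + R) - r" "F (v - R) + r < p"
          using Fv r by linarith+
      qed
      note mse = cvar_mse_le[OF this]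
      have "2 * (R / p)\<^sup>2 = 8 * (h (\<epsilon> m) / (p * f\<^sub>X v))\<^sup>2"
        by (simp add: R_def r_def power_divide power_mult_distrib mult.commute)
      then show ?case using mse unfolding mse_def varK_def varF_def by simp
    qed
  qed
  have a_eq': "a m = 8 * (g (\<epsilon> m) / (p * f\<^sub>X v))\<^sup>2" for m by (simp add: a_eq \<epsilon>_def)
  have a_nonneg: "0 \<le> a m" for m by (simp add: a_eq')
  have a_lim: "a \<longlonglongrightarrow> 0"
  proof -
    have "(\<lambda>m. (g (\<epsilon> m) / (p * f\<^sub>X v))\<^sup>2) \<longlonglongrightarrow> 0"
      using tendsto_power[OF tendsto_divide_zero[OF boundary_lim[OF B]], of _ 2] by simp
    then show ?thesis unfolding a_eq'[abs_def] by (rule tendsto_mult_right_zero)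
  qed
  have part1: "\<forall>\<^sub>F m in sequentially. integrable (M m) (\<lambda>\<omega>. (chat m \<omega> - c)\<^sup>2) \<and>
      mse m \<le> 2 / p\<^sup>2 * varK m + a m * (4 / (N m)\<^sup>2 + varF m)"
    using mse_le[OF B]
  proof eventually_elim
    case (elim m)
    have "a m * varF m \<le> a m * (4 / (N m)\<^sup>2 + varF m)"
      using a_nonneg by (intro mult_left_mono) auto
    then show ?case using elim unfolding a_eq'[symmetric] by auto
  qed
  have part2: "mse \<in> o(\<lambda>m. 1 / N m)"
  proof (rule smalloI_tendsto)
    show "\<forall>\<^sub>F m in sequentially. 1 / N m \<noteq> 0"
    proof (rule always_eventually, rule allI)
      show "1 / N m \<noteq> 0" for m using N_pos[of m] by simp
    qed
    have "(\<lambda>m. N m * mse m) \<longlonglongrightarrow> 0"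
    proof (rule order_tendstoI)
      fix y :: real assume "y < 0"
      moreover have "0 \<le> N m * mse m" for m using N_pos[of m] mse_nonneg by simp
      ultimately show "\<forall>\<^sub>F m in sequentially. y < N m * mse m"
        by (intro always_eventually allI) (meson less_le_trans)
    next
      fix y :: real assume y: "0 < y"
      \<comment> \<open>Chosen so that the contribution of \<open>varK\<close> to N times the error
        stays below y / 2; K + 1 keeps the denominator positive.\<close>
      define e where "e = y * p\<^sup>2 / (4 * (K + 1))"
      have e: "0 < e" using y p K0 by (simp add: e_def)
      obtain l s where s: "step_fun b (\<lambda>_. l) s" "(LINT z|uniform_cube. (max (v - \<phi> z) 0 - s z)\<^sup>2) \<le> e"
        using L2_approximable[OF b L2K] e unfolding approximable_def by meson
      have Ke: "2 / p\<^sup>2 * (K * e) \<le> y / 2"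
      proof -
        have "2 / p\<^sup>2 * (K * e) = y / 2 * (K / (K + 1))"
        proof -
          have "K + 1 \<noteq> 0" using K0 by simp
          then show ?thesis using p by (simp add: e_def divide_simps)
        qed
        also have "\<dots> \<le> y / 2 * 1"
          using y K0 by (intro mult_left_mono) auto
        finally show ?thesis by simp
      qed
      have "(\<lambda>m. a m * K) \<longlonglongrightarrow> 0" using tendsto_mult_left_zero[OF a_lim] .
      then have "\<forall>\<^sub>F m in sequentially. a m * K < y / 2"
        using y by (intro order_tendstoD(2)) auto
      with mse_le[OF B] eventually_ge_at_top[of "l * ?d + t"]
      show "\<forall>\<^sub>F m in sequentially. N m * mse m < y"
      proof eventually_elim
        case (elim m)
        have "mse m \<le> 2 / p\<^sup>2 * varK m + a m * varF m" using elim(1) by (simp add: a_eq')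
        also have "\<dots> \<le> 2 / p\<^sup>2 * (K / N m * e) + a m * (K / N m)"
          using varK_le[OF elim(2) s] varF_le[of m] elim(2) a_nonneg
          by (intro add_mono mult_left_mono) auto
        finally have "N m * mse m \<le> N m * (2 / p\<^sup>2 * (K / N m * e) + a m * (K / N m))"
          using N_pos[of m] by (intro mult_left_mono) auto
        also have "\<dots> = 2 / p\<^sup>2 * (K * e) + a m * K"
          using N_pos[of m] by (simp add: field_simps)
        finally show ?case using Ke elim(3) by linarith
      qed
    qed
    then show "(\<lambda>m. mse m / (1 / N m)) \<longlonglongrightarrow> 0" by (simp add: mult.commute)
  qed
  have part3: "mse \<in> O(\<lambda>m. N m powr (- 1 - 1 / (2 * real ?d - 1) + e))"
    if hk: "bounded_hk_variation \<phi>" and \<kappa>: "\<kappa> > 0" "boundary_condition \<phi> v (\<lambda>\<epsilon>. \<kappa> * \<epsilon>)" and e: "e > 0"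
    for \<kappa> e
  proof -
    obtain V where V: "0 \<le> V" "\<And>l. integrable uniform_cube (\<lambda>x. (\<phi> x - \<phi> (corner b (\<lambda>_. l) (cells b (\<lambda>_. l) x)))\<^sup>2)"
      "\<And>l. (LINT x|uniform_cube. (\<phi> x - \<phi> (corner b (\<lambda>_. l) (cells b (\<lambda>_. l) x)))\<^sup>2) \<le> V / real b ^ l"
      using hk_step_approximation[OF b \<phi>_measurable hk] by blast
    define s where "s l x = max (v - \<phi> (corner b (\<lambda>_. l) (cells b (\<lambda>_. l) x))) 0" for l x
    have s: "step_fun b (\<lambda>_. l) (s l)" for l by (simp add: step_fun_def s_def)
    have s_le: "(LINT y|uniform_cube. (max (v - \<phi> y) 0 - s l y)\<^sup>2) \<le> V / real b ^ l" for l
    proof -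
      have "(LINT y|uniform_cube. (max (v - \<phi> y) 0 - s l y)\<^sup>2)
          \<le> (LINT x|uniform_cube. (\<phi> x - \<phi> (corner b (\<lambda>_. l) (cells b (\<lambda>_. l) x)))\<^sup>2)"
      proof (rule integral_mono)
        show "integrable uniform_cube (\<lambda>y. (max (v - \<phi> y) 0 - s l y)\<^sup>2)"
          using L2_diff[OF L2K step_fun_L2[OF b0 s]] by (simp add: L2_def)
        \<comment> \<open>Taking the positive part of v - x is a contraction, so the approximation
          of \<phi> carries over to the integrand.\<close>
        show "(max (v - \<phi> y) 0 - s l y)\<^sup>2 \<le> (\<phi> y - \<phi> (corner b (\<lambda>_. l) (cells b (\<lambda>_. l) y)))\<^sup>2" for y
          unfolding s_def by (intro abs_le_square_iff[THEN iffD1]) (auto simp: max_def)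
      qed (rule V(2))
      then show ?thesis using V(3)[of l] by linarith
    qed
    define A1 where "A1 = 2 / p\<^sup>2 * (K * V)"
    define A2 where "A2 = 8 * (\<kappa> / (p * f\<^sub>X v))\<^sup>2 * K"
    define c0 where "c0 = sqrt (real ?d) * real b powr (1 + real t / real ?d)"
    have A: "0 \<le> A1" "0 \<le> A2" "0 \<le> c0" using K0 V(1) by (simp_all add: A1_def A2_def c0_def)
    have "\<forall>\<^sub>F m in sequentially. \<epsilon> m < 1"
      using \<epsilon>_lim by (intro order_tendstoD(2)) auto
    with mse_le[OF \<kappa>(2)] eventually_ge_at_top[of t]
    have "\<forall>\<^sub>F m in sequentially. norm (mse m) \<le> ((A1 + A2) * c0) * norm (N m powr (- 1 - 1 / (2 * real ?d - 1) + e))"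
    proof eventually_elim
      case (elim m)
      have "1 / real b ^ k m \<le> sqrt (real ?d) / real b ^ k m"
        using b0 by (intro divide_right_mono) (auto simp: Suc_le_eq)
      then have bk: "1 / real b ^ k m \<le> \<epsilon> m" using cell_diameter[OF elim(2)] by linarith
      \<comment> \<open>Both contributions are thus of order \<epsilon> m / N m, that is N^(-1 -
        1/d): the first through b^(-k) <= \<epsilon> m, the second through this bound.\<close>
      have sq: "(\<epsilon> m)\<^sup>2 \<le> \<epsilon> m"
        using \<epsilon>_pos[of m] elim(3) by (simp add: power2_eq_square mult_left_le)
      have "mse m \<le> 2 / p\<^sup>2 * varK m + 8 * (\<kappa> * \<epsilon> m / (p * f\<^sub>X v))\<^sup>2 * varF m"
        using elim(1) by simp
      also have "\<dots> \<le> 2 / p\<^sup>2 * (K / N m * (V / real b ^ k m)) + 8 * (\<kappa> * \<epsilon> m / (p * f\<^sub>X v))\<^sup>2 * (K / N m)"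
        using varK_le[OF k_le[OF elim(2)] s s_le] varF_le[OF elim(2)]
        by (intro add_mono mult_left_mono) auto
      also have "\<dots> = (A1 * (1 / real b ^ k m) + A2 * (\<epsilon> m)\<^sup>2) / N m"
        by (simp add: A1_def A2_def add_divide_distrib power_mult_distrib power_divide mult_ac)
      also have "\<dots> \<le> (A1 * \<epsilon> m + A2 * \<epsilon> m) / N m"
        using bk sq A N_pos[of m] by (intro divide_right_mono add_mono mult_left_mono) auto
      also have "\<dots> = ((A1 + A2) * c0) * (N m powr (- 1 / real ?d) / N m)"
      proof -
        have "\<epsilon> m = c0 * N m powr (- 1 / real ?d)" by (simp add: \<epsilon>_def c0_def)
        then show ?thesis by (simp add: algebra_simps add_divide_distrib)
      qed
      also have "N m powr (- 1 / real ?d) / N m = N m powr (- 1 / real ?d - 1)"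
        using N_pos[of m] by (simp add: powr_diff)
      also have "((A1 + A2) * c0) * N m powr (- 1 / real ?d - 1)
          \<le> ((A1 + A2) * c0) * N m powr (- 1 - 1 / (2 * real ?d - 1) + e)"
      proof (intro mult_left_mono powr_mono)
        \<comment> \<open>From d <= 2 d - 1, the exponent -1 - 1/d obtained here is at most the one
          claimed.\<close>
        have "1 \<le> real ?d" by (simp add: Suc_le_eq)
        then have "0 < real ?d" "real ?d \<le> 2 * real ?d - 1" by linarith+
        then have "1 / (2 * real ?d - 1) \<le> 1 / real ?d"
          by (rule frac_le[OF zero_le_one order_refl])
        then show "- 1 / real ?d - 1 \<le> - 1 - 1 / (2 * real ?d - 1) + e" using e by simp
        show "1 \<le> N m" using b0 by (simp add: N_eq)
      qed (use A in simp)
      finally show ?case using mse_nonneg by simp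
    qed
    then show ?thesis by (rule bigoI)
  qed
  show ?thesis
    using part1 a_lim part2 part3
    unfolding mse_def varK_def varF_def by blast
qed

end
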